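(* There exists a sentence $Isom$ of the language of rings such that: (1) $\mathbb{A}_K(X)\models Isom$ for every infinite field $K$ and every set $X$ with $|X|\ge2$; (2) for every unitary ring $A$, if $A\models Isom$ then all proper centralizers of $A$ of the form $C_A(P)=\{a\in A: aP=Pa\}$, $P\in A$, $C_A(P)\neq A$, are isomorphic to each other (as rings).
   Context: $\mathbb{A}_K(X)$ denotes the free associative unitary algebra over $K$ with free basis $X$; the language of rings is $\{+,\cdot,0,1\}$. *)

theory Defs
  imports "HOL-Algebra.Algebra"
begin

subsection \<open>First-order logic over the language of rings\<close>

datatype rterm =
    Var nat
  | Zero
  | One
  | Add rterm rterm
  | Mul rterm rterm

datatype rform =
    Eq rterm rterm
  | Neg rform
  | Conj rform rform
  | Disj rform rform
  | Imp rform rform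
  | All nat rform
  | Ex nat rform

primrec tvars :: "rterm \<Rightarrow> nat set" where
  "tvars (Var n) = {n}"
| "tvars Zero = {}"
| "tvars One = {}"
| "tvars (Add s t) = tvars s \<union> tvars t"
| "tvars (Mul s t) = tvars s \<union> tvars t"

primrec fvars :: "rform \<Rightarrow> nat set" where
  "fvars (Eq s t) = tvars s \<union> tvars t"
| "fvars (Neg \<phi>) = fvars \<phi>"
| "fvars (Conj \<phi> \<psi>) = fvars \<phi> \<union> fvars \<psi>"
| "fvars (Disj \<phi> \<psi>) = fvars \<phi> \<union> fvars \<psi>"
| "fvars (Imp \<phi> \<psi>) = fvars \<phi> \<union> fvars \<psi>"
| "fvars (All n \<phi>) = fvars \<phi> - {n}"
| "fvars (Ex n \<phi>) = fvars \<phi> - {n}"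

definition sentence :: "rform \<Rightarrow> bool" where
  "sentence \<phi> \<longleftrightarrow> fvars \<phi> = {}"

primrec teval :: "('a, 'm) ring_scheme \<Rightarrow> (nat \<Rightarrow> 'a) \<Rightarrow> rterm \<Rightarrow> 'a" where
  "teval R e (Var n) = e n"
| "teval R e Zero = \<zero>\<^bsub>R\<^esub>"
| "teval R e One = \<one>\<^bsub>R\<^esub>"
| "teval R e (Add s t) = teval R e s \<oplus>\<^bsub>R\<^esub> teval R e t"
| "teval R e (Mul s t) = teval R e s \<otimes>\<^bsub>R\<^esub> teval R e t"

primrec sat :: "('a, 'm) ring_scheme \<Rightarrow> (nat \<Rightarrow> 'a) \<Rightarrow> rform \<Rightarrow> bool" where
  "sat R e (Eq s t) \<longleftrightarrow> teval R e s = teval R e t"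
| "sat R e (Neg \<phi>) \<longleftrightarrow> \<not> sat R e \<phi>"
| "sat R e (Conj \<phi> \<psi>) \<longleftrightarrow> sat R e \<phi> \<and> sat R e \<psi>"
| "sat R e (Disj \<phi> \<psi>) \<longleftrightarrow> sat R e \<phi> \<or> sat R e \<psi>"
| "sat R e (Imp \<phi> \<psi>) \<longleftrightarrow> (sat R e \<phi> \<longrightarrow> sat R e \<psi>)"
| "sat R e (All n \<phi>) \<longleftrightarrow> (\<forall>a\<in>carrier R. sat R (e(n := a)) \<phi>)"
| "sat R e (Ex n \<phi>) \<longleftrightarrow> (\<exists>a\<in>carrier R. sat R (e(n := a)) \<phi>)"

definition models :: "('a, 'm) ring_scheme \<Rightarrow> rform \<Rightarrow> bool" where
  "models R \<phi> \<longleftrightarrow> (\<forall>e. (\<forall>n. e n \<in> carrier R) \<longrightarrow> sat R e \<phi>)"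


subsection \<open>Free associative algebras and centralizers\<close>

text \<open>
  The free associative unitary algebra on \<open>S\<close> is the monoid algebra of the free monoid of words
  over \<open>S\<close>: an element is the finitely supported family of its coefficients, and the product is
  the convolution along the factorizations \<open>w = take i w @ drop i w\<close>.
\<close>

definition free_algebra :: "('k, 'm) ring_scheme \<Rightarrow> 'x set \<Rightarrow> ('x list \<Rightarrow> 'k) ring" where
  "free_algebra K S =
    \<lparr> carrier = {f. (\<forall>w. f w \<in> carrier K) \<and> finite {w. f w \<noteq> \<zero>\<^bsub>K\<^esub>} \<and>
                    (\<forall>w. f w \<noteq> \<zero>\<^bsub>K\<^esub> \<longrightarrow> w \<in> lists S)},
      monoid.mult = (\<lambda>f g w. \<Oplus>\<^bsub>K\<^esub>i\<in>{..length w}. f (take i w) \<otimes>\<^bsub>K\<^esub> g (drop i w)),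
      one = (\<lambda>w. if w = [] then \<one>\<^bsub>K\<^esub> else \<zero>\<^bsub>K\<^esub>),
      ring.zero = (\<lambda>w. \<zero>\<^bsub>K\<^esub>),
      add = (\<lambda>f g w. f w \<oplus>\<^bsub>K\<^esub> g w) \<rparr>"

definition centralizer :: "('a, 'm) ring_scheme \<Rightarrow> 'a \<Rightarrow> 'a set" where
  "centralizer A P = {a \<in> carrier A. a \<otimes>\<^bsub>A\<^esub> P = P \<otimes>\<^bsub>A\<^esub> a}"

definition centralizer_ring :: "('a, 'm) ring_scheme \<Rightarrow> 'a \<Rightarrow> ('a, 'm) ring_scheme" where
  "centralizer_ring A P = A\<lparr>carrier := centralizer A P\<rparr>"


subsection \<open>The sentence\<close>

text \<open>
  One sentence has to serve all fields, all sets and all rings, of whatever cardinality, that is,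
  over all types at once. A type cannot be quantified inside a formula of HOL, so under an
  existential quantifier the sentence could vary with the types of the structures. It is therefore
  a closed constant of the type-variable-free type \<open>rform\<close>.

  In a free algebra over an infinite field \<open>K\<close> with at least two generators, the centre is \<open>K\<close>
  and the centralizer of every \<open>p\<close> outside the centre is a polynomial ring \<open>K[t]\<close> (Bergman).
  For central \<open>a\<close>, \<open>b\<close>, the value of \<open>f \<in> K[t]\<close> at \<open>a\<close> is \<open>b\<close> iff \<open>f + a h = b + t h\<close> for some
  \<open>h \<in> K[t]\<close>, and, \<open>K\<close> being infinite, \<open>f\<close> is determined by its values. The sentence says that for
  all non-central \<open>p\<close>, \<open>q\<close> there are \<open>t\<close>, \<open>s\<close> such that having the same values, \<open>f\<close> with respect
  to \<open>t\<close> and \<open>g\<close> with respect to \<open>s\<close>, is the graph of a ring isomorphism from the centralizer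
  of \<open>p\<close> onto that of \<open>q\<close>.

  Variables are named, so each auxiliary formula binds indices that the terms supplied to it
  do not use: 0 = \<open>p\<close>, 1 = \<open>q\<close>, 2 = \<open>t\<close>, 3 = \<open>s\<close>, 4 and 5 range over the centralizer of \<open>p\<close>,
  6 and 7 over that of \<open>q\<close>, 8 = \<open>a\<close>, 9 = \<open>b\<close>, 10 = \<open>h\<close>, and 11 is used in \<open>central_fm\<close>.
\<close>

definition commute_fm :: "rterm \<Rightarrow> rterm \<Rightarrow> rform" where
  "commute_fm x y = Eq (Mul x y) (Mul y x)"

definition central_fm :: "rterm \<Rightarrow> rform" where
  "central_fm x = All 11 (commute_fm x (Var 11))"

definition value_fm :: "rterm \<Rightarrow> rterm \<Rightarrow> rterm \<Rightarrow> rform" where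
  "value_fm p t f =
    Ex 10 (Conj (commute_fm (Var 10) p)
                (Eq (Add f (Mul (Var 8) (Var 10))) (Add (Var 9) (Mul t (Var 10)))))"

definition same_values_fm :: "rterm \<Rightarrow> rterm \<Rightarrow> rform" where
  "same_values_fm f g =
    All 8 (All 9 (Imp (Conj (central_fm (Var 8)) (central_fm (Var 9)))
      (Conj (Imp (value_fm (Var 0) (Var 2) f) (value_fm (Var 1) (Var 3) g))
            (Imp (value_fm (Var 1) (Var 3) g) (value_fm (Var 0) (Var 2) f)))))"

definition all_in_centralizer :: "nat \<Rightarrow> nat \<Rightarrow> rform \<Rightarrow> rform" where
  "all_in_centralizer n p \<phi> = All n (Imp (commute_fm (Var n) (Var p)) \<phi>)"

definition ex_in_centralizer :: "nat \<Rightarrow> nat \<Rightarrow> rform \<Rightarrow> rform" where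
  "ex_in_centralizer n p \<phi> = Ex n (Conj (commute_fm (Var n) (Var p)) \<phi>)"

definition bijective_fm :: rform where
  "bijective_fm =
    Conj (Conj (all_in_centralizer 4 0 (ex_in_centralizer 6 1 (same_values_fm (Var 4) (Var 6))))
               (all_in_centralizer 6 1 (ex_in_centralizer 4 0 (same_values_fm (Var 4) (Var 6)))))
         (Conj (all_in_centralizer 4 0 (all_in_centralizer 6 1 (all_in_centralizer 7 1
                 (Imp (Conj (same_values_fm (Var 4) (Var 6)) (same_values_fm (Var 4) (Var 7)))
                      (Eq (Var 6) (Var 7))))))
               (all_in_centralizer 4 0 (all_in_centralizer 5 0 (all_in_centralizer 6 1
                 (Imp (Conj (same_values_fm (Var 4) (Var 6)) (same_values_fm (Var 5) (Var 6)))
                      (Eq (Var 4) (Var 5)))))))"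

definition homomorphic_fm :: rform where
  "homomorphic_fm =
    Conj (same_values_fm One One)
         (all_in_centralizer 4 0 (all_in_centralizer 5 0
           (all_in_centralizer 6 1 (all_in_centralizer 7 1
             (Imp (Conj (same_values_fm (Var 4) (Var 6)) (same_values_fm (Var 5) (Var 7)))
                  (Conj (same_values_fm (Add (Var 4) (Var 5)) (Add (Var 6) (Var 7)))
                        (same_values_fm (Mul (Var 4) (Var 5)) (Mul (Var 6) (Var 7)))))))))"

definition Isom :: rform where
  "Isom =
    All 0 (All 1 (Imp (Conj (Neg (central_fm (Var 0))) (Neg (central_fm (Var 1))))
      (Ex 2 (Ex 3 (Conj bijective_fm homomorphic_fm)))))"

end

theory Submission
  imports Defs
begin

text \<open>
  The centralizer \<open>C\<close> of a non-scalar element \<open>p\<close> is shown to be a polynomial ring (Bergman) as follows.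
  Leading forms of elements of \<open>C\<close> commute, and those of equal degree are proportional, whence \<open>C\<close> is
  commutative and its associated graded ring embeds into \<open>K[z]\<close>, with \<open>z\<close> homogeneous of degree \<open>g\<close>,
  the generator of the group of degrees. Choose \<open>a\<close>, \<open>b\<close> in \<open>C\<close> with degrees differing by \<open>g\<close>,
  and let \<open>a'\<close>, \<open>b'\<close> be second copies of them that commute with the generators. In the free algebra over
  the fraction field of \<open>C'\<close> the commuting elements \<open>a - a'\<close> and \<open>b - b'\<close> have, by the Euclidean
  algorithm, a right gcd \<open>d\<close>, which vanishes when the second copy is identified with the first. For the
  grading in which \<open>C'\<close> has its own degree, the leading form of \<open>d\<close> divides \<open>z - 1\<close>, so the coefficients
  of \<open>d\<close> at the nonempty words have degree at most that of its leading coefficient. By the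
  Dedekind-Mertens lemma their quotients by the leading coefficient are almost integral over \<open>C'\<close>,
  hence scalars, and \<open>d\<close> is proportional to \<open>t - t'\<close> with \<open>t\<close> in \<open>C\<close> of degree \<open>g\<close>; then
  \<open>C = K[t]\<close>. Fractions are avoided by clearing denominators.
\<close>

subsection \<open>Free algebras over a domain\<close>

text \<open>The origin of \<open>d\<close>: if \<open>C = K[t]\<close>, then every difference
  \<open>e - e'\<close> is a multiple of \<open>t - t'\<close>, so \<open>t\<close> can be sought as
  a gcd of such differences before it is known. Two of them suffice because of their leading forms.
  With \<open>k\<close> the degree of \<open>a\<close> divided by \<open>g\<close>, the leading
  forms of \<open>a\<close> and \<open>b\<close> are \<open>c z^k\<close> and
  \<open>c z^(k+1)\<close>. Setting the copy of \<open>z\<close> to 1, those of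
  \<open>a - a'\<close> and \<open>b - b'\<close> become \<open>c (z^k - 1)\<close> and
  \<open>c (z^(k+1) - 1)\<close>, and \<open>(z^(k+1) - 1) - z (z^k - 1) = z - 1\<close>. What
  survives is a statement on degrees: if \<open>y^(k+j)\<close> is divisible by \<open>v^j\<close>
  for every \<open>j\<close>, then the degree of \<open>y\<close> is at least that of
  \<open>v\<close>. For commutativity the obstacle is positive characteristic. The leading form of
  the commutator of \<open>f^n\<close> with \<open>h\<close> carries the factor \<open>n\<close>,
  which may vanish in \<open>K\<close>; of two coprime exponents at least one does not.\<close>

lemma (in abelian_monoid) finsum_single:
  assumes "finite I" "i \<in> I" "f \<in> I \<rightarrow> carrier G" "\<And>j. j \<in> I \<Longrightarrow> j \<noteq> i \<Longrightarrow> f j = \<zero>"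
  shows "(\<Oplus>j\<in>I. f j) = f i"
proof -
  have "(\<Oplus>j\<in>I. f j) = (\<Oplus>j\<in>I. if i = j then f j else \<zero>)"
    using assms by (intro finsum_cong') (auto simp: Pi_iff)
  then show ?thesis using add.finprod_singleton[OF assms(2,1,3)] by simp
qed

lemma (in abelian_monoid) finsum_all_zero:
  assumes "\<And>j. j \<in> I \<Longrightarrow> f j = \<zero>"
  shows "(\<Oplus>j\<in>I. f j) = \<zero>"
proof -
  have "(\<Oplus>j\<in>I. f j) = (\<Oplus>j\<in>I. \<zero>)"
    using assms by (intro finsum_cong') auto
  then show ?thesis by simp
qed

text \<open>Both sides sum over the pairs \<open>j \<le> i \<le> n\<close>, the right one with
  \<open>i = j + k\<close>. This is the form needed when a word is cut at two places,
  \<open>j\<close> before \<open>i\<close>.\<close>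

lemma (in abelian_monoid) finsum_triangle:
  fixes F :: "nat \<Rightarrow> nat \<Rightarrow> 'a" and n :: nat
  assumes "\<And>i j. F i j \<in> carrier G"
  shows "(\<Oplus>i\<in>{..n}. \<Oplus>j\<in>{..i}. F i j) = (\<Oplus>j\<in>{..n}. \<Oplus>k\<in>{..n - j}. F (j + k) j)"
proof (induction n)
  case 0
  then show ?case using assms by (simp add: Pi_iff)
next
  case (Suc n)
  have S: "(\<Oplus>k\<in>{..Suc n - j}. F (j + k) j) = F (Suc n) j \<oplus> (\<Oplus>k\<in>{..n - j}. F (j + k) j)" if "j \<le> n" for j
  proof -
    have "Suc n - j = Suc (n - j)" using that by simp
    moreover have "j + (Suc (n - j)) = Suc n" using that by simp
    ultimately show ?thesis using assms by (simp add: finsum_Suc Pi_iff)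
  qed
  have "(\<Oplus>j\<in>{..Suc n}. \<Oplus>k\<in>{..Suc n - j}. F (j + k) j)
      = (\<Oplus>k\<in>{..0::nat}. F (Suc n + k) (Suc n)) \<oplus> (\<Oplus>j\<in>{..n}. \<Oplus>k\<in>{..Suc n - j}. F (j + k) j)"
    using assms by (subst finsum_Suc) (auto simp: Pi_iff intro!: finsum_closed)
  also have "(\<Oplus>j\<in>{..n}. \<Oplus>k\<in>{..Suc n - j}. F (j + k) j) =
      (\<Oplus>j\<in>{..n}. F (Suc n) j \<oplus> (\<Oplus>k\<in>{..n - j}. F (j + k) j))"
    using assms by (intro finsum_cong') (auto simp: Pi_iff S intro!: finsum_closed)
  also have "\<dots> = (\<Oplus>j\<in>{..n}. F (Suc n) j) \<oplus> (\<Oplus>j\<in>{..n}. \<Oplus>k\<in>{..n - j}. F (j + k) j)"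
    using assms by (intro finsum_addf) (auto simp: Pi_iff intro!: finsum_closed)
  also have "(\<Oplus>k\<in>{..0::nat}. F (Suc n + k) (Suc n)) = F (Suc n) (Suc n)"
    using assms by (simp add: Pi_iff)
  finally have "(\<Oplus>j\<in>{..Suc n}. \<Oplus>k\<in>{..Suc n - j}. F (j + k) j)
    = (F (Suc n) (Suc n) \<oplus> (\<Oplus>j\<in>{..n}. F (Suc n) j)) \<oplus> (\<Oplus>j\<in>{..n}. \<Oplus>k\<in>{..n - j}. F (j + k) j)"
    using assms by (simp add: a_assoc Pi_iff)
  also have "F (Suc n) (Suc n) \<oplus> (\<Oplus>j\<in>{..n}. F (Suc n) j) = (\<Oplus>j\<in>{..Suc n}. F (Suc n) j)"
    using assms by (simp add: finsum_Suc Pi_iff)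
  finally show ?case
    using assms by (subst finsum_Suc) (auto simp: Pi_iff Suc)
qed

text \<open>The coefficients form only a domain, since the same construction is applied a second
  time with a centralizer as coefficient ring.\<close>

locale free_alg = A: "domain" A for A :: "('a, 'm) ring_scheme" (structure) +
  fixes S :: "'x set"
begin

abbreviation FA :: "('x list \<Rightarrow> 'a) ring" where "FA \<equiv> free_algebra A S"

lemma carrier_FA:
  "f \<in> carrier FA \<longleftrightarrow> (\<forall>w. f w \<in> carrier A) \<and> finite {w. f w \<noteq> \<zero>} \<and> (\<forall>w. f w \<noteq> \<zero> \<longrightarrow> w \<in> lists S)"
  by (simp add: free_algebra_def)

lemma FA_zero: "\<zero>\<^bsub>FA\<^esub> = (\<lambda>w. \<zero>)"
  and FA_one: "\<one>\<^bsub>FA\<^esub> = (\<lambda>w. if w = [] then \<one> else \<zero>)"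
  and FA_add: "f \<oplus>\<^bsub>FA\<^esub> g = (\<lambda>w. f w \<oplus> g w)"
  and FA_mult: "f \<otimes>\<^bsub>FA\<^esub> g = (\<lambda>w. \<Oplus>i\<in>{..length w}. f (take i w) \<otimes> g (drop i w))"
  by (simp_all add: free_algebra_def)

lemma FA_coeff [simp, intro]: "f \<in> carrier FA \<Longrightarrow> f w \<in> carrier A"
  by (simp add: carrier_FA)

lemma FA_supp: "f \<in> carrier FA \<Longrightarrow> f w \<noteq> \<zero> \<Longrightarrow> w \<in> lists S"
  unfolding carrier_FA by blast

lemma FA_mult_nonzero:
  assumes "f \<in> carrier FA" "g \<in> carrier FA" "(f \<otimes>\<^bsub>FA\<^esub> g) w \<noteq> \<zero>"
  shows "\<exists>u v. w = u @ v \<and> f u \<noteq> \<zero> \<and> g v \<noteq> \<zero>"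
proof (rule ccontr)
  assume *: "\<not> ?thesis"
  have "f (take i w) \<otimes> g (drop i w) = \<zero>" for i
  proof -
    have "f (take i w) = \<zero> \<or> g (drop i w) = \<zero>"
      using * append_take_drop_id[of i w] by metis
    then show ?thesis using assms(1,2) by auto
  qed
  then have "(f \<otimes>\<^bsub>FA\<^esub> g) w = \<zero>"
    unfolding FA_mult by (intro A.finsum_all_zero)
  with assms(3) show False by simp
qed

lemma FA_mult_closed:
  assumes "f \<in> carrier FA" "g \<in> carrier FA"
  shows "f \<otimes>\<^bsub>FA\<^esub> g \<in> carrier FA"
proof -
  have "{w. (f \<otimes>\<^bsub>FA\<^esub> g) w \<noteq> \<zero>} \<subseteq> (\<lambda>(u, v). u @ v) ` ({w. f w \<noteq> \<zero>} \<times> {w. g w \<noteq> \<zero>})"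
    using FA_mult_nonzero[OF assms] by force
  moreover have "finite ({w. f w \<noteq> \<zero>} \<times> {w. g w \<noteq> \<zero>})"
    using assms by (auto simp: carrier_FA)
  ultimately have "finite {w. (f \<otimes>\<^bsub>FA\<^esub> g) w \<noteq> \<zero>}"
    using finite_surj by blast
  moreover have "(f \<otimes>\<^bsub>FA\<^esub> g) w \<in> carrier A" for w
    unfolding FA_mult using assms by (intro A.finsum_closed) auto
  moreover have "w \<in> lists S" if "(f \<otimes>\<^bsub>FA\<^esub> g) w \<noteq> \<zero>" for w
    using FA_mult_nonzero[OF assms that] FA_supp assms by (metis append_in_lists_conv)
  ultimately show ?thesis by (auto simp: carrier_FA)
qed

lemma FA_add_closed:
  assumes "f \<in> carrier FA" "g \<in> carrier FA"
  shows "f \<oplus>\<^bsub>FA\<^esub> g \<in> carrier FA"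
proof -
  have "{w. f w \<oplus> g w \<noteq> \<zero>} \<subseteq> {w. f w \<noteq> \<zero>} \<union> {w. g w \<noteq> \<zero>}"
    using assms by auto
  moreover have "w \<in> lists S" if "f w \<oplus> g w \<noteq> \<zero>" for w
  proof -
    have "f w \<noteq> \<zero> \<or> g w \<noteq> \<zero>" using that assms by auto
    then show ?thesis using assms by (auto simp: carrier_FA)
  qed
  ultimately show ?thesis
    using assms by (simp add: carrier_FA FA_add finite_subset)
qed

lemma FA_mult_assoc:
  assumes "f \<in> carrier FA" "g \<in> carrier FA" "h \<in> carrier FA"
  shows "(f \<otimes>\<^bsub>FA\<^esub> g) \<otimes>\<^bsub>FA\<^esub> h = f \<otimes>\<^bsub>FA\<^esub> (g \<otimes>\<^bsub>FA\<^esub> h)"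
proof
  fix w :: "'x list"
  define n where "n = length w"
  \<comment> \<open>The summand belonging to the cuts of \<open>w\<close> at \<open>j\<close> and
    \<open>i\<close>, for \<open>j \<le> i\<close>; both bracketings sum it over the same
    triangle.\<close>
  define F where "F i j = f (take j w) \<otimes> (g (take (i - j) (drop j w)) \<otimes> h (drop i w))" for i j
  have F: "F i j \<in> carrier A" for i j using assms by (auto simp: F_def)
  have "((f \<otimes>\<^bsub>FA\<^esub> g) \<otimes>\<^bsub>FA\<^esub> h) w = (\<Oplus>i\<in>{..n}. \<Oplus>j\<in>{..i}. F i j)"
    unfolding FA_mult n_def
  proof (intro A.finsum_cong')
    fix i assume i: "i \<in> {..length w}"
    have "(\<Oplus>j\<in>{..length (take i w)}. f (take j (take i w)) \<otimes> g (drop j (take i w))) \<otimes> h (drop i w)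
        = (\<Oplus>j\<in>{..i}. f (take j (take i w)) \<otimes> g (drop j (take i w)) \<otimes> h (drop i w))"
      using i assms by (subst A.finsum_ldistr) (auto simp: min_absorb2)
    also have "\<dots> = (\<Oplus>j\<in>{..i}. F i j)"
      using assms by (intro A.finsum_cong') (auto simp: F_def A.m_assoc drop_take min_def)
    finally show "(\<Oplus>j\<in>{..length (take i w)}. f (take j (take i w)) \<otimes> g (drop j (take i w))) \<otimes> h (drop i w)
       = (\<Oplus>j\<in>{..i}. F i j)" .
  qed (auto simp: F intro!: A.finsum_closed)
  also have "\<dots> = (\<Oplus>j\<in>{..n}. \<Oplus>k\<in>{..n - j}. F (j + k) j)"
    using F by (rule A.finsum_triangle)
  also have "\<dots> = (f \<otimes>\<^bsub>FA\<^esub> (g \<otimes>\<^bsub>FA\<^esub> h)) w"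
    unfolding FA_mult n_def
  proof (intro A.finsum_cong')
    fix j assume j: "j \<in> {..length w}"
    have "f (take j w) \<otimes> (\<Oplus>k\<in>{..length (drop j w)}. g (take k (drop j w)) \<otimes> h (drop k (drop j w)))
        = (\<Oplus>k\<in>{..length w - j}. f (take j w) \<otimes> (g (take k (drop j w)) \<otimes> h (drop k (drop j w))))"
      using j assms by (subst A.finsum_rdistr) auto
    also have "\<dots> = (\<Oplus>k\<in>{..length w - j}. F (j + k) j)"
      using assms by (intro A.finsum_cong') (auto simp: F_def add.commute)
    finally show "(\<Oplus>k\<in>{..length w - j}. F (j + k) j) = f (take j w) \<otimes> (\<Oplus>k\<in>{..length (drop j w)}. g (take k (drop j w)) \<otimes> h (drop k (drop j w)))"
      by simp
  qed (use assms in \<open>auto intro!: A.finsum_closed\<close>)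
  finally show "((f \<otimes>\<^bsub>FA\<^esub> g) \<otimes>\<^bsub>FA\<^esub> h) w = (f \<otimes>\<^bsub>FA\<^esub> (g \<otimes>\<^bsub>FA\<^esub> h)) w" .
qed

definition cst :: "'a \<Rightarrow> 'x list \<Rightarrow> 'a" where
  "cst c w = (if w = [] then c else \<zero>)"

lemma cst_closed [simp, intro]: "c \<in> carrier A \<Longrightarrow> cst c \<in> carrier FA"
proof -
  assume "c \<in> carrier A"
  moreover have "finite {w :: 'x list. cst c w \<noteq> \<zero>}"
    by (rule finite_subset[of _ "{[]}"]) (auto simp: cst_def)
  ultimately show ?thesis by (auto simp: carrier_FA cst_def)
qed

lemma FA_one_cst: "\<one>\<^bsub>FA\<^esub> = cst \<one>"
  by (auto simp: FA_one cst_def)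

lemma cst_mult: 
  assumes "c \<in> carrier A" "f \<in> carrier FA"
  shows "(cst c \<otimes>\<^bsub>FA\<^esub> f) w = c \<otimes> f w"
proof -
  have "(cst c \<otimes>\<^bsub>FA\<^esub> f) w = cst c (take 0 w) \<otimes> f (drop 0 w)"
    unfolding FA_mult using assms
    by (intro A.finsum_single) (auto simp: cst_def)
  then show ?thesis by (simp add: cst_def)
qed

lemma mult_cst: 
  assumes "c \<in> carrier A" "f \<in> carrier FA"
  shows "(f \<otimes>\<^bsub>FA\<^esub> cst c) w = f w \<otimes> c"
proof -
  have "(f \<otimes>\<^bsub>FA\<^esub> cst c) w = f (take (length w) w) \<otimes> cst c (drop (length w) w)"
    unfolding FA_mult using assms
    by (intro A.finsum_single) (auto simp: cst_def)
  then show ?thesis by (simp add: cst_def)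
qed

lemma cst_commute:
  assumes "c \<in> carrier A" "f \<in> carrier FA"
  shows "cst c \<otimes>\<^bsub>FA\<^esub> f = f \<otimes>\<^bsub>FA\<^esub> cst c"
  using assms by (auto simp: fun_eq_iff cst_mult mult_cst A.m_comm)

lemma FA_ring: "ring FA"
proof (rule ringI)
  show "abelian_group FA"
  proof (rule abelian_groupI)
    fix f g h assume f: "f \<in> carrier FA" and g: "g \<in> carrier FA" and h: "h \<in> carrier FA"
    show "f \<oplus>\<^bsub>FA\<^esub> g \<oplus>\<^bsub>FA\<^esub> h = f \<oplus>\<^bsub>FA\<^esub> (g \<oplus>\<^bsub>FA\<^esub> h)"
      using f g h by (auto simp: FA_add A.a_assoc)
    show "f \<oplus>\<^bsub>FA\<^esub> g = g \<oplus>\<^bsub>FA\<^esub> f"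
      using f g by (auto simp: FA_add A.a_comm)
  next
    show "\<zero>\<^bsub>FA\<^esub> \<in> carrier FA" by (simp add: carrier_FA FA_zero)
  next
    fix f assume f: "f \<in> carrier FA"
    show "\<zero>\<^bsub>FA\<^esub> \<oplus>\<^bsub>FA\<^esub> f = f" using f by (auto simp: FA_add FA_zero)
    have "(\<ominus> x = \<zero>) = (x = \<zero>)" if "x \<in> carrier A" for x
      using that A.add.inv_eq_1_iff by auto
    then have "(\<lambda>w. \<ominus> f w) \<in> carrier FA"
      using f by (auto simp: carrier_FA)
    moreover have "(\<lambda>w. \<ominus> f w) \<oplus>\<^bsub>FA\<^esub> f = \<zero>\<^bsub>FA\<^esub>"
      using f by (auto simp: FA_add FA_zero A.l_neg)
    ultimately show "\<exists>g\<in>carrier FA. g \<oplus>\<^bsub>FA\<^esub> f = \<zero>\<^bsub>FA\<^esub>" by blast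
  qed (rule FA_add_closed)
  show "monoid FA"
  proof (rule monoidI)
    show "\<one>\<^bsub>FA\<^esub> \<in> carrier FA" by (simp add: FA_one_cst)
    show "\<one>\<^bsub>FA\<^esub> \<otimes>\<^bsub>FA\<^esub> f = f" if "f \<in> carrier FA" for f
      using that by (auto simp: FA_one_cst fun_eq_iff cst_mult)
    show "f \<otimes>\<^bsub>FA\<^esub> \<one>\<^bsub>FA\<^esub> = f" if "f \<in> carrier FA" for f
      using that by (auto simp: FA_one_cst fun_eq_iff mult_cst)
  qed (auto intro: FA_mult_closed simp: FA_mult_assoc)
next
  fix f g h assume f: "f \<in> carrier FA" and g: "g \<in> carrier FA" and h: "h \<in> carrier FA"
  show "(f \<oplus>\<^bsub>FA\<^esub> g) \<otimes>\<^bsub>FA\<^esub> h = f \<otimes>\<^bsub>FA\<^esub> h \<oplus>\<^bsub>FA\<^esub> g \<otimes>\<^bsub>FA\<^esub> h"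
  proof
    fix w
    have "((f \<oplus>\<^bsub>FA\<^esub> g) \<otimes>\<^bsub>FA\<^esub> h) w
      = (\<Oplus>i\<in>{..length w}. f (take i w) \<otimes> h (drop i w) \<oplus> g (take i w) \<otimes> h (drop i w))"
      unfolding FA_mult FA_add using f g h by (intro A.finsum_cong') (auto simp: A.l_distr)
    then show "((f \<oplus>\<^bsub>FA\<^esub> g) \<otimes>\<^bsub>FA\<^esub> h) w = (f \<otimes>\<^bsub>FA\<^esub> h \<oplus>\<^bsub>FA\<^esub> g \<otimes>\<^bsub>FA\<^esub> h) w"
      using f g h by (simp add: FA_mult FA_add A.finsum_addf)
  qed
  show "h \<otimes>\<^bsub>FA\<^esub> (f \<oplus>\<^bsub>FA\<^esub> g) = h \<otimes>\<^bsub>FA\<^esub> f \<oplus>\<^bsub>FA\<^esub> h \<otimes>\<^bsub>FA\<^esub> g"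
  proof
    fix w
    have "(h \<otimes>\<^bsub>FA\<^esub> (f \<oplus>\<^bsub>FA\<^esub> g)) w
      = (\<Oplus>i\<in>{..length w}. h (take i w) \<otimes> f (drop i w) \<oplus> h (take i w) \<otimes> g (drop i w))"
      unfolding FA_mult FA_add using f g h by (intro A.finsum_cong') (auto simp: A.r_distr)
    then show "(h \<otimes>\<^bsub>FA\<^esub> (f \<oplus>\<^bsub>FA\<^esub> g)) w = (h \<otimes>\<^bsub>FA\<^esub> f \<oplus>\<^bsub>FA\<^esub> h \<otimes>\<^bsub>FA\<^esub> g) w"
      using f g h by (simp add: FA_mult FA_add A.finsum_addf)
  qed
qed

sublocale R: ring FA by (rule FA_ring)

lemma FA_uminus: "f \<in> carrier FA \<Longrightarrow> (\<ominus>\<^bsub>FA\<^esub> f) w = \<ominus> f w"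
proof -
  assume f: "f \<in> carrier FA"
  have "(\<ominus>\<^bsub>FA\<^esub> f \<oplus>\<^bsub>FA\<^esub> f) w = \<zero>" using f by (simp add: R.l_neg FA_zero)
  then show ?thesis
    using f R.a_inv_closed[OF f] by (simp add: FA_add A.minus_equality)
qed

lemma FA_minus: "f \<in> carrier FA \<Longrightarrow> g \<in> carrier FA \<Longrightarrow> (f \<ominus>\<^bsub>FA\<^esub> g) w = f w \<ominus> g w"
  by (simp add: a_minus_def FA_add FA_uminus)

section \<open>Degrees and homogeneous components\<close>

definition dle :: "('x list \<Rightarrow> 'a) \<Rightarrow> nat \<Rightarrow> bool" where
  "dle f n \<longleftrightarrow> (\<forall>w. f w \<noteq> \<zero> \<longrightarrow> length w \<le> n)"

definition homog :: "('x list \<Rightarrow> 'a) \<Rightarrow> nat \<Rightarrow> bool" where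
  "homog f n \<longleftrightarrow> (\<forall>w. f w \<noteq> \<zero> \<longrightarrow> length w = n)"

definition component :: "nat \<Rightarrow> ('x list \<Rightarrow> 'a) \<Rightarrow> 'x list \<Rightarrow> 'a" where
  "component n f w = (if length w = n then f w else \<zero>)"

text \<open>As a least bound, the degree of the zero element is 0, like that of a nonzero scalar.
  Bounds that must hold for zero as well are stated with \<open>dle\<close>.\<close>

definition deg :: "('x list \<Rightarrow> 'a) \<Rightarrow> nat" where
  "deg f = (LEAST n. dle f n)"

lemma homog_dle: "homog f n \<Longrightarrow> dle f n" by (auto simp: homog_def dle_def)
lemma homog_comp [simp]: "homog (component n f) n" by (auto simp: homog_def component_def)
lemma component_hom: "homog f n \<Longrightarrow> component n f = f" by (rule ext) (metis homog_def component_def)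
lemma homog_zero: "homog f n \<Longrightarrow> length w \<noteq> n \<Longrightarrow> f w = \<zero>" unfolding homog_def by blast
lemma dle_mono: "dle f m \<Longrightarrow> m \<le> n \<Longrightarrow> dle f n" by (force simp: dle_def)

lemma component_closed [simp, intro]:
  assumes "f \<in> carrier FA" shows "component n f \<in> carrier FA"
proof -
  have "{w. component n f w \<noteq> \<zero>} \<subseteq> {w. f w \<noteq> \<zero>}" by (auto simp: component_def)
  then show ?thesis using assms by (auto simp: carrier_FA component_def intro: finite_subset)
qed

lemma dle_exists: assumes "f \<in> carrier FA" shows "\<exists>n. dle f n"
proof -
  have "finite (length ` {w. f w \<noteq> \<zero>})" using assms by (simp add: carrier_FA)
  then have "dle f (Max (insert 0 (length ` {w. f w \<noteq> \<zero>})))"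
    by (auto simp: dle_def intro: Max_ge)
  then show ?thesis ..
qed

lemma dle_deg: "f \<in> carrier FA \<Longrightarrow> dle f (deg f)"
  unfolding deg_def using dle_exists by (metis LeastI)

lemma deg_le: "dle f n \<Longrightarrow> deg f \<le> n"
  unfolding deg_def by (rule Least_le)

lemma deg_witness:
  assumes "f \<in> carrier FA" "f \<noteq> \<zero>\<^bsub>FA\<^esub>"
  shows "\<exists>w. length w = deg f \<and> f w \<noteq> \<zero>"
proof (rule ccontr)
  assume *: "\<not> ?thesis"
  obtain w where w: "f w \<noteq> \<zero>" using assms(2) by (auto simp: FA_zero)
  show False
  proof (cases "deg f")
    case 0
    then show False using * w dle_deg[OF assms(1)] by (auto simp: dle_def)
  next
    case (Suc m)
    have "dle f m" using * dle_deg[OF assms(1)] Suc by (force simp: dle_def le_Suc_eq)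
    then show False using deg_le Suc by force
  qed
qed

lemma deg_eqI: "f \<in> carrier FA \<Longrightarrow> dle f n \<Longrightarrow> f w \<noteq> \<zero> \<Longrightarrow> length w = n \<Longrightarrow> deg f = n"
  using deg_le[of f n] dle_deg[of f] by (force simp: dle_def)

text \<open>At a word of the maximal length \<open>n + m\<close> a single cut contributes: a later
  cut makes the prefix too long for \<open>f\<close>, an earlier one the suffix too long for
  \<open>g\<close>. Top coefficients therefore multiply without cancellation.\<close>

lemma mult_top:
  assumes "f \<in> carrier FA" "g \<in> carrier FA" "dle f n" "dle g m" "length a = n" "length b = m"
  shows "(f \<otimes>\<^bsub>FA\<^esub> g) (a @ b) = f a \<otimes> g b"
proof -
  have "(f \<otimes>\<^bsub>FA\<^esub> g) (a @ b) = f (take n (a @ b)) \<otimes> g (drop n (a @ b))"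
    unfolding FA_mult
  proof (rule A.finsum_single)
    fix j assume j: "j \<in> {..length (a @ b)}" "j \<noteq> n"
    show "f (take j (a @ b)) \<otimes> g (drop j (a @ b)) = \<zero>"
    proof (cases "j > n")
      case True
      then have "f (take j (a @ b)) = \<zero>" using assms j by (force simp: dle_def)
      then show ?thesis using assms by simp
    next
      case False
      then have "length (drop j (a @ b)) > m" using assms j by simp
      then have "g (drop j (a @ b)) = \<zero>" using assms(4) unfolding dle_def by (metis not_le)
      then show ?thesis using assms by simp
    qed
  qed (use assms in auto)
  then show ?thesis using assms(5) by simp
qed

lemma mult_top_take:
  assumes "f \<in> carrier FA" "g \<in> carrier FA" "dle f n" "dle g m" "length w = n + m"
  shows "(f \<otimes>\<^bsub>FA\<^esub> g) w = f (take n w) \<otimes> g (drop n w)"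
  using mult_top[OF assms(1-4), of "take n w" "drop n w"] assms(5) by simp

lemma dle_mult:
  assumes "f \<in> carrier FA" "g \<in> carrier FA" "dle f n" "dle g m"
  shows "dle (f \<otimes>\<^bsub>FA\<^esub> g) (n + m)"
  unfolding dle_def
proof (intro allI impI)
  fix w assume "(f \<otimes>\<^bsub>FA\<^esub> g) w \<noteq> \<zero>"
  then obtain u v where "w = u @ v" "f u \<noteq> \<zero>" "g v \<noteq> \<zero>"
    using FA_mult_nonzero assms(1,2) by blast
  then show "length w \<le> n + m" using assms(3,4) by (force simp: dle_def)
qed

lemma homog_mult:
  assumes "f \<in> carrier FA" "g \<in> carrier FA" "homog f n" "homog g m"
  shows "homog (f \<otimes>\<^bsub>FA\<^esub> g) (n + m)"
  unfolding homog_def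
proof (intro allI impI)
  fix w assume "(f \<otimes>\<^bsub>FA\<^esub> g) w \<noteq> \<zero>"
  then obtain u v where "w = u @ v" "f u \<noteq> \<zero>" "g v \<noteq> \<zero>"
    using FA_mult_nonzero assms(1,2) by blast
  then show "length w = n + m" using assms(3,4) by (force simp: homog_def)
qed

lemma component_mult:
  assumes "f \<in> carrier FA" "g \<in> carrier FA" "dle f n" "dle g m"
  shows "component (n + m) (f \<otimes>\<^bsub>FA\<^esub> g) = component n f \<otimes>\<^bsub>FA\<^esub> component m g"
proof
  fix w :: "'x list"
  show "component (n + m) (f \<otimes>\<^bsub>FA\<^esub> g) w = (component n f \<otimes>\<^bsub>FA\<^esub> component m g) w"
  proof (cases "length w = n + m")
    case True
    have "(component n f \<otimes>\<^bsub>FA\<^esub> component m g) w = component n f (take n w) \<otimes> component m g (drop n w)"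
      using assms True by (intro mult_top_take) (auto intro: homog_dle)
    then show ?thesis
      using mult_top_take[OF assms True] True by (simp add: component_def)
  next
    case False
    then have "(component n f \<otimes>\<^bsub>FA\<^esub> component m g) w = \<zero>"
      using homog_mult[OF component_closed component_closed homog_comp homog_comp, of f g n m] assms
      by (auto simp: homog_def)
    then show ?thesis using False by (simp add: component_def)
  qed
qed

lemma dle_zero: "dle f n \<Longrightarrow> n < length w \<Longrightarrow> f w = \<zero>"
  unfolding dle_def by (metis not_le)

lemma dleI: "(\<And>w. n < length w \<Longrightarrow> f w = \<zero>) \<Longrightarrow> dle f n"
  unfolding dle_def by (metis not_le)

lemma dle_add: "dle f n \<Longrightarrow> dle g n \<Longrightarrow> dle (f \<oplus>\<^bsub>FA\<^esub> g) n"
  by (rule dleI) (simp add: FA_add dle_zero)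

lemma dle_minus:
  "f \<in> carrier FA \<Longrightarrow> g \<in> carrier FA \<Longrightarrow> dle f n \<Longrightarrow> dle g n \<Longrightarrow> dle (f \<ominus>\<^bsub>FA\<^esub> g) n"
  by (rule dleI) (simp add: FA_minus dle_zero A.minus_eq)

lemma component_add: "component n (f \<oplus>\<^bsub>FA\<^esub> g) = component n f \<oplus>\<^bsub>FA\<^esub> component n g"
  by (auto simp: component_def FA_add fun_eq_iff)

lemma component_minus: "f \<in> carrier FA \<Longrightarrow> g \<in> carrier FA \<Longrightarrow> component n (f \<ominus>\<^bsub>FA\<^esub> g) = component n f \<ominus>\<^bsub>FA\<^esub> component n g"
  by (rule ext) (simp add: component_def FA_minus A.minus_eq)

text \<open>For words \<open>a\<close> and \<open>b\<close> of maximal length in \<open>f\<close>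
  and \<open>g\<close>, the coefficient of the product at their concatenation is a product of two
  nonzero coefficients.\<close>

lemma FA_integral:
  assumes "f \<in> carrier FA" "g \<in> carrier FA" "f \<noteq> \<zero>\<^bsub>FA\<^esub>" "g \<noteq> \<zero>\<^bsub>FA\<^esub>"
  shows "f \<otimes>\<^bsub>FA\<^esub> g \<noteq> \<zero>\<^bsub>FA\<^esub>" "deg (f \<otimes>\<^bsub>FA\<^esub> g) = deg f + deg g"
proof -
  obtain a b where a: "length a = deg f" "f a \<noteq> \<zero>" and b: "length b = deg g" "g b \<noteq> \<zero>"
    using deg_witness assms by metis
  have "(f \<otimes>\<^bsub>FA\<^esub> g) (a @ b) = f a \<otimes> g b"
    using mult_top[OF assms(1,2) dle_deg dle_deg] assms a b by blast
  also have "\<dots> \<noteq> \<zero>" using A.integral a b assms by blast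
  finally have ne: "(f \<otimes>\<^bsub>FA\<^esub> g) (a @ b) \<noteq> \<zero>" .
  then show "f \<otimes>\<^bsub>FA\<^esub> g \<noteq> \<zero>\<^bsub>FA\<^esub>" by (auto simp: FA_zero)
  show "deg (f \<otimes>\<^bsub>FA\<^esub> g) = deg f + deg g"
    using ne a b by (intro deg_eqI[of _ _ "a @ b"] dle_mult dle_deg FA_mult_closed assms) auto
qed

lemma FA_one_neq_zero: "\<one>\<^bsub>FA\<^esub> \<noteq> \<zero>\<^bsub>FA\<^esub>"
  by (auto simp: FA_one FA_zero fun_eq_iff)

lemma FA_r_cancel:
  assumes "f \<in> carrier FA" "g \<in> carrier FA" "h \<in> carrier FA" "f \<noteq> \<zero>\<^bsub>FA\<^esub>"
    "g \<otimes>\<^bsub>FA\<^esub> f = h \<otimes>\<^bsub>FA\<^esub> f"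
  shows "g = h"
proof -
  have "(g \<ominus>\<^bsub>FA\<^esub> h) \<otimes>\<^bsub>FA\<^esub> f = \<zero>\<^bsub>FA\<^esub>"
    using assms by (simp add: a_minus_def R.l_distr R.l_minus R.r_neg)
  then show ?thesis using FA_integral(1)[of "g \<ominus>\<^bsub>FA\<^esub> h" f] assms by auto
qed

text \<open>Comparing the terms of \<open>x u = y v\<close> whose words begin with a fixed word \<open>a\<close> of maximal
  length in \<open>x\<close> exhibits the leading form of \<open>u\<close> as a left multiple of that of \<open>v\<close>.\<close>

lemma weak_algorithm:
  assumes c: "x \<in> carrier FA" "u \<in> carrier FA" "y \<in> carrier FA" "v \<in> carrier FA"
    and eq: "x \<otimes>\<^bsub>FA\<^esub> u = y \<otimes>\<^bsub>FA\<^esub> v"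
    and d: "dle x n" "dle u m" "dle y n'" "dle v m'" "n + m = n' + m'" "m' \<le> m"
    and a: "length a = n" "x a \<noteq> \<zero>"
  shows "\<exists>q\<in>carrier FA. homog q (m - m') \<and> (\<forall>b. length b = m \<longrightarrow> x a \<otimes> u b = (q \<otimes>\<^bsub>FA\<^esub> v) b)"
proof -
  \<comment> \<open>The left quotient: what remains of the words of \<open>y\<close> of length
    \<open>n'\<close> that begin with \<open>a\<close> once this prefix is removed. The equation
    \<open>n + m = n' + m'\<close> fixes the length \<open>m - m'\<close> of the rest.\<close>
  define q where "q = (\<lambda>b. if length b = m - m' then y (a @ b) else \<zero>)"
  have inj: "inj_on (\<lambda>b. a @ b) B" for B by (simp add: inj_on_def)
  have "(\<lambda>b. a @ b) ` {b. q b \<noteq> \<zero>} \<subseteq> {w. y w \<noteq> \<zero>}" by (auto simp: q_def)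
  then have "finite {b. q b \<noteq> \<zero>}"
    using c(3) finite_imageD[OF _ inj] finite_subset by (metis carrier_FA)
  moreover have "b \<in> lists S" if "q b \<noteq> \<zero>" for b
  proof -
    have "y (a @ b) \<noteq> \<zero>" using that by (auto simp: q_def split: if_splits)
    then have "a @ b \<in> lists S" using c(3) FA_supp by blast
    then show ?thesis by simp
  qed
  ultimately have q: "q \<in> carrier FA" using c(3) by (auto simp: carrier_FA q_def)
  have hq: "homog q (m - m')" by (auto simp: homog_def q_def)
  have "x a \<otimes> u b = (q \<otimes>\<^bsub>FA\<^esub> v) b" if b: "length b = m" for b
  proof -
    define b1 b2 where "b1 = take (m - m') b" and "b2 = drop (m - m') b"
    have bb: "b = b1 @ b2" "length b1 = m - m'" "length b2 = m'"
      using b d by (auto simp: b1_def b2_def)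
    have "x a \<otimes> u b = (x \<otimes>\<^bsub>FA\<^esub> u) (a @ b)" using mult_top[OF c(1,2) d(1,2) a(1) b] by simp
    also have "\<dots> = (y \<otimes>\<^bsub>FA\<^esub> v) ((a @ b1) @ b2)" using eq bb by simp
    also have "\<dots> = y (a @ b1) \<otimes> v b2"
      using bb a d by (intro mult_top[OF c(3,4) d(3,4)]) auto
    also have "\<dots> = q b1 \<otimes> v b2" using bb by (simp add: q_def)
    also have "\<dots> = (q \<otimes>\<^bsub>FA\<^esub> v) (b1 @ b2)"
      using mult_top[OF q c(4) homog_dle[OF hq] d(4)] bb by simp
    finally show ?thesis using bb by simp
  qed
  then show ?thesis using q hq by blast
qed

text \<open>For homogeneous elements the comparison of leading forms becomes an equation. The factor
  \<open>c\<close> is a coefficient of \<open>x\<close>; it is kept because a domain need not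
  contain its inverse.\<close>

lemma weak_algorithm_hom:
  assumes c: "x \<in> carrier FA" "u \<in> carrier FA" "y \<in> carrier FA" "v \<in> carrier FA"
    and eq: "x \<otimes>\<^bsub>FA\<^esub> u = y \<otimes>\<^bsub>FA\<^esub> v"
    and d: "homog x n" "homog u m" "homog y n'" "homog v m'" "n + m = n' + m'" "m' \<le> m"
    and x: "x \<noteq> \<zero>\<^bsub>FA\<^esub>"
  shows "\<exists>c\<in>carrier A. c \<noteq> \<zero> \<and> (\<exists>q\<in>carrier FA. homog q (m - m') \<and> cst c \<otimes>\<^bsub>FA\<^esub> u = q \<otimes>\<^bsub>FA\<^esub> v)"
proof -
  obtain a where a: "x a \<noteq> \<zero>" using x by (auto simp: FA_zero)
  then have la: "length a = n" using d(1) by (simp add: homog_def)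
  obtain q where q: "q \<in> carrier FA" "homog q (m - m')" "\<And>b. length b = m \<Longrightarrow> x a \<otimes> u b = (q \<otimes>\<^bsub>FA\<^esub> v) b"
    using weak_algorithm[OF c eq d(1-4)[THEN homog_dle] d(5,6) la a] by blast
  have hqv: "homog (q \<otimes>\<^bsub>FA\<^esub> v) m" using homog_mult[OF q(1) c(4) q(2) d(4)] d(6) by simp
  have "cst (x a) \<otimes>\<^bsub>FA\<^esub> u = q \<otimes>\<^bsub>FA\<^esub> v"
  proof
    fix b
    show "(cst (x a) \<otimes>\<^bsub>FA\<^esub> u) b = (q \<otimes>\<^bsub>FA\<^esub> v) b"
    proof (cases "length b = m")
      case True
      then show ?thesis using q(3) c by (simp add: cst_mult)
    next
      case False
      then have "u b = \<zero>" "(q \<otimes>\<^bsub>FA\<^esub> v) b = \<zero>" using d(2) hqv by (auto simp: homog_def)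
      then show ?thesis using c by (simp add: cst_mult)
    qed
  qed
  then show ?thesis using a c q by blast
qed

end

subsection \<open>Centralizers are commutative\<close>

lemma (in ring) centralizer_subring:
  assumes "P \<in> carrier R"
  shows "subring (centralizer R P) R"
proof (rule subringI)
  fix a b assume "a \<in> centralizer R P" "b \<in> centralizer R P"
  then have a: "a \<in> carrier R" "a \<otimes> P = P \<otimes> a" and b: "b \<in> carrier R" "b \<otimes> P = P \<otimes> b"
    by (auto simp: centralizer_def)
  show "\<ominus> a \<in> centralizer R P"
    using a assms by (simp add: centralizer_def l_minus r_minus)
  show "a \<oplus> b \<in> centralizer R P"
    using a b assms by (simp add: centralizer_def l_distr r_distr)
  have "(a \<otimes> b) \<otimes> P = a \<otimes> (P \<otimes> b)" using a(1) b assms by (simp add: m_assoc)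
  also have "\<dots> = P \<otimes> (a \<otimes> b)" using a b assms by (simp add: m_assoc[symmetric])
  finally show "a \<otimes> b \<in> centralizer R P"
    using a b by (simp add: centralizer_def)
qed (use assms in \<open>auto simp: centralizer_def\<close>)

lemma (in ring) centralizer_self: "P \<in> carrier R \<Longrightarrow> P \<in> centralizer R P"
  by (simp add: centralizer_def)

lemma (in ring) centralizer_minus:
  "P \<in> carrier R \<Longrightarrow> a \<in> centralizer R P \<Longrightarrow> b \<in> centralizer R P \<Longrightarrow> a \<ominus> b \<in> centralizer R P"
  using centralizer_subring[of P] by (simp add: a_minus_def subringE(5,7))

lemma (in ring) centralizer_pow:
  "P \<in> carrier R \<Longrightarrow> a \<in> centralizer R P \<Longrightarrow> a [^] (n::nat) \<in> centralizer R P"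
  by (induction n) (auto simp: subringE[OF centralizer_subring])

context free_alg
begin

lemma cst_centralizer: "P \<in> carrier FA \<Longrightarrow> c \<in> carrier A \<Longrightarrow> cst c \<in> centralizer FA P"
  by (simp add: centralizer_def cst_commute)

lemma cst_add: "c \<in> carrier A \<Longrightarrow> d \<in> carrier A \<Longrightarrow> cst c \<oplus>\<^bsub>FA\<^esub> cst d = cst (c \<oplus> d)"
  by (auto simp: FA_add cst_def)

lemma cst_cst_mult: "c \<in> carrier A \<Longrightarrow> d \<in> carrier A \<Longrightarrow> cst c \<otimes>\<^bsub>FA\<^esub> cst d = cst (c \<otimes> d)"
  by (rule ext) (simp add: cst_mult, simp add: cst_def)

lemma cst_zero: "cst \<zero> = \<zero>\<^bsub>FA\<^esub>"
  by (auto simp: FA_zero cst_def)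

lemma cst_inject [simp]: "cst c = cst d \<longleftrightarrow> c = d"
  by (auto simp: cst_def fun_eq_iff)

lemma dle_cst: "dle (cst c) 0"
  by (auto simp: dle_def cst_def)

lemma deg_cst: "deg (cst c) = 0"
  using deg_le[OF dle_cst] by simp

lemma deg_0_cst: "f \<in> carrier FA \<Longrightarrow> dle f 0 \<Longrightarrow> f = cst (f [])"
  by (rule ext) (auto simp: cst_def dle_zero)

lemma homog_cst: "homog (cst c) 0"
  by (auto simp: homog_def cst_def)

lemma homog_minus: "f \<in> carrier FA \<Longrightarrow> g \<in> carrier FA \<Longrightarrow> homog f n \<Longrightarrow> homog g n \<Longrightarrow> homog (f \<ominus>\<^bsub>FA\<^esub> g) n"
  unfolding homog_def FA_minus by (metis A.minus_eq A.l_zero A.minus_zero A.zero_closed)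

lemma homog_pow:
  assumes "f \<in> carrier FA" "homog f n"
  shows "homog (f [^]\<^bsub>FA\<^esub> (k::nat)) (k * n)"
proof (induction k)
  case 0
  then show ?case by (simp add: FA_one_cst homog_cst)
next
  case (Suc k)
  then show ?case using homog_mult[OF _ assms(1) Suc assms(2)] assms by (simp add: add.commute)
qed

lemma dle_pow:
  assumes "f \<in> carrier FA" "dle f n"
  shows "dle (f [^]\<^bsub>FA\<^esub> (k::nat)) (k * n)"
proof (induction k)
  case 0
  then show ?case by (simp add: FA_one_cst dle_cst)
next
  case (Suc k)
  then show ?case using dle_mult[OF _ assms(1) Suc assms(2)] assms by (simp add: add.commute)
qed

lemma component_pow:
  assumes "f \<in> carrier FA" "dle f n"
  shows "component (k * n) (f [^]\<^bsub>FA\<^esub> (k::nat)) = component n f [^]\<^bsub>FA\<^esub> k"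
proof (induction k)
  case 0
  then show ?case by (simp add: FA_one_cst component_hom homog_cst)
next
  case (Suc k)
  have "component (k * n + n) (f [^]\<^bsub>FA\<^esub> k \<otimes>\<^bsub>FA\<^esub> f) = component (k * n) (f [^]\<^bsub>FA\<^esub> k) \<otimes>\<^bsub>FA\<^esub> component n f"
    using assms by (intro component_mult dle_pow) auto
  then show ?case using Suc by (simp add: add.commute)
qed

lemma pow_nonzero:
  assumes "f \<in> carrier FA" "f \<noteq> \<zero>\<^bsub>FA\<^esub>"
  shows "f [^]\<^bsub>FA\<^esub> (k::nat) \<noteq> \<zero>\<^bsub>FA\<^esub>"
  by (induction k) (use assms FA_one_neq_zero FA_integral(1) in auto)

abbreviation top :: "('x list \<Rightarrow> 'a) \<Rightarrow> 'x list \<Rightarrow> 'a" where "top f \<equiv> component (deg f) f"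

lemma top_nonzero: "f \<in> carrier FA \<Longrightarrow> f \<noteq> \<zero>\<^bsub>FA\<^esub> \<Longrightarrow> top f \<noteq> \<zero>\<^bsub>FA\<^esub>"
  using deg_witness[of f] by (auto simp: component_def FA_zero fun_eq_iff)

lemma deg_less:
  assumes "f \<in> carrier FA" "f \<noteq> \<zero>\<^bsub>FA\<^esub>" "dle f n" "component n f = \<zero>\<^bsub>FA\<^esub>"
  shows "deg f < n"
proof -
  have "deg f \<noteq> n" using top_nonzero[OF assms(1,2)] assms(4) by auto
  then show ?thesis using deg_le[OF assms(3)] by simp
qed

lemma deg_eq_comp:
  assumes "f \<in> carrier FA" "dle f n" "component n f \<noteq> \<zero>\<^bsub>FA\<^esub>"
  shows "deg f = n"
proof -
  obtain w where "component n f w \<noteq> \<zero>" using assms(3) by (auto simp: FA_zero)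
  then show ?thesis using assms by (intro deg_eqI[of f n w]) (auto simp: component_def split: if_splits)
qed

lemma top_mult:
  assumes "f \<in> carrier FA" "g \<in> carrier FA" "f \<noteq> \<zero>\<^bsub>FA\<^esub>" "g \<noteq> \<zero>\<^bsub>FA\<^esub>"
  shows "top (f \<otimes>\<^bsub>FA\<^esub> g) = top f \<otimes>\<^bsub>FA\<^esub> top g"
  using component_mult[OF assms(1,2) dle_deg dle_deg] FA_integral(2)[OF assms] assms by simp

end

section \<open>Commuting homogeneous elements over a field\<close>

locale free_alg_field = free_alg K S + K: field K
  for K :: "('k, 'm) ring_scheme" (structure) and S :: "'x set"
begin

lemma K_inverse: "c \<in> carrier K \<Longrightarrow> c \<noteq> \<zero> \<Longrightarrow> \<exists>d\<in>carrier K. d \<noteq> \<zero> \<and> d \<otimes> c = \<one>"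
proof -
  assume c: "c \<in> carrier K" "c \<noteq> \<zero>"
  then have "c \<in> Units K" by (simp add: K.field_Units)
  then have "inv c \<in> carrier K" "inv c \<otimes> c = \<one>" by auto
  moreover have "inv c \<noteq> \<zero>" using calculation c by auto
  ultimately show ?thesis by blast
qed

text \<open>Subtracting a multiple of \<open>r\<close> from \<open>r'\<close> gives an
  \<open>s\<close> that vanishes at one word \<open>a\<close> of \<open>r\<close>. If
  \<open>s\<close> were nonzero, then \<open>s Q = Q s\<close>, for a power \<open>Q\<close> of
  \<open>P\<close>, would make \<open>Q\<close> vanish at every word beginning with
  \<open>a\<close>, and then \<open>r Q = Q r\<close> would make \<open>Q\<close> vanish
  everywhere.\<close>

lemma homog_commute_proportional:
  assumes c: "r \<in> carrier FA" "r' \<in> centralizer FA P" "r \<in> centralizer FA P" "P \<in> carrier FA"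
    and h: "homog r n" "homog r' n" "homog P m" "0 < m"
    and nz: "P \<noteq> \<zero>\<^bsub>FA\<^esub>" "r \<noteq> \<zero>\<^bsub>FA\<^esub>"
  shows "\<exists>k\<in>carrier K. r' = cst k \<otimes>\<^bsub>FA\<^esub> r"
proof -
  \<comment> \<open>The exponent \<open>n\<close> makes the words of \<open>Q\<close> at least as
    long as those of \<open>r\<close>, because \<open>m\<close> is positive; a prefix of length
    \<open>n\<close> then lies inside a word of \<open>Q\<close>.\<close>
  define Q where "Q = P [^]\<^bsub>FA\<^esub> n"
  define N where "N = n * m"
  have Q: "Q \<in> carrier FA" "homog Q N" "Q \<noteq> \<zero>\<^bsub>FA\<^esub>"
    using c h nz by (simp_all add: Q_def N_def homog_pow pow_nonzero)
  have N: "n \<le> N" using h by (simp add: N_def)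
  have comm: "s \<otimes>\<^bsub>FA\<^esub> Q = Q \<otimes>\<^bsub>FA\<^esub> s" if "s \<in> centralizer FA P" for s
  proof -
    have s: "s \<in> carrier FA" using that by (simp add: centralizer_def)
    have "P \<in> centralizer FA s" using that c(4) by (simp add: centralizer_def)
    then have "Q \<in> centralizer FA s" unfolding Q_def by (rule R.centralizer_pow[OF s])
    then show ?thesis by (simp add: centralizer_def)
  qed
  obtain a where a: "r a \<noteq> \<zero>" using nz by (auto simp: FA_zero)
  then have la: "length a = n" using h(1) by (simp add: homog_def)
  have r': "r' \<in> carrier FA" using c by (simp add: centralizer_def)
  obtain d where d: "d \<in> carrier K" "d \<otimes> r a = \<one>" using K_inverse[OF _ a] c by auto
  define k where "k = r' a \<otimes> d"
  define s where "s = r' \<ominus>\<^bsub>FA\<^esub> cst k \<otimes>\<^bsub>FA\<^esub> r"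
  have k: "k \<in> carrier K" using r' d by (simp add: k_def)
  have kr: "cst k \<otimes>\<^bsub>FA\<^esub> r \<in> centralizer FA P"
    using subringE(6)[OF R.centralizer_subring[OF c(4)] cst_centralizer[OF c(4) k] c(3)] .
  have sc: "s \<in> centralizer FA P" unfolding s_def by (rule R.centralizer_minus[OF c(4) c(2) kr])
  have s: "s \<in> carrier FA" using sc by (simp add: centralizer_def)
  have "homog (cst k \<otimes>\<^bsub>FA\<^esub> r) n" using homog_mult[OF cst_closed[OF k] c(1) homog_cst h(1)] by simp
  then have hs: "homog s n" unfolding s_def using c r' k h by (intro homog_minus) auto
  have sa: "s a = \<zero>"
  proof -
    have "s a = r' a \<ominus> k \<otimes> r a" using r' c k by (simp add: s_def FA_minus cst_mult)
    also have "k \<otimes> r a = r' a" using r' c d by (simp add: k_def A.m_assoc)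
    finally show ?thesis using r' by (simp add: A.r_neg A.minus_eq)
  qed
  have "s = \<zero>\<^bsub>FA\<^esub>"
  proof (rule ccontr)
    assume "s \<noteq> \<zero>\<^bsub>FA\<^esub>"
    then obtain b0 where b0: "s b0 \<noteq> \<zero>" by (auto simp: FA_zero)
    then have lb0: "length b0 = n" using hs by (simp add: homog_def)
    have Qa: "Q (a @ e) = \<zero>" if e: "length e = N - n" for e
    proof -
      have "(s \<otimes>\<^bsub>FA\<^esub> Q) (a @ (e @ b0)) = s a \<otimes> Q (e @ b0)"
        using s Q hs la lb0 e N by (intro mult_top) (auto intro: homog_dle)
      moreover have "(Q \<otimes>\<^bsub>FA\<^esub> s) ((a @ e) @ b0) = Q (a @ e) \<otimes> s b0"
        using s Q hs la lb0 e N by (intro mult_top[of _ _ N n]) (auto intro: homog_dle)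
      ultimately have "Q (a @ e) \<otimes> s b0 = \<zero>" using comm[OF sc] sa Q by simp
      then show ?thesis using b0 s Q A.integral by blast
    qed
    have "Q b = \<zero>" for b
    proof (cases "length b = N")
      case True
      have "r a \<otimes> Q b = (r \<otimes>\<^bsub>FA\<^esub> Q) (a @ b)"
        using c Q h la True by (intro mult_top[symmetric]) (auto intro: homog_dle)
      also have "\<dots> = (Q \<otimes>\<^bsub>FA\<^esub> r) ((a @ take (N - n) b) @ drop (N - n) b)"
        using comm[OF c(3)] by simp
      also have "\<dots> = Q (a @ take (N - n) b) \<otimes> r (drop (N - n) b)"
        using c Q h la True N by (intro mult_top[of _ _ N n]) (auto intro: homog_dle)
      also have "\<dots> = \<zero>" using Qa[of "take (N - n) b"] True c by simp
      finally show ?thesis using a c Q A.integral by blast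
    next
      case False
      then show ?thesis using Q(2) homog_zero by blast
    qed
    then show False using Q(3) by (auto simp: FA_zero)
  qed
  then have "r' = cst k \<otimes>\<^bsub>FA\<^esub> r"
    unfolding s_def using r' c k by simp
  then show ?thesis using k by blast
qed

text \<open>A Euclidean descent. For \<open>m \<le> n\<close> the relation shows that
  \<open>f\<close> is, up to a scalar, of the form \<open>q h\<close>; cancelling \<open>h\<close>
  on the right gives \<open>q h = k h q\<close>, with total degree \<open>n\<close> instead of
  \<open>n + m\<close>. At \<open>m = 0\<close> the element \<open>h\<close> is a scalar and
  commutes with \<open>f\<close>.\<close>

lemma homog_commute_up_to_scalar:
  assumes "f \<in> carrier FA" "h \<in> carrier FA" "f \<noteq> \<zero>\<^bsub>FA\<^esub>" "h \<noteq> \<zero>\<^bsub>FA\<^esub>"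
    "homog f n" "homog h m" "k \<in> carrier K" "f \<otimes>\<^bsub>FA\<^esub> h = cst k \<otimes>\<^bsub>FA\<^esub> (h \<otimes>\<^bsub>FA\<^esub> f)"
  shows "k = \<one>"
  using assms
proof (induction "n + m" arbitrary: f h n m k rule: less_induct)
  case less
  define N where "N = n + m"
  have main: "k = \<one>"
    if f: "f \<in> carrier FA" "f \<noteq> \<zero>\<^bsub>FA\<^esub>" "homog f n" and h: "h \<in> carrier FA" "h \<noteq> \<zero>\<^bsub>FA\<^esub>" "homog h m"
      and k: "k \<in> carrier K" and eq: "f \<otimes>\<^bsub>FA\<^esub> h = cst k \<otimes>\<^bsub>FA\<^esub> (h \<otimes>\<^bsub>FA\<^esub> f)"
      and nm: "m \<le> n" "n + m = N"
    for f h n m k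
  proof (cases "m = 0")
    case True
    have hc: "h = cst (h [])" using deg_0_cst[of h] homog_dle[OF h(3)] h True by simp
    then have "f \<otimes>\<^bsub>FA\<^esub> h = h \<otimes>\<^bsub>FA\<^esub> f" using cst_commute[of "h []" f] f h by simp
    then have "cst k \<otimes>\<^bsub>FA\<^esub> (h \<otimes>\<^bsub>FA\<^esub> f) = cst \<one> \<otimes>\<^bsub>FA\<^esub> (h \<otimes>\<^bsub>FA\<^esub> f)"
      using eq f h by (simp add: FA_one_cst[symmetric])
    then have "cst k = cst \<one>"
      using FA_r_cancel[of "h \<otimes>\<^bsub>FA\<^esub> f" "cst k" "cst \<one>"] FA_integral(1)[OF h(1) f(1) h(2) f(2)] f h k by simp
    then show ?thesis by simp
  next
    case False
    have k0: "k \<noteq> \<zero>"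
    proof
      assume "k = \<zero>"
      then have "f \<otimes>\<^bsub>FA\<^esub> h = \<zero>\<^bsub>FA\<^esub>" using eq f h by (simp add: cst_zero)
      then show False using FA_integral(1)[OF f(1) h(1) f(2) h(2)] by simp
    qed
    have kh: "cst k \<otimes>\<^bsub>FA\<^esub> h \<noteq> \<zero>\<^bsub>FA\<^esub>"
      using FA_integral(1)[of "cst k" h] k0 k h by (metis cst_closed cst_inject cst_zero)
    have "(cst k \<otimes>\<^bsub>FA\<^esub> h) \<otimes>\<^bsub>FA\<^esub> f = f \<otimes>\<^bsub>FA\<^esub> h" using eq f h k by (simp add: R.m_assoc)
    moreover have "homog (cst k \<otimes>\<^bsub>FA\<^esub> h) m" using homog_mult[OF cst_closed[OF k] h(1) homog_cst h(3)] by simp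
    ultimately obtain c q where c: "c \<in> carrier K" "c \<noteq> \<zero>"
      and q: "q \<in> carrier FA" "homog q (n - m)" "cst c \<otimes>\<^bsub>FA\<^esub> f = q \<otimes>\<^bsub>FA\<^esub> h"
      using weak_algorithm_hom[of "cst k \<otimes>\<^bsub>FA\<^esub> h" f f h m n n m] f h k kh nm by auto
    have cf: "cst c \<otimes>\<^bsub>FA\<^esub> f \<noteq> \<zero>\<^bsub>FA\<^esub>"
      using FA_integral(1)[of "cst c" f] c f by (metis cst_closed cst_inject cst_zero)
    then have q0: "q \<noteq> \<zero>\<^bsub>FA\<^esub>" using q h by auto
    have "(q \<otimes>\<^bsub>FA\<^esub> h) \<otimes>\<^bsub>FA\<^esub> h = cst c \<otimes>\<^bsub>FA\<^esub> (f \<otimes>\<^bsub>FA\<^esub> h)"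
      unfolding q(3)[symmetric] using f h c by (simp add: R.m_assoc)
    then have "(q \<otimes>\<^bsub>FA\<^esub> h) \<otimes>\<^bsub>FA\<^esub> h = cst c \<otimes>\<^bsub>FA\<^esub> (cst k \<otimes>\<^bsub>FA\<^esub> (h \<otimes>\<^bsub>FA\<^esub> f))"
      using eq by simp
    also have "\<dots> = cst k \<otimes>\<^bsub>FA\<^esub> (h \<otimes>\<^bsub>FA\<^esub> (cst c \<otimes>\<^bsub>FA\<^esub> f))"
    proof -
      have "cst c \<otimes>\<^bsub>FA\<^esub> (cst k \<otimes>\<^bsub>FA\<^esub> (h \<otimes>\<^bsub>FA\<^esub> f)) = (cst c \<otimes>\<^bsub>FA\<^esub> (cst k \<otimes>\<^bsub>FA\<^esub> h)) \<otimes>\<^bsub>FA\<^esub> f"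
        using c k h f by (simp add: R.m_assoc)
      also have "cst c \<otimes>\<^bsub>FA\<^esub> (cst k \<otimes>\<^bsub>FA\<^esub> h) = (cst k \<otimes>\<^bsub>FA\<^esub> h) \<otimes>\<^bsub>FA\<^esub> cst c"
        using c k h by (intro cst_commute) auto
      finally show ?thesis using c k h f by (simp add: R.m_assoc)
    qed
    also have "\<dots> = (cst k \<otimes>\<^bsub>FA\<^esub> (h \<otimes>\<^bsub>FA\<^esub> q)) \<otimes>\<^bsub>FA\<^esub> h" using q h k by (simp add: R.m_assoc)
    finally have "q \<otimes>\<^bsub>FA\<^esub> h = cst k \<otimes>\<^bsub>FA\<^esub> (h \<otimes>\<^bsub>FA\<^esub> q)"
      using FA_r_cancel[of h "q \<otimes>\<^bsub>FA\<^esub> h" "cst k \<otimes>\<^bsub>FA\<^esub> (h \<otimes>\<^bsub>FA\<^esub> q)"] h q k by simp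
    moreover have "(n - m) + m < N" using False nm by simp
    ultimately show ?thesis
      using less.hyps[OF _ q(1) h(1) q0 h(2) q(2) h(3) k] unfolding N_def by blast
  qed
  show ?case
  proof (cases "m \<le> n")
    case True
    then show ?thesis
      using main[OF less.prems(1,3,5,2,4,6,7,8) True] by (simp add: N_def)
  next
    \<comment> \<open>For \<open>n < m\<close> the roles of \<open>f\<close> and \<open>h\<close>
      are exchanged, which replaces \<open>k\<close> by its inverse \<open>l\<close>.\<close>
    case False
    have "f \<otimes>\<^bsub>FA\<^esub> h \<noteq> \<zero>\<^bsub>FA\<^esub>" using less.prems by (intro FA_integral)
    then have "k \<noteq> \<zero>" using less.prems by (auto simp: cst_zero)
    then obtain l where l: "l \<in> carrier K" "l \<otimes> k = \<one>" using K_inverse less.prems(7) by blast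
    have "cst l \<otimes>\<^bsub>FA\<^esub> (f \<otimes>\<^bsub>FA\<^esub> h) = (cst l \<otimes>\<^bsub>FA\<^esub> cst k) \<otimes>\<^bsub>FA\<^esub> (h \<otimes>\<^bsub>FA\<^esub> f)"
      using less.prems l by (simp add: R.m_assoc)
    also have "\<dots> = h \<otimes>\<^bsub>FA\<^esub> f"
      using less.prems l by (simp add: cst_cst_mult FA_one_cst[symmetric])
    finally have eq: "h \<otimes>\<^bsub>FA\<^esub> f = cst l \<otimes>\<^bsub>FA\<^esub> (f \<otimes>\<^bsub>FA\<^esub> h)" by simp
    have "l = \<one>"
      by (rule main[OF less.prems(2,4,6,1,3,5) l(1) eq]) (use False in \<open>auto simp: N_def\<close>)
    then show ?thesis using l less.prems by simp
  qed
qed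

end

locale free_alg_centralizer = free_alg_field K S 
  for K :: "('k, 'm) ring_scheme" (structure) and S :: "'x set" +
  fixes p
  assumes p_closed [simp, intro]: "p \<in> carrier FA" and deg_p: "0 < deg p"
begin

abbreviation C :: "('x list \<Rightarrow> 'k) set" where "C \<equiv> centralizer FA p"

lemma p_nonzero: "p \<noteq> \<zero>\<^bsub>FA\<^esub>"
  using deg_p deg_cst[of \<zero>] by (auto simp: cst_zero)

lemma C_carrier [intro]: "f \<in> C \<Longrightarrow> f \<in> carrier FA"
  by (simp add: centralizer_def)

lemma C_subring: "subring C FA"
  by (rule R.centralizer_subring) simp

lemmas C_ops [simp, intro] = subringE(2,3,5,6,7)[OF C_subring]
lemmas C_minus [simp, intro] = R.centralizer_minus[OF p_closed]
lemmas C_pow [simp, intro] = R.centralizer_pow[OF p_closed]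
lemmas C_cst [simp, intro] = cst_centralizer[OF p_closed]
lemmas C_p [simp, intro] = R.centralizer_self[OF p_closed]

lemma top_C: 
  assumes "f \<in> C" "f \<noteq> \<zero>\<^bsub>FA\<^esub>"
  shows "top f \<in> centralizer FA (top p)"
  using top_mult[of f p] top_mult[of p f] assms p_nonzero by (auto simp: centralizer_def)

lemma top_p: "top p \<in> carrier FA" "top p \<noteq> \<zero>\<^bsub>FA\<^esub>"
  by (auto simp: top_nonzero p_nonzero)

text \<open>Each homogeneous part of the centralizer of the leading form of \<open>p\<close> has
  dimension at most one over \<open>K\<close>. This is what makes leading forms of \<open>C\<close>
  behave like monomials in one variable.\<close>

lemma proportional:
  assumes "r \<in> centralizer FA (top p)" "r' \<in> centralizer FA (top p)" "homog r n" "homog r' n" "r \<noteq> \<zero>\<^bsub>FA\<^esub>"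
  shows "\<exists>k\<in>carrier K. r' = cst k \<otimes>\<^bsub>FA\<^esub> r"
  using assms top_p deg_p
  by (intro homog_commute_proportional[of r r' "top p" n "deg p"]) (auto simp: centralizer_def)

text \<open>The two products have the same degree and centralize the leading form of
  \<open>p\<close>, so they are proportional, and a relation of commutation up to a scalar has
  scalar 1.\<close>

lemma tops_commute:
  assumes "f \<in> C" "f \<noteq> \<zero>\<^bsub>FA\<^esub>" "h \<in> C" "h \<noteq> \<zero>\<^bsub>FA\<^esub>"
  shows "top f \<otimes>\<^bsub>FA\<^esub> top h = top h \<otimes>\<^bsub>FA\<^esub> top f"
proof -
  note sub = R.centralizer_subring[OF top_p(1)]
  have c: "top f \<in> carrier FA" "top h \<in> carrier FA" using assms by auto
  have nz: "top f \<noteq> \<zero>\<^bsub>FA\<^esub>" "top h \<noteq> \<zero>\<^bsub>FA\<^esub>" using assms by (simp_all add: top_nonzero C_carrier)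
  have "homog (top f \<otimes>\<^bsub>FA\<^esub> top h) (deg f + deg h)" using c by (intro homog_mult) auto
  moreover have "homog (top h \<otimes>\<^bsub>FA\<^esub> top f) (deg f + deg h)"
    using homog_mult[OF c(2,1) homog_comp homog_comp] by (simp add: add.commute)
  moreover have "top h \<otimes>\<^bsub>FA\<^esub> top f \<noteq> \<zero>\<^bsub>FA\<^esub>" using c nz by (intro FA_integral)
  ultimately obtain k where k: "k \<in> carrier K" 
    "top f \<otimes>\<^bsub>FA\<^esub> top h = cst k \<otimes>\<^bsub>FA\<^esub> (top h \<otimes>\<^bsub>FA\<^esub> top f)"
    using proportional[of "top h \<otimes>\<^bsub>FA\<^esub> top f" "top f \<otimes>\<^bsub>FA\<^esub> top h" "deg f + deg h"]
      subringE(6)[OF sub] top_C assms by blast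
  then have "k = \<one>" using homog_commute_up_to_scalar[OF c nz homog_comp homog_comp] by blast
  then show ?thesis using k c by (simp add: FA_one_cst[symmetric])
qed

section \<open>Commutativity, by descent on the degree lost in a commutator\<close>

definition commutator :: "('x list \<Rightarrow> 'k) \<Rightarrow> ('x list \<Rightarrow> 'k) \<Rightarrow> 'x list \<Rightarrow> 'k" where
  "commutator f h = f \<otimes>\<^bsub>FA\<^esub> h \<ominus>\<^bsub>FA\<^esub> h \<otimes>\<^bsub>FA\<^esub> f"

lemma commutator_C [simp, intro]: "f \<in> C \<Longrightarrow> h \<in> C \<Longrightarrow> commutator f h \<in> C"
  unfolding commutator_def by (intro C_minus C_ops)

lemma commutator_zero_iff: "f \<in> C \<Longrightarrow> h \<in> C \<Longrightarrow> commutator f h = \<zero>\<^bsub>FA\<^esub> \<longleftrightarrow> f \<otimes>\<^bsub>FA\<^esub> h = h \<otimes>\<^bsub>FA\<^esub> f"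
  unfolding commutator_def by (auto simp: C_carrier)

lemma commutator_0:
  assumes "f \<in> C"
  shows "commutator f \<zero>\<^bsub>FA\<^esub> = \<zero>\<^bsub>FA\<^esub>" "commutator \<zero>\<^bsub>FA\<^esub> f = \<zero>\<^bsub>FA\<^esub>"
  using assms by (simp_all add: commutator_zero_iff C_carrier)

lemma deg_commutator_le:
  assumes "f \<in> C" "h \<in> C"
  shows "deg (commutator f h) \<le> deg f + deg h"
proof -
  have "dle (f \<otimes>\<^bsub>FA\<^esub> h) (deg f + deg h)" "dle (h \<otimes>\<^bsub>FA\<^esub> f) (deg f + deg h)"
    using assms dle_mult[of h f "deg h" "deg f"] dle_mult[of f h "deg f" "deg h"]
    by (simp_all add: add.commute C_carrier dle_deg)
  then show ?thesis unfolding commutator_def using assms by (intro deg_le dle_minus) auto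
qed

text \<open>By the Leibniz rule the commutator of a power is a sum of \<open>j + 1\<close> terms,
  whose leading forms agree because those of \<open>f\<close> and of the commutator \<open>e\<close>
  commute. In positive characteristic the factor \<open>j + 1\<close>, and with it this component,
  can be zero.\<close>

lemma pow_commutator:
  assumes f: "f \<in> C" and h: "h \<in> C" and ne: "commutator f h \<noteq> \<zero>\<^bsub>FA\<^esub>"
  defines "e \<equiv> commutator f h"
  shows "dle (commutator (f [^]\<^bsub>FA\<^esub> Suc j) h) (j * deg f + deg e) \<and>
    component (j * deg f + deg e) (commutator (f [^]\<^bsub>FA\<^esub> Suc j) h)
      = cst (add_pow K (Suc j) \<one>) \<otimes>\<^bsub>FA\<^esub> (top f [^]\<^bsub>FA\<^esub> j \<otimes>\<^bsub>FA\<^esub> top e)"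
proof (induction j)
  case 0
  have "e \<in> carrier FA" using f h by (auto simp: e_def)
  moreover have "top e \<in> carrier FA" using f h by (auto simp: e_def)
  ultimately show ?case using f by (auto simp: e_def[symmetric] dle_deg C_carrier FA_one_cst[symmetric])
next
  case (Suc j)
  have e: "e \<in> C" "e \<noteq> \<zero>\<^bsub>FA\<^esub>" using f h ne by (auto simp: e_def)
  have f0: "f \<noteq> \<zero>\<^bsub>FA\<^esub>" using ne h by (auto simp: commutator_0)
  define F where "F = f [^]\<^bsub>FA\<^esub> Suc j"
  have F: "F \<in> C" using f by (simp add: F_def del: R.nat_pow_Suc)
  note cl = f[THEN C_carrier] h[THEN C_carrier] e(1)[THEN C_carrier] F[THEN C_carrier]
  have eq: "commutator (f [^]\<^bsub>FA\<^esub> Suc (Suc j)) h = commutator F h \<otimes>\<^bsub>FA\<^esub> f \<oplus>\<^bsub>FA\<^esub> F \<otimes>\<^bsub>FA\<^esub> e"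
  proof -
    have "f [^]\<^bsub>FA\<^esub> Suc (Suc j) = F \<otimes>\<^bsub>FA\<^esub> f" by (simp add: F_def)
    moreover have "commutator (F \<otimes>\<^bsub>FA\<^esub> f) h = commutator F h \<otimes>\<^bsub>FA\<^esub> f \<oplus>\<^bsub>FA\<^esub> F \<otimes>\<^bsub>FA\<^esub> e"
      unfolding commutator_def e_def using cl by algebra
    ultimately show ?thesis by simp
  qed
  have n: "Suc j * deg f + deg e = (j * deg f + deg e) + deg f" by simp
  have d1: "dle (commutator F h \<otimes>\<^bsub>FA\<^esub> f) (Suc j * deg f + deg e)"
    unfolding n using conjunct1[OF Suc[folded F_def]] F h f by (intro dle_mult dle_deg) auto
  have dF: "dle F (Suc j * deg f)"
    unfolding F_def by (rule dle_pow[OF cl(1) dle_deg[OF cl(1)]])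
  have d2: "dle (F \<otimes>\<^bsub>FA\<^esub> e) (Suc j * deg f + deg e)"
    using dF cl by (intro dle_mult dle_deg)
  let ?c = "add_pow K (Suc j) \<one>" and ?t = "top f [^]\<^bsub>FA\<^esub> j"
  have c: "?c \<in> carrier K" by simp
  have t: "?t \<in> carrier FA" "top e \<in> carrier FA" "top f \<in> carrier FA" using cl by auto
  have "component (Suc j * deg f + deg e) (commutator F h \<otimes>\<^bsub>FA\<^esub> f) =
      (cst ?c \<otimes>\<^bsub>FA\<^esub> (?t \<otimes>\<^bsub>FA\<^esub> top e)) \<otimes>\<^bsub>FA\<^esub> top f"
    unfolding n using conjunct1[OF Suc[folded F_def]] conjunct2[OF Suc[folded F_def]] cl F h
    by (subst component_mult) (auto simp: dle_deg simp del: A.add.nat_pow_Suc)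
  also have "\<dots> = cst ?c \<otimes>\<^bsub>FA\<^esub> ((?t \<otimes>\<^bsub>FA\<^esub> top f) \<otimes>\<^bsub>FA\<^esub> top e)"
    using t c tops_commute[OF f f0 e] by (simp add: R.m_assoc del: A.add.nat_pow_Suc)
  finally have c1: "component (Suc j * deg f + deg e) (commutator F h \<otimes>\<^bsub>FA\<^esub> f) =
     cst ?c \<otimes>\<^bsub>FA\<^esub> ((?t \<otimes>\<^bsub>FA\<^esub> top f) \<otimes>\<^bsub>FA\<^esub> top e)" .
  have "component (Suc j * deg f) F = ?t \<otimes>\<^bsub>FA\<^esub> top f"
    using component_pow[OF cl(1) dle_deg[OF cl(1)], of "Suc j"] by (simp add: F_def)
  then have c2: "component (Suc j * deg f + deg e) (F \<otimes>\<^bsub>FA\<^esub> e) = (?t \<otimes>\<^bsub>FA\<^esub> top f) \<otimes>\<^bsub>FA\<^esub> top e"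
    using component_mult[OF cl(4,3) dF dle_deg[OF cl(3)]] by simp
  have X: "(?t \<otimes>\<^bsub>FA\<^esub> top f) \<otimes>\<^bsub>FA\<^esub> top e \<in> carrier FA" using t by simp
  have "add_pow K (Suc (Suc j)) \<one> = ?c \<oplus> \<one>" by simp
  then have "cst (add_pow K (Suc (Suc j)) \<one>) = cst ?c \<oplus>\<^bsub>FA\<^esub> \<one>\<^bsub>FA\<^esub>"
    using c by (simp add: cst_add FA_one_cst del: A.add.nat_pow_Suc)
  then have "component (Suc j * deg f + deg e) (commutator (f [^]\<^bsub>FA\<^esub> Suc (Suc j)) h)
     = cst (add_pow K (Suc (Suc j)) \<one>) \<otimes>\<^bsub>FA\<^esub> ((?t \<otimes>\<^bsub>FA\<^esub> top f) \<otimes>\<^bsub>FA\<^esub> top e)"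
    unfolding eq component_add c1 c2 using X c by (simp add: R.l_distr del: A.add.nat_pow_Suc)
  then show ?case using dle_add[OF d1 d2] eq by simp
qed

text \<open>The descending quantity is the drop from \<open>deg f + deg h\<close> to the degree of
  the commutator. The powers \<open>f^(j+1)\<close> and \<open>h^i\<close> have equal degrees, hence
  proportional leading forms. Subtracting the right multiple of \<open>h^i\<close> lowers the degree
  of \<open>f^(j+1)\<close> but does not change its commutator with \<open>h\<close>.\<close>

lemma smaller_defect:
  assumes f: "f \<in> C" and h: "h \<in> C" and ne: "commutator f h \<noteq> \<zero>\<^bsub>FA\<^esub>"
    and j: "add_pow K (Suc j) \<one> \<noteq> \<zero>" "Suc j * deg f = i * deg h"
  shows "\<exists>f'\<in>C. commutator f' h \<noteq> \<zero>\<^bsub>FA\<^esub> \<and>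
    deg f' + deg h - deg (commutator f' h) < deg f + deg h - deg (commutator f h)"
proof -
  define e where "e = commutator f h"
  have e: "e \<in> C" "e \<noteq> \<zero>\<^bsub>FA\<^esub>" using f h ne by (auto simp: e_def)
  have f0: "f \<noteq> \<zero>\<^bsub>FA\<^esub>" "h \<noteq> \<zero>\<^bsub>FA\<^esub>" using ne f h by (auto simp: commutator_0)
  define F H where "F = f [^]\<^bsub>FA\<^esub> Suc j" and "H = h [^]\<^bsub>FA\<^esub> i"
  have F: "F \<in> C" and H: "H \<in> C" using f h by (simp_all add: F_def H_def del: R.nat_pow_Suc)
  note cl = f[THEN C_carrier] h[THEN C_carrier] e(1)[THEN C_carrier] F[THEN C_carrier] H[THEN C_carrier]
  let ?N = "Suc j * deg f"
  have dF: "dle F ?N" unfolding F_def by (rule dle_pow[OF cl(1) dle_deg[OF cl(1)]])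
  have dH: "dle H ?N" unfolding H_def j(2) by (rule dle_pow[OF cl(2) dle_deg[OF cl(2)]])
  have tF: "component ?N F = top f [^]\<^bsub>FA\<^esub> Suc j" unfolding F_def by (rule component_pow[OF cl(1) dle_deg[OF cl(1)]])
  have tH: "component ?N H = top h [^]\<^bsub>FA\<^esub> i" unfolding H_def j(2) by (rule component_pow[OF cl(2) dle_deg[OF cl(2)]])
  have "component ?N F \<in> centralizer FA (top p)"
    unfolding tF using f f0 by (intro R.centralizer_pow top_p top_C)
  moreover have "component ?N H \<in> centralizer FA (top p)"
    unfolding tH using h f0 by (intro R.centralizer_pow top_p top_C)
  moreover have "component ?N H \<noteq> \<zero>\<^bsub>FA\<^esub>" unfolding tH using cl f0 by (intro pow_nonzero top_nonzero) auto
  ultimately obtain k where k: "k \<in> carrier K" "component ?N F = cst k \<otimes>\<^bsub>FA\<^esub> component ?N H"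
    using proportional homog_comp by blast
  \<comment> \<open>The leading forms cancel, so \<open>f'\<close> has degree below
    \<open>(j+1) deg f\<close>, whereas its commutator with \<open>h\<close> keeps the degree
    \<open>j deg f + deg e\<close>.\<close>
  define f' where "f' = F \<ominus>\<^bsub>FA\<^esub> cst k \<otimes>\<^bsub>FA\<^esub> H"
  have f': "f' \<in> C" unfolding f'_def using F H k by auto
  have "commutator f' h = commutator F h \<ominus>\<^bsub>FA\<^esub> cst k \<otimes>\<^bsub>FA\<^esub> commutator H h"
  proof -
    have "h \<otimes>\<^bsub>FA\<^esub> (cst k \<otimes>\<^bsub>FA\<^esub> H) = cst k \<otimes>\<^bsub>FA\<^esub> (h \<otimes>\<^bsub>FA\<^esub> H)"
      using cst_commute[OF k(1) cl(2)] cl k by (simp add: R.m_assoc[symmetric])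
    moreover have "(F \<ominus>\<^bsub>FA\<^esub> cst k \<otimes>\<^bsub>FA\<^esub> H) \<otimes>\<^bsub>FA\<^esub> h \<ominus>\<^bsub>FA\<^esub> h \<otimes>\<^bsub>FA\<^esub> (F \<ominus>\<^bsub>FA\<^esub> cst k \<otimes>\<^bsub>FA\<^esub> H)
      = (F \<otimes>\<^bsub>FA\<^esub> h \<ominus>\<^bsub>FA\<^esub> h \<otimes>\<^bsub>FA\<^esub> F) \<ominus>\<^bsub>FA\<^esub> (cst k \<otimes>\<^bsub>FA\<^esub> (H \<otimes>\<^bsub>FA\<^esub> h) \<ominus>\<^bsub>FA\<^esub> h \<otimes>\<^bsub>FA\<^esub> (cst k \<otimes>\<^bsub>FA\<^esub> H))"
      using cl cst_closed[OF k(1)] by algebra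
    moreover have "cst k \<otimes>\<^bsub>FA\<^esub> (H \<otimes>\<^bsub>FA\<^esub> h) \<ominus>\<^bsub>FA\<^esub> cst k \<otimes>\<^bsub>FA\<^esub> (h \<otimes>\<^bsub>FA\<^esub> H) 
      = cst k \<otimes>\<^bsub>FA\<^esub> (H \<otimes>\<^bsub>FA\<^esub> h \<ominus>\<^bsub>FA\<^esub> h \<otimes>\<^bsub>FA\<^esub> H)"
      using cl cst_closed[OF k(1)] by algebra
    ultimately show ?thesis unfolding commutator_def f'_def by simp
  qed
  also have "commutator H h = \<zero>\<^bsub>FA\<^esub>"
  proof -
    have "h \<in> centralizer FA h" by (rule R.centralizer_self[OF cl(2)])
    then have "H \<in> centralizer FA h" unfolding H_def by (rule R.centralizer_pow[OF cl(2)])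
    then show ?thesis using commutator_zero_iff[OF H h] by (simp add: centralizer_def)
  qed
  finally have eq: "commutator f' h = commutator F h"
    using k F h by (simp add: R.minus_eq C_carrier)
  have "top f [^]\<^bsub>FA\<^esub> j \<otimes>\<^bsub>FA\<^esub> top e \<noteq> \<zero>\<^bsub>FA\<^esub>"
    using cl e f0 by (intro FA_integral pow_nonzero top_nonzero) auto
  then have "cst (add_pow K (Suc j) \<one>) \<otimes>\<^bsub>FA\<^esub> (top f [^]\<^bsub>FA\<^esub> j \<otimes>\<^bsub>FA\<^esub> top e) \<noteq> \<zero>\<^bsub>FA\<^esub>"
    using cl j(1) cst_inject[of "add_pow K (Suc j) \<one>" \<zero>] 
    by (intro FA_integral) (auto simp: cst_zero simp del: A.add.nat_pow_Suc)
  then have dc: "deg (commutator F h) = j * deg f + deg e"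
    using pow_commutator[OF f h ne, of j] F h
    by (intro deg_eq_comp) (auto simp: e_def F_def simp del: A.add.nat_pow_Suc R.nat_pow_Suc)
  have ne': "commutator f' h \<noteq> \<zero>\<^bsub>FA\<^esub>"
  proof
    assume "commutator f' h = \<zero>\<^bsub>FA\<^esub>"
    then have "component (j * deg f + deg e) (commutator F h) = \<zero>\<^bsub>FA\<^esub>" using eq by (auto simp: component_def FA_zero)
    then show False
      using pow_commutator[OF f h ne, of j]
        \<open>cst (add_pow K (Suc j) \<one>) \<otimes>\<^bsub>FA\<^esub> (top f [^]\<^bsub>FA\<^esub> j \<otimes>\<^bsub>FA\<^esub> top e) \<noteq> \<zero>\<^bsub>FA\<^esub>\<close>
      by (simp add: F_def e_def del: A.add.nat_pow_Suc R.nat_pow_Suc)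
  qed
  have f'0: "f' \<noteq> \<zero>\<^bsub>FA\<^esub>" using ne' h by (auto simp: commutator_0)
  have kH: "cst k \<otimes>\<^bsub>FA\<^esub> H \<in> carrier FA" using k cl by auto
  have dkH: "dle (cst k \<otimes>\<^bsub>FA\<^esub> H) ?N" using dle_mult[OF _ cl(5) dle_cst dH, of k] k by simp
  have "component ?N (cst k \<otimes>\<^bsub>FA\<^esub> H) = cst k \<otimes>\<^bsub>FA\<^esub> component ?N H"
    using component_mult[OF cst_closed[OF k(1)] cl(5) dle_cst dH] by (simp add: component_hom homog_cst)
  then have "component ?N f' = \<zero>\<^bsub>FA\<^esub>"
    unfolding f'_def using component_minus[OF cl(4) kH] k cl kH by simp
  then have "deg f' < ?N"
    using f' f'0 dle_minus[OF cl(4) kH dF dkH] by (intro deg_less) (auto simp: f'_def)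
  \<comment> \<open>Subtraction of natural numbers is truncated; these two bounds ensure that both
    drops are true differences.\<close>
  moreover have "deg (commutator f' h) \<le> deg f' + deg h" by (rule deg_commutator_le[OF f' h])
  moreover have "deg (commutator f h) \<le> deg f + deg h" by (rule deg_commutator_le[OF f h])
  ultimately have "deg f' + deg h - deg (commutator f' h) < deg f + deg h - deg (commutator f h)"
    using dc eq by (simp add: e_def)
  then show ?thesis using f' ne' by blast
qed

lemma commutator_swap:
  assumes "f \<in> C" "h \<in> C"
  shows "commutator h f = \<ominus>\<^bsub>FA\<^esub> commutator f h"
  unfolding commutator_def using assms[THEN C_carrier] by algebra

lemma deg_uminus: "f \<in> carrier FA \<Longrightarrow> deg (\<ominus>\<^bsub>FA\<^esub> f) = deg f"
proof -
  assume f: "f \<in> carrier FA"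
  have "(\<ominus> x = \<zero>) = (x = \<zero>)" if "x \<in> carrier K" for x
    using that A.add.inv_eq_1_iff by auto
  then show ?thesis using f by (simp add: deg_def dle_def FA_uminus)
qed

text \<open>Take a noncommuting pair with minimal drop. Dividing its degrees by their gcd gives
  coprime exponents \<open>i + 1\<close> and \<open>j + 1\<close>; one of them is nonzero in
  \<open>K\<close>, and the descent applies to the pair or to the pair in the other order.\<close>

lemma C_commute:
  assumes "f \<in> C" "h \<in> C"
  shows "f \<otimes>\<^bsub>FA\<^esub> h = h \<otimes>\<^bsub>FA\<^esub> f"
proof -
  have "commutator f h = \<zero>\<^bsub>FA\<^esub>"
    using assms
  proof (induction "deg f + deg h - deg (commutator f h)" arbitrary: f h rule: less_induct)
    case less
    note f = less.prems(1) and h = less.prems(2)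
    show ?case
    proof (rule ccontr)
      assume ne: "commutator f h \<noteq> \<zero>\<^bsub>FA\<^esub>"
      have pos: "0 < deg f" if "f \<in> C" "h \<in> C" "commutator f h \<noteq> \<zero>\<^bsub>FA\<^esub>" for f h
      proof (rule ccontr)
        assume "\<not> 0 < deg f"
        then have "f = cst (f [])" using deg_0_cst[of f] dle_deg[of f] that by auto
        then have "f \<otimes>\<^bsub>FA\<^esub> h = h \<otimes>\<^bsub>FA\<^esub> f"
          using cst_commute[of "f []" h] that by (metis C_carrier FA_coeff)
        then show False using that commutator_zero_iff by blast
      qed
      have ne': "commutator h f \<noteq> \<zero>\<^bsub>FA\<^esub>" using ne f h by (auto simp: commutator_zero_iff)
      have eqd: "deg (commutator h f) = deg (commutator f h)"
        using commutator_swap[OF f h] deg_uminus[of "commutator f h"] f h by auto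
      define n m where "n = deg f" and "m = deg h"
      have nm: "0 < n" "0 < m" using pos[OF f h ne] pos[OF h f ne'] by (simp_all add: n_def m_def)
      define g where "g = gcd n m"
      have g0: "0 < g" using nm by (simp add: g_def)
      have dv: "g * (n div g) = n" "g * (m div g) = m" by (simp_all add: g_def)
      obtain i j where i: "n div g = Suc i" and j: "m div g = Suc j"
        using dv nm by (metis gr0_implies_Suc mult_is_0 neq0_conv)
      have e: "Suc j * n = Suc i * m"
        using dv i j by (metis mult.assoc mult.commute)
      have cop: "coprime (Suc i) (Suc j)"
        using div_gcd_coprime[of n m] nm i j by (simp add: g_def)
      \<comment> \<open>If both coprime multiples of 1 were zero in \<open>K\<close>, a Bezout
        relation would give \<open>1 = 0\<close>.\<close>
      have "add_pow K (Suc i) \<one> \<noteq> \<zero> \<or> add_pow K (Suc j) \<one> \<noteq> \<zero>"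
      proof (rule ccontr)
        assume "\<not> ?thesis"
        then have z: "add_pow K (Suc i) \<one> = \<zero>" "add_pow K (Suc j) \<one> = \<zero>" by auto
        obtain x y where "Suc i * x = Suc j * y + gcd (Suc i) (Suc j)"
          using bezout_nat[of "Suc i" "Suc j"] by auto
        then have xy: "Suc i * x = Suc (Suc j * y)" using cop by simp
        have "add_pow K (Suc i * x) \<one> = add_pow K x (add_pow K (Suc i) \<one>)" by (rule A.add.nat_pow_pow[symmetric, OF A.one_closed])
        moreover have "add_pow K (Suc j * y) \<one> = add_pow K y (add_pow K (Suc j) \<one>)" by (rule A.add.nat_pow_pow[symmetric, OF A.one_closed])
        moreover have "add_pow K (Suc (Suc j * y)) \<one> = add_pow K (Suc j * y) \<one> \<oplus> \<one>" by (rule A.add.nat_pow_Suc)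
        ultimately have "\<zero> = \<zero> \<oplus> \<one>" unfolding xy z by (simp del: A.add.nat_pow_Suc)
        then show False by simp
      qed
      then show False
      proof
        assume a: "add_pow K (Suc j) \<one> \<noteq> \<zero>"
        obtain f' where "f' \<in> C" "commutator f' h \<noteq> \<zero>\<^bsub>FA\<^esub>" 
          "deg f' + deg h - deg (commutator f' h) < deg f + deg h - deg (commutator f h)"
          using smaller_defect[OF f h ne a, of "Suc i"] e by (auto simp: n_def m_def)
        then show False using less.hyps[of f' h] h by blast
      next
        assume a: "add_pow K (Suc i) \<one> \<noteq> \<zero>"
        obtain h' where "h' \<in> C" "commutator h' f \<noteq> \<zero>\<^bsub>FA\<^esub>" 
          "deg h' + deg f - deg (commutator h' f) < deg h + deg f - deg (commutator h f)"
          using smaller_defect[OF h f ne' a, of "Suc j"] e by (auto simp: n_def m_def)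
        then show False using less.hyps[of h' f] f eqd by (simp add: add.commute)
      qed
    qed
  qed
  then show ?thesis using commutator_zero_iff assms by blast
qed

end

subsection \<open>The free algebra over a centralizer\<close>

context free_alg
begin

text \<open>The Euclidean algorithm for right divisors, with denominators cleared: \<open>d\<close>
  divides \<open>u\<close> and \<open>v\<close> only after multiplication by nonzero constants. Two
  elements of a free algebra need not have a nonzero common left multiple, so one,
  \<open>x u = y v\<close>, is assumed. It is what allows division with remainder, and it passes to
  the remainder.\<close>

lemma euclid:
  assumes "u \<in> carrier FA" "v \<in> carrier FA" "u \<noteq> \<zero>\<^bsub>FA\<^esub>" "v \<noteq> \<zero>\<^bsub>FA\<^esub>"
    "x \<in> carrier FA" "y \<in> carrier FA" "x \<noteq> \<zero>\<^bsub>FA\<^esub>" "x \<otimes>\<^bsub>FA\<^esub> u = y \<otimes>\<^bsub>FA\<^esub> v"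
  shows "\<exists>d\<in>carrier FA. d \<noteq> \<zero>\<^bsub>FA\<^esub> \<and>
    (\<exists>\<alpha>\<in>carrier FA. \<exists>\<beta>\<in>carrier FA. d = \<alpha> \<otimes>\<^bsub>FA\<^esub> u \<oplus>\<^bsub>FA\<^esub> \<beta> \<otimes>\<^bsub>FA\<^esub> v) \<and>
    (\<exists>f\<in>carrier A. f \<noteq> \<zero> \<and> (\<exists>h\<in>carrier FA. cst f \<otimes>\<^bsub>FA\<^esub> u = h \<otimes>\<^bsub>FA\<^esub> d)) \<and>
    (\<exists>f\<in>carrier A. f \<noteq> \<zero> \<and> (\<exists>h\<in>carrier FA. cst f \<otimes>\<^bsub>FA\<^esub> v = h \<otimes>\<^bsub>FA\<^esub> d))"
    (is "?gcd u v")
  using assms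
proof (induction "deg u + deg v" arbitrary: u v x y rule: less_induct)
  case less
  define N where "N = deg u + deg v"
  have main: "?gcd u v"
    if u: "u \<in> carrier FA" "u \<noteq> \<zero>\<^bsub>FA\<^esub>" and v: "v \<in> carrier FA" "v \<noteq> \<zero>\<^bsub>FA\<^esub>" 
      and x: "x \<in> carrier FA" "x \<noteq> \<zero>\<^bsub>FA\<^esub>" and y: "y \<in> carrier FA" "y \<noteq> \<zero>\<^bsub>FA\<^esub>"
      and eq: "x \<otimes>\<^bsub>FA\<^esub> u = y \<otimes>\<^bsub>FA\<^esub> v" and d: "deg v \<le> deg u" "deg u + deg v = N" for u v x y
  proof -
    have e: "deg x + deg u = deg y + deg v"
      using FA_integral(2)[OF x(1) u(1) x(2) u(2)] FA_integral(2)[OF y(1) v(1) y(2) v(2)] eq by simp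
    obtain a where a: "length a = deg x" "x a \<noteq> \<zero>" using deg_witness x by blast
    obtain q where q: "q \<in> carrier FA" "homog q (deg u - deg v)"
      "\<And>b. length b = deg u \<Longrightarrow> x a \<otimes> u b = (q \<otimes>\<^bsub>FA\<^esub> v) b"
      using weak_algorithm[OF x(1) u(1) y(1) v(1) eq dle_deg dle_deg dle_deg dle_deg e d(1) a] x u y v by blast
    define F where "F = cst (x a)"
    have xa: "x a \<in> carrier A" using x by auto
    then have F: "F \<in> carrier FA" by (simp add: F_def)
    have F0: "F \<noteq> \<zero>\<^bsub>FA\<^esub>" using a(2) by (metis F_def cst_inject cst_zero)
    have Fcomm: "F \<otimes>\<^bsub>FA\<^esub> r = r \<otimes>\<^bsub>FA\<^esub> F" if "r \<in> carrier FA" for r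
      unfolding F_def by (rule cst_commute[OF xa that])
    \<comment> \<open>The remainder of \<open>u\<close>, multiplied by the constant
      \<open>F\<close>, on division by \<open>v\<close>: the leading form is removed.\<close>
    define u' where "u' = F \<otimes>\<^bsub>FA\<^esub> u \<ominus>\<^bsub>FA\<^esub> q \<otimes>\<^bsub>FA\<^esub> v"
    have u': "u' \<in> carrier FA" using F u q v by (simp add: u'_def)
    have du': "dle u' (deg u)"
      unfolding u'_def
    proof (rule dle_minus)
      show "dle (F \<otimes>\<^bsub>FA\<^esub> u) (deg u)" using dle_mult[OF F u(1) dle_cst[of "x a", folded F_def] dle_deg[OF u(1)]] by simp
      show "dle (q \<otimes>\<^bsub>FA\<^esub> v) (deg u)" using dle_mult[OF q(1) v(1) homog_dle[OF q(2)] dle_deg[OF v(1)]] d(1) by simp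
    qed (use F u q v in auto)
    have cu': "component (deg u) u' = \<zero>\<^bsub>FA\<^esub>"
    proof
      fix b show "component (deg u) u' b = \<zero>\<^bsub>FA\<^esub> b"
        using q(3)[of b] F u q v xa by (auto simp: component_def u'_def FA_minus FA_zero cst_mult F_def A.minus_eq A.r_neg)
    qed
    have Fu: "F \<otimes>\<^bsub>FA\<^esub> u = u' \<oplus>\<^bsub>FA\<^esub> q \<otimes>\<^bsub>FA\<^esub> v"
      unfolding u'_def using F u q v by (simp add: R.minus_eq R.a_assoc R.l_neg)
    show ?thesis
    proof (cases "u' = \<zero>\<^bsub>FA\<^esub>")
      case True
      have "v = \<zero>\<^bsub>FA\<^esub> \<otimes>\<^bsub>FA\<^esub> u \<oplus>\<^bsub>FA\<^esub> \<one>\<^bsub>FA\<^esub> \<otimes>\<^bsub>FA\<^esub> v" using u v by simp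
      moreover have "cst (x a) \<otimes>\<^bsub>FA\<^esub> u = q \<otimes>\<^bsub>FA\<^esub> v" using Fu True q v by (simp add: F_def)
      moreover have "cst \<one> \<otimes>\<^bsub>FA\<^esub> v = \<one>\<^bsub>FA\<^esub> \<otimes>\<^bsub>FA\<^esub> v" by (simp add: FA_one_cst)
      ultimately show ?thesis using v q a xa A.one_not_zero A.one_closed R.one_closed R.zero_closed by blast
    next
      case False
      have dl: "deg u' < deg u" by (rule deg_less[OF u' False du' cu'])
      \<comment> \<open>As constants are central, \<open>x u' = F y v - x q v\<close>, so
        \<open>x\<close> and \<open>y'\<close> give the common left multiple for \<open>u'\<close>
        and \<open>v\<close>.\<close>
      define y' where "y' = F \<otimes>\<^bsub>FA\<^esub> y \<ominus>\<^bsub>FA\<^esub> x \<otimes>\<^bsub>FA\<^esub> q"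
      have y': "y' \<in> carrier FA" using F y x q by (simp add: y'_def)
      have "x \<otimes>\<^bsub>FA\<^esub> u' = x \<otimes>\<^bsub>FA\<^esub> (F \<otimes>\<^bsub>FA\<^esub> u) \<ominus>\<^bsub>FA\<^esub> x \<otimes>\<^bsub>FA\<^esub> (q \<otimes>\<^bsub>FA\<^esub> v)"
        unfolding u'_def using x F u q v by algebra
      also have "x \<otimes>\<^bsub>FA\<^esub> (F \<otimes>\<^bsub>FA\<^esub> u) = F \<otimes>\<^bsub>FA\<^esub> (y \<otimes>\<^bsub>FA\<^esub> v)"
      proof -
        have "x \<otimes>\<^bsub>FA\<^esub> (F \<otimes>\<^bsub>FA\<^esub> u) = (F \<otimes>\<^bsub>FA\<^esub> x) \<otimes>\<^bsub>FA\<^esub> u"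
          using x F u Fcomm[OF x(1)] by (simp add: R.m_assoc[symmetric])
        then show ?thesis using x F u eq by (simp add: R.m_assoc)
      qed
      also have "F \<otimes>\<^bsub>FA\<^esub> (y \<otimes>\<^bsub>FA\<^esub> v) \<ominus>\<^bsub>FA\<^esub> x \<otimes>\<^bsub>FA\<^esub> (q \<otimes>\<^bsub>FA\<^esub> v) = y' \<otimes>\<^bsub>FA\<^esub> v"
        unfolding y'_def using x F y q v by algebra
      finally have eq': "x \<otimes>\<^bsub>FA\<^esub> u' = y' \<otimes>\<^bsub>FA\<^esub> v" .
      have "deg u' + deg v < deg u + deg v" using dl by simp
      then have "?gcd u' v"
        using less.hyps[OF _ u' v(1) False v(2) x(1) y' x(2) eq'] d(2) unfolding N_def by simp
      then obtain e \<alpha> \<beta> f h f' h' where e: "e \<in> carrier FA" "e \<noteq> \<zero>\<^bsub>FA\<^esub>" 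
        and ab: "\<alpha> \<in> carrier FA" "\<beta> \<in> carrier FA" "e = \<alpha> \<otimes>\<^bsub>FA\<^esub> u' \<oplus>\<^bsub>FA\<^esub> \<beta> \<otimes>\<^bsub>FA\<^esub> v"
        and f: "f \<in> carrier A" "f \<noteq> \<zero>" "h \<in> carrier FA" "cst f \<otimes>\<^bsub>FA\<^esub> u' = h \<otimes>\<^bsub>FA\<^esub> e"
        and f': "f' \<in> carrier A" "f' \<noteq> \<zero>" "h' \<in> carrier FA" "cst f' \<otimes>\<^bsub>FA\<^esub> v = h' \<otimes>\<^bsub>FA\<^esub> e"
        by blast
      have "e = (\<alpha> \<otimes>\<^bsub>FA\<^esub> F) \<otimes>\<^bsub>FA\<^esub> u \<oplus>\<^bsub>FA\<^esub> (\<beta> \<ominus>\<^bsub>FA\<^esub> \<alpha> \<otimes>\<^bsub>FA\<^esub> q) \<otimes>\<^bsub>FA\<^esub> v"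
        unfolding ab(3) u'_def using ab(1,2) F u q v by algebra
      \<comment> \<open>The multiplier combines three: \<open>F\<close> from the division,
        \<open>f\<close> and \<open>f'\<close> from the divisibility of \<open>u'\<close> and
        \<open>v\<close>. After it, both terms of \<open>F u = u' + q v\<close> are left multiples
        of \<open>e\<close>.\<close>
      moreover have "cst (f' \<otimes> f \<otimes> x a) \<otimes>\<^bsub>FA\<^esub> u = (cst f' \<otimes>\<^bsub>FA\<^esub> h \<oplus>\<^bsub>FA\<^esub> cst f \<otimes>\<^bsub>FA\<^esub> (q \<otimes>\<^bsub>FA\<^esub> h')) \<otimes>\<^bsub>FA\<^esub> e"
      proof -
        have "cst (f' \<otimes> f \<otimes> x a) \<otimes>\<^bsub>FA\<^esub> u = cst f' \<otimes>\<^bsub>FA\<^esub> (cst f \<otimes>\<^bsub>FA\<^esub> (F \<otimes>\<^bsub>FA\<^esub> u))"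
          using f f' xa u by (simp add: F_def cst_cst_mult[symmetric] R.m_assoc)
        also have "\<dots> = cst f' \<otimes>\<^bsub>FA\<^esub> (cst f \<otimes>\<^bsub>FA\<^esub> u') \<oplus>\<^bsub>FA\<^esub> cst f' \<otimes>\<^bsub>FA\<^esub> (cst f \<otimes>\<^bsub>FA\<^esub> (q \<otimes>\<^bsub>FA\<^esub> v))"
          unfolding Fu using f(1)[THEN cst_closed] f'(1)[THEN cst_closed] u' q v by algebra
        also have "cst f' \<otimes>\<^bsub>FA\<^esub> (cst f \<otimes>\<^bsub>FA\<^esub> u') = (cst f' \<otimes>\<^bsub>FA\<^esub> h) \<otimes>\<^bsub>FA\<^esub> e"
          unfolding f(4) using f f' e by (simp add: R.m_assoc)
        also have "cst f' \<otimes>\<^bsub>FA\<^esub> (cst f \<otimes>\<^bsub>FA\<^esub> (q \<otimes>\<^bsub>FA\<^esub> v)) = cst f \<otimes>\<^bsub>FA\<^esub> (q \<otimes>\<^bsub>FA\<^esub> (cst f' \<otimes>\<^bsub>FA\<^esub> v))"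
        proof -
          have "cst f' \<otimes>\<^bsub>FA\<^esub> (cst f \<otimes>\<^bsub>FA\<^esub> q) = (cst f \<otimes>\<^bsub>FA\<^esub> q) \<otimes>\<^bsub>FA\<^esub> cst f'"
            using f f' q by (intro cst_commute) auto
          then have "(cst f' \<otimes>\<^bsub>FA\<^esub> (cst f \<otimes>\<^bsub>FA\<^esub> q)) \<otimes>\<^bsub>FA\<^esub> v = ((cst f \<otimes>\<^bsub>FA\<^esub> q) \<otimes>\<^bsub>FA\<^esub> cst f') \<otimes>\<^bsub>FA\<^esub> v"
            by simp
          then show ?thesis using f f' q v by (simp add: R.m_assoc)
        qed
        also have "cst f \<otimes>\<^bsub>FA\<^esub> (q \<otimes>\<^bsub>FA\<^esub> (cst f' \<otimes>\<^bsub>FA\<^esub> v)) = (cst f \<otimes>\<^bsub>FA\<^esub> (q \<otimes>\<^bsub>FA\<^esub> h')) \<otimes>\<^bsub>FA\<^esub> e"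
          unfolding f'(4) using f f' e q by (simp add: R.m_assoc)
        finally show ?thesis using f f' e q by (simp add: R.l_distr)
      qed
      moreover have "f' \<otimes> f \<otimes> x a \<noteq> \<zero>" using A.integral f f' xa a by blast
      moreover have "f' \<otimes> f \<otimes> x a \<in> carrier A" using f f' xa by simp
      moreover have "cst f' \<otimes>\<^bsub>FA\<^esub> h \<oplus>\<^bsub>FA\<^esub> cst f \<otimes>\<^bsub>FA\<^esub> (q \<otimes>\<^bsub>FA\<^esub> h') \<in> carrier FA" using f f' q by simp
      moreover have "\<alpha> \<otimes>\<^bsub>FA\<^esub> F \<in> carrier FA" "\<beta> \<ominus>\<^bsub>FA\<^esub> \<alpha> \<otimes>\<^bsub>FA\<^esub> q \<in> carrier FA" using ab F q by simp_all
      ultimately show ?thesis using e f' by blast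
    qed
  qed
  have y0: "y \<noteq> \<zero>\<^bsub>FA\<^esub>" 
    using FA_integral(1)[of x u] less.prems by auto
  show ?case
  proof (cases "deg v \<le> deg u")
    case True
    then show ?thesis using main[of u v x y] less.prems y0 N_def by blast
  next
    case False
    have "?gcd v u" using main[of v u y x] less.prems y0 N_def False by (simp add: add.commute)
    then obtain d \<alpha> \<beta> where *: "d \<in> carrier FA" "d \<noteq> \<zero>\<^bsub>FA\<^esub>" 
      "\<alpha> \<in> carrier FA" "\<beta> \<in> carrier FA" "d = \<alpha> \<otimes>\<^bsub>FA\<^esub> v \<oplus>\<^bsub>FA\<^esub> \<beta> \<otimes>\<^bsub>FA\<^esub> u"
      "\<exists>f\<in>carrier A. f \<noteq> \<zero> \<and> (\<exists>h\<in>carrier FA. cst f \<otimes>\<^bsub>FA\<^esub> u = h \<otimes>\<^bsub>FA\<^esub> d)"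
      "\<exists>f\<in>carrier A. f \<noteq> \<zero> \<and> (\<exists>h\<in>carrier FA. cst f \<otimes>\<^bsub>FA\<^esub> v = h \<otimes>\<^bsub>FA\<^esub> d)" by blast
    have "d = \<beta> \<otimes>\<^bsub>FA\<^esub> u \<oplus>\<^bsub>FA\<^esub> \<alpha> \<otimes>\<^bsub>FA\<^esub> v" using * less.prems by (simp add: R.a_comm)
    then show ?thesis using * by blast
  qed
qed

lemma deg_pow: "f \<in> carrier FA \<Longrightarrow> f \<noteq> \<zero>\<^bsub>FA\<^esub> \<Longrightarrow> deg (f [^]\<^bsub>FA\<^esub> (k::nat)) = k * deg f"
proof (induction k)
  case 0
  then show ?case by (simp add: FA_one_cst deg_cst)
next
  case (Suc k)
  then show ?case using FA_integral(2)[of "f [^]\<^bsub>FA\<^esub> k" f] pow_nonzero[of f k] by simp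
qed

end

context free_alg_centralizer
begin

section \<open>The tensor product of the free algebra with a centralizer\<close>

abbreviation Cr :: "('x list \<Rightarrow> 'k) ring" where "Cr \<equiv> centralizer_ring FA p"

lemma Cr_simps [simp]:
  "carrier Cr = C" "\<zero>\<^bsub>Cr\<^esub> = \<zero>\<^bsub>FA\<^esub>" "\<one>\<^bsub>Cr\<^esub> = \<one>\<^bsub>FA\<^esub>" 
  "f \<otimes>\<^bsub>Cr\<^esub> h = f \<otimes>\<^bsub>FA\<^esub> h" "f \<oplus>\<^bsub>Cr\<^esub> h = f \<oplus>\<^bsub>FA\<^esub> h"
  by (simp_all add: centralizer_ring_def)

lemma Cr_domain: "domain Cr"
proof -
  have ring: "ring Cr"
    unfolding centralizer_ring_def by (rule R.subring_is_ring[OF C_subring])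
  then interpret Cr: ring Cr .
  show ?thesis
  proof (intro domain.intro cring.intro comm_monoid.intro comm_monoid_axioms.intro domain_axioms.intro)
    show "x \<otimes>\<^bsub>Cr\<^esub> y = y \<otimes>\<^bsub>Cr\<^esub> x" if "x \<in> carrier Cr" "y \<in> carrier Cr" for x y
      using that C_commute[of x y] by simp
    show "x = \<zero>\<^bsub>Cr\<^esub> \<or> y = \<zero>\<^bsub>Cr\<^esub>" if "x \<otimes>\<^bsub>Cr\<^esub> y = \<zero>\<^bsub>Cr\<^esub>" "x \<in> carrier Cr" "y \<in> carrier Cr" for x y
      using that FA_integral(1)[of x y] by (auto simp: C_carrier)
    show "\<one>\<^bsub>Cr\<^esub> \<noteq> \<zero>\<^bsub>Cr\<^esub>" using FA_one_neq_zero by simp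
  qed (use ring Cr.monoid_axioms in auto)
qed

text \<open>An element \<open>d\<close> of \<open>B.FA\<close> is a function of two words: in
  \<open>d v w\<close> the word \<open>v\<close> belongs to the free algebra and \<open>w\<close> to
  the coefficient \<open>d v\<close> in \<open>C\<close>. The two kinds of letters commute with each
  other.\<close>

sublocale B: free_alg Cr S
  by (intro free_alg.intro Cr_domain)

lemma Cr_minus:
  assumes "f \<in> C" "h \<in> C"
  shows "f \<ominus>\<^bsub>Cr\<^esub> h = f \<ominus>\<^bsub>FA\<^esub> h"
proof -
  have "\<ominus>\<^bsub>Cr\<^esub> h = \<ominus>\<^bsub>FA\<^esub> h"
    using B.A.minus_equality[of "\<ominus>\<^bsub>FA\<^esub> h" h] assms by (simp add: R.l_neg C_carrier)
  then show ?thesis by (simp add: a_minus_def)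
qed

lemma Cr_finsum:
  assumes "finite I" "F \<in> I \<rightarrow> C"
  shows "finsum Cr F I w = (\<Oplus>i\<in>I. F i w)"
  using assms
proof (induction I rule: finite_induct)
  case empty
  then show ?case by (simp add: FA_zero)
next
  case (insert i I)
  have "F j w \<in> carrier K" if "j \<in> insert i I" for j
    using that insert.prems by (metis C_carrier FA_coeff Pi_mem)
  then have "(\<Oplus>j\<in>insert i I. F j w) = F i w \<oplus> (\<Oplus>j\<in>I. F j w)"
    using insert.hyps by (intro A.finsum_insert) (auto simp: Pi_iff)
  moreover have "finsum Cr F (insert i I) = F i \<oplus>\<^bsub>FA\<^esub> finsum Cr F I"
    using insert by (subst B.A.finsum_insert) (auto simp: Pi_iff)
  ultimately show ?case using insert by (simp add: FA_add Pi_iff)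
qed

lemma B_mult_coeff:
  assumes "h \<in> carrier B.FA" "d \<in> carrier B.FA"
  shows "(h \<otimes>\<^bsub>B.FA\<^esub> d) v w = (\<Oplus>i\<in>{..length v}. (h (take i v) \<otimes>\<^bsub>FA\<^esub> d (drop i v)) w)"
  unfolding B.FA_mult using assms B.FA_coeff
  by (subst Cr_finsum) auto

lemma B_coeff_C [intro, simp]: "h \<in> carrier B.FA \<Longrightarrow> h v \<in> C"
  using B.FA_coeff by simp

lemma B_coeff_FA [intro, simp]: "h \<in> carrier B.FA \<Longrightarrow> h v \<in> carrier FA"
  using B.FA_coeff by auto

text \<open>The first copy of the free algebra, with scalar coefficients. The second copy, of
  \<open>C\<close> only, is \<open>B.cst\<close>.\<close>

definition emb :: "('x list \<Rightarrow> 'k) \<Rightarrow> 'x list \<Rightarrow> 'x list \<Rightarrow> 'k" where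
  "emb r v = cst (r v)"

lemma emb_closed [simp, intro]:
  assumes "r \<in> carrier FA" shows "emb r \<in> carrier B.FA"
proof -
  have "{v. emb r v \<noteq> \<zero>\<^bsub>FA\<^esub>} = {v. r v \<noteq> \<zero>}"
    by (simp add: emb_def cst_zero[symmetric])
  then show ?thesis
    using assms by (auto simp: B.carrier_FA carrier_FA emb_def cst_zero[symmetric] simp del: in_lists_conv_set)
qed

lemma emb_mult:
  assumes "r \<in> carrier FA" "s \<in> carrier FA"
  shows "emb r \<otimes>\<^bsub>B.FA\<^esub> emb s = emb (r \<otimes>\<^bsub>FA\<^esub> s)"
proof (intro ext)
  fix v w :: "'x list"
  have "(emb r \<otimes>\<^bsub>B.FA\<^esub> emb s) v w = (\<Oplus>i\<in>{..length v}. cst (r (take i v) \<otimes> s (drop i v)) w)"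
    using assms by (subst B_mult_coeff) (auto simp: emb_def cst_cst_mult)
  also have "\<dots> = emb (r \<otimes>\<^bsub>FA\<^esub> s) v w"
    by (simp add: cst_def emb_def FA_mult)
  finally show "(emb r \<otimes>\<^bsub>B.FA\<^esub> emb s) v w = emb (r \<otimes>\<^bsub>FA\<^esub> s) v w" .
qed

text \<open>\<open>dif c\<close> is \<open>c - c'\<close>, where the copy \<open>c'\<close> of \<open>c\<close> is a constant coefficient.\<close>

definition dif :: "('x list \<Rightarrow> 'k) \<Rightarrow> 'x list \<Rightarrow> 'x list \<Rightarrow> 'k" where
  "dif c = emb c \<ominus>\<^bsub>B.FA\<^esub> B.cst c"

lemma dif_closed [simp, intro]: "c \<in> C \<Longrightarrow> dif c \<in> carrier B.FA"
  by (simp add: dif_def C_carrier)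

lemma dif_coeff: "c \<in> C \<Longrightarrow> dif c v = (if v = [] then cst (c []) \<ominus>\<^bsub>FA\<^esub> c else cst (c v))"
proof -
  assume c: "c \<in> C"
  have "dif c v = cst (c v) \<ominus>\<^bsub>FA\<^esub> B.cst c v"
    unfolding dif_def using c by (simp add: B.FA_minus C_carrier emb_def B.cst_def Cr_minus)
  then show ?thesis using c by (simp add: B.cst_def R.minus_eq C_carrier)
qed

text \<open>Each copy of \<open>C\<close> is commutative and constants are central. This relation
  provides the common left multiple that \<open>euclid\<close> requires.\<close>

lemma dif_commute:
  assumes "c \<in> C" "e \<in> C"
  shows "dif c \<otimes>\<^bsub>B.FA\<^esub> dif e = dif e \<otimes>\<^bsub>B.FA\<^esub> dif c"
proof -
  have cl: "emb c \<in> carrier B.FA" "emb e \<in> carrier B.FA" "B.cst c \<in> carrier B.FA" "B.cst e \<in> carrier B.FA"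
    using assms by (auto simp: C_carrier)
  have 1: "emb c \<otimes>\<^bsub>B.FA\<^esub> emb e = emb e \<otimes>\<^bsub>B.FA\<^esub> emb c"
    using assms C_commute by (simp add: emb_mult C_carrier)
  have 2: "B.cst c \<otimes>\<^bsub>B.FA\<^esub> emb e = emb e \<otimes>\<^bsub>B.FA\<^esub> B.cst c"
     "B.cst e \<otimes>\<^bsub>B.FA\<^esub> emb c = emb c \<otimes>\<^bsub>B.FA\<^esub> B.cst e"
     "B.cst c \<otimes>\<^bsub>B.FA\<^esub> B.cst e = B.cst e \<otimes>\<^bsub>B.FA\<^esub> B.cst c"
    using assms cl by (auto intro!: B.cst_commute)
  have "dif c \<otimes>\<^bsub>B.FA\<^esub> dif e = (emb c \<otimes>\<^bsub>B.FA\<^esub> emb e \<oplus>\<^bsub>B.FA\<^esub> B.cst c \<otimes>\<^bsub>B.FA\<^esub> B.cst e) 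
      \<ominus>\<^bsub>B.FA\<^esub> (emb c \<otimes>\<^bsub>B.FA\<^esub> B.cst e \<oplus>\<^bsub>B.FA\<^esub> B.cst c \<otimes>\<^bsub>B.FA\<^esub> emb e)"
    unfolding dif_def using cl by algebra
  also have "\<dots> = (emb e \<otimes>\<^bsub>B.FA\<^esub> emb c \<oplus>\<^bsub>B.FA\<^esub> B.cst e \<otimes>\<^bsub>B.FA\<^esub> B.cst c) 
      \<ominus>\<^bsub>B.FA\<^esub> (B.cst e \<otimes>\<^bsub>B.FA\<^esub> emb c \<oplus>\<^bsub>B.FA\<^esub> emb e \<otimes>\<^bsub>B.FA\<^esub> B.cst c)"
    unfolding 1 2 ..
  also have "\<dots> = dif e \<otimes>\<^bsub>B.FA\<^esub> dif c"
    unfolding dif_def using cl by algebra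
  finally show ?thesis .
qed

text \<open>\<open>ev d\<close> is the sum of the products \<open>v d\<^sub>v\<close> in the free algebra, that is, the image of
  \<open>d\<close> under the multiplication map of the tensor product of the free algebra with \<open>C\<close>.\<close>

definition ev :: "('x list \<Rightarrow> 'x list \<Rightarrow> 'k) \<Rightarrow> 'x list \<Rightarrow> 'k" where
  "ev d w = (\<Oplus>i\<in>{..length w}. d (take i w) (drop i w))"

lemma ev_add:
  assumes "d \<in> carrier B.FA" "e \<in> carrier B.FA"
  shows "ev (d \<oplus>\<^bsub>B.FA\<^esub> e) w = ev d w \<oplus> ev e w"
  unfolding ev_def using assms
  by (subst A.finsum_addf[symmetric]) (auto simp: B.FA_add FA_add)

lemma ev_minus:
  assumes "d \<in> carrier B.FA" "e \<in> carrier B.FA" "\<And>w. ev d w = ev e w"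
  shows "ev (d \<ominus>\<^bsub>B.FA\<^esub> e) w = \<zero>"
proof -
  have cl: "d \<ominus>\<^bsub>B.FA\<^esub> e \<in> carrier B.FA" using assms by simp
  have ev_cl: "ev x w \<in> carrier K" if "x \<in> carrier B.FA" for x
    unfolding ev_def using that by (intro A.finsum_closed) auto
  have "(d \<ominus>\<^bsub>B.FA\<^esub> e) \<oplus>\<^bsub>B.FA\<^esub> e = d"
    using assms by (simp add: B.R.minus_eq B.R.a_assoc B.R.l_neg)
  then have "ev (d \<ominus>\<^bsub>B.FA\<^esub> e) w \<oplus> ev e w = ev e w"
    using ev_add[OF cl assms(2), of w] assms(3) by simp
  then show ?thesis using ev_cl[OF cl] ev_cl[OF assms(2)] by (metis A.add.r_cancel_one')
qed

text \<open>With coefficients written on the right of words, \<open>ev\<close> maps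
  \<open>h emb c\<close> to the sum of the \<open>v c h\<^sub>v\<close> and \<open>h c'\<close> to
  the sum of the \<open>v h\<^sub>v c\<close>. These agree because \<open>c\<close> and the
  coefficient \<open>h\<^sub>v\<close> both lie in the commutative ring \<open>C\<close>.\<close>

lemma ev_mult_dif:
  assumes h: "h \<in> carrier B.FA" and c: "c \<in> C"
  shows "ev (h \<otimes>\<^bsub>B.FA\<^esub> dif c) w = \<zero>"
proof -
  define n where "n = length w"
  define G where "G i j = h (take j w) (drop i w) \<otimes> c (take (i - j) (drop j w))" for i j
  have G: "G i j \<in> carrier K" for i j using h c by (auto simp: G_def C_carrier)
  have cF: "c \<in> carrier FA" using c by auto
  have ev1: "ev (h \<otimes>\<^bsub>B.FA\<^esub> emb c) w = ev (h \<otimes>\<^bsub>B.FA\<^esub> B.cst c) w" for w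
  proof -
    define n where "n = length w"
    define G where "G i j = c (take (i - j) (drop j w)) \<otimes> h (take j w) (drop i w)" for i j
    have G: "G i j \<in> carrier K" for i j using h c by (auto simp: G_def C_carrier)
    have "ev (h \<otimes>\<^bsub>B.FA\<^esub> emb c) w = (\<Oplus>i\<in>{..n}. \<Oplus>j\<in>{..i}. G i j)"
      unfolding ev_def n_def
    proof (rule A.finsum_cong')
      fix i assume i: "i \<in> {..length w}"
      have "(h \<otimes>\<^bsub>B.FA\<^esub> emb c) (take i w) (drop i w) =
        (\<Oplus>j\<in>{..i}. (h (take j (take i w)) \<otimes>\<^bsub>FA\<^esub> emb c (drop j (take i w))) (drop i w))"
        using i h cF by (subst B_mult_coeff) (auto simp: min_absorb2)
      also have "\<dots> = (\<Oplus>j\<in>{..i}. G i j)"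
      proof (rule A.finsum_cong')
        fix j assume j: "j \<in> {..i}"
        have "(h (take j (take i w)) \<otimes>\<^bsub>FA\<^esub> emb c (drop j (take i w))) (drop i w)
          = h (take j w) (drop i w) \<otimes> c (take (i - j) (drop j w))"
          using j h cF unfolding emb_def by (subst mult_cst) (auto simp: min_def drop_take)
        then show "(h (take j (take i w)) \<otimes>\<^bsub>FA\<^esub> emb c (drop j (take i w))) (drop i w) = G i j"
          using h cF by (simp add: G_def A.m_comm)
      qed (use G in auto)
      finally show "(h \<otimes>\<^bsub>B.FA\<^esub> emb c) (take i w) (drop i w) = (\<Oplus>j\<in>{..i}. G i j)" .
    qed (use G in \<open>auto intro!: A.finsum_closed\<close>)
    also have "\<dots> = (\<Oplus>j\<in>{..n}. \<Oplus>k\<in>{..n - j}. G (j + k) j)"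
      using G by (rule A.finsum_triangle)
    also have "\<dots> = ev (h \<otimes>\<^bsub>B.FA\<^esub> B.cst c) w"
      unfolding ev_def n_def
    proof (rule A.finsum_cong')
      fix j assume j: "j \<in> {..length w}"
      have "(h \<otimes>\<^bsub>B.FA\<^esub> B.cst c) (take j w) (drop j w) = (h (take j w) \<otimes>\<^bsub>FA\<^esub> c) (drop j w)"
        using B.mult_cst[of c h "take j w"] c h by simp
      also have "h (take j w) \<otimes>\<^bsub>FA\<^esub> c = c \<otimes>\<^bsub>FA\<^esub> h (take j w)"
        using c h by (intro C_commute) auto
      also have "(c \<otimes>\<^bsub>FA\<^esub> h (take j w)) (drop j w) = (\<Oplus>k\<in>{..length w - j}. G (j + k) j)"
        unfolding FA_mult using h cF by (intro A.finsum_cong') (auto simp: G_def add.commute)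
      finally show "(\<Oplus>k\<in>{..length w - j}. G (j + k) j) = (h \<otimes>\<^bsub>B.FA\<^esub> B.cst c) (take j w) (drop j w)" ..
    qed (use h c in auto)
    finally show ?thesis .
  qed
  have "h \<otimes>\<^bsub>B.FA\<^esub> dif c = h \<otimes>\<^bsub>B.FA\<^esub> emb c \<ominus>\<^bsub>B.FA\<^esub> h \<otimes>\<^bsub>B.FA\<^esub> B.cst c"
    unfolding dif_def using h emb_closed[OF cF] B.cst_closed[of c] c by (simp add: B.R.minus_eq B.R.r_distr B.R.r_minus)
  then show ?thesis using ev_minus ev1 h cF c by simp
qed

text \<open>The least positive difference \<open>g\<close> of two degrees divides every degree,
  since otherwise a remainder would be a smaller difference. It need not be a degree itself at this
  stage, hence the pair \<open>a\<close>, \<open>b\<close>.\<close>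

lemma degree_generator:
  "\<exists>g>0. (\<forall>f\<in>C. f \<noteq> \<zero>\<^bsub>FA\<^esub> \<longrightarrow> g dvd deg f) \<and>
    (\<exists>a\<in>C. \<exists>b\<in>C. a \<noteq> \<zero>\<^bsub>FA\<^esub> \<and> b \<noteq> \<zero>\<^bsub>FA\<^esub> \<and> 0 < deg a \<and> deg b = deg a + g)"
proof -
  define P where "P k \<longleftrightarrow> 0 < k \<and> (\<exists>a\<in>C. \<exists>b\<in>C. a \<noteq> \<zero>\<^bsub>FA\<^esub> \<and> b \<noteq> \<zero>\<^bsub>FA\<^esub> \<and> deg b = deg a + k)" for k
  have "P (deg p)"
  proof -
    have "deg p = deg \<one>\<^bsub>FA\<^esub> + deg p" by (simp add: FA_one_cst deg_cst)
    moreover have "\<one>\<^bsub>FA\<^esub> \<in> C" "p \<in> C" by auto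
    ultimately show ?thesis unfolding P_def using deg_p p_nonzero FA_one_neq_zero by blast
  qed
  define g where "g = (LEAST k. P k)"
  have g: "P g" unfolding g_def by (rule LeastI) fact
  have gmin: "g \<le> k" if "P k" for k unfolding g_def using that by (rule Least_le)
  from g obtain a b where ab: "0 < g" "a \<in> C" "b \<in> C" "a \<noteq> \<zero>\<^bsub>FA\<^esub>" "b \<noteq> \<zero>\<^bsub>FA\<^esub>" "deg b = deg a + g"
    by (auto simp: P_def)
  have "g dvd deg f" if f: "f \<in> C" "f \<noteq> \<zero>\<^bsub>FA\<^esub>" for f
  proof (rule ccontr)
    assume "\<not> g dvd deg f"
    then have r: "0 < deg f mod g" by (simp add: dvd_eq_mod_eq_0)
    define q where "q = deg f div g"
    \<comment> \<open>The degrees of \<open>f a^q\<close> and \<open>b^q\<close> differ by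
      \<open>deg f - q g\<close>, the remainder of \<open>deg f\<close> modulo
      \<open>g\<close>.\<close>
    define x where "x = f \<otimes>\<^bsub>FA\<^esub> a [^]\<^bsub>FA\<^esub> q"
    define y where "y = b [^]\<^bsub>FA\<^esub> q"
    have x: "x \<in> C" "x \<noteq> \<zero>\<^bsub>FA\<^esub>" "deg x = deg f + q * deg a"
      unfolding x_def using f ab FA_integral[of f "a [^]\<^bsub>FA\<^esub> q"] pow_nonzero[of a q] deg_pow[of a q]
      by (simp_all add: C_carrier)
    have y: "y \<in> C" "y \<noteq> \<zero>\<^bsub>FA\<^esub>" "deg y = q * deg a + q * g"
      unfolding y_def using ab pow_nonzero[of b q] deg_pow[of b q] by (simp_all add: C_carrier algebra_simps)
    have "deg f = q * g + deg f mod g" by (simp add: q_def)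
    then have "deg x = deg y + deg f mod g" using x(3) y(3) by simp
    then have "P (deg f mod g)" unfolding P_def using r x(1,2) y(1,2) by blast
    then have "g \<le> deg f mod g" by (rule gmin)
    then show False using mod_less_divisor[OF ab(1), of "deg f"] by linarith
  qed
  \<comment> \<open>Multiplying both elements by \<open>p\<close> keeps the difference of their
    degrees and makes these degrees positive.\<close>
  moreover have "a \<otimes>\<^bsub>FA\<^esub> p \<in> C" "b \<otimes>\<^bsub>FA\<^esub> p \<in> C" using ab by auto
  moreover have "a \<otimes>\<^bsub>FA\<^esub> p \<noteq> \<zero>\<^bsub>FA\<^esub>" "b \<otimes>\<^bsub>FA\<^esub> p \<noteq> \<zero>\<^bsub>FA\<^esub>" "deg (a \<otimes>\<^bsub>FA\<^esub> p) = deg a + deg p" "deg (b \<otimes>\<^bsub>FA\<^esub> p) = deg b + deg p"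
    using FA_integral[of a p] FA_integral[of b p] ab p_nonzero by (auto simp: C_carrier)
  ultimately show ?thesis
    using ab deg_p by (intro exI[of _ g] conjI bexI[of _ "a \<otimes>\<^bsub>FA\<^esub> p"] bexI[of _ "b \<otimes>\<^bsub>FA\<^esub> p"]) auto
qed

text \<open>The form \<open>z\<close> is a quotient of two leading forms, obtained from their
  commutation by the weak algorithm. It stands for the leading form of the generator of
  \<open>C\<close>, although no element with this leading form is known yet.\<close>

lemma leading_root:
  "\<exists>g>0. (\<forall>f\<in>C. f \<noteq> \<zero>\<^bsub>FA\<^esub> \<longrightarrow> g dvd deg f) \<and>
    (\<exists>a\<in>C. \<exists>b\<in>C. \<exists>z\<in>centralizer FA (top p). \<exists>\<omega>. a \<noteq> \<zero>\<^bsub>FA\<^esub> \<and> b \<noteq> \<zero>\<^bsub>FA\<^esub> \<and> 0 < deg a \<and> deg b = deg a + g \<and>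
      homog z g \<and> z \<omega> = \<one> \<and> top b = z \<otimes>\<^bsub>FA\<^esub> top a)"
proof -
  obtain g a b where g: "0 < g" "\<And>f. f \<in> C \<Longrightarrow> f \<noteq> \<zero>\<^bsub>FA\<^esub> \<Longrightarrow> g dvd deg f"
    and a: "a \<in> C" "a \<noteq> \<zero>\<^bsub>FA\<^esub>" "0 < deg a" and b: "b \<in> C" "b \<noteq> \<zero>\<^bsub>FA\<^esub>" "deg b = deg a + g"
    using degree_generator by blast
  have cl: "a \<in> carrier FA" "b \<in> carrier FA" "top a \<in> carrier FA" "top b \<in> carrier FA" using a b by auto
  have nz: "top a \<noteq> \<zero>\<^bsub>FA\<^esub>" "top b \<noteq> \<zero>\<^bsub>FA\<^esub>" using top_nonzero[of a] top_nonzero[of b] a b cl by blast+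
  have "top a \<otimes>\<^bsub>FA\<^esub> top b = top b \<otimes>\<^bsub>FA\<^esub> top a" by (rule tops_commute) (use a b in auto)
  then obtain c q where c: "c \<in> carrier K" "c \<noteq> \<zero>" 
    and q: "q \<in> carrier FA" "homog q g" "cst c \<otimes>\<^bsub>FA\<^esub> top b = q \<otimes>\<^bsub>FA\<^esub> top a"
    using weak_algorithm_hom[of "top a" "top b" "top b" "top a" "deg a" "deg b" "deg b" "deg a"] cl nz b(3) by auto
  have "cst c \<otimes>\<^bsub>FA\<^esub> top b \<noteq> \<zero>\<^bsub>FA\<^esub>"
    using FA_integral(1)[of "cst c" "top b"] c cl nz by (metis cst_closed cst_inject cst_zero)
  then have "q \<noteq> \<zero>\<^bsub>FA\<^esub>" using q cl by auto
  then obtain \<omega> where \<omega>: "q \<omega> \<noteq> \<zero>" by (auto simp: FA_zero)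
  obtain d where d: "d \<in> carrier K" "d \<otimes> q \<omega> = \<one>" "d \<noteq> \<zero>" using K_inverse[OF _ \<omega>] q by auto
  define z where "z = cst d \<otimes>\<^bsub>FA\<^esub> q"
  \<comment> \<open>Rescaling \<open>b\<close> by \<open>d c\<close> makes the quotient exactly
    \<open>z\<close>, which is normalized to have coefficient 1 at \<open>\<omega>\<close>.\<close>
  define b' where "b' = cst (d \<otimes> c) \<otimes>\<^bsub>FA\<^esub> b"
  have z: "z \<in> carrier FA" using d q by (simp add: z_def)
  have hz: "homog z g" using homog_mult[OF cst_closed[OF d(1)] q(1) homog_cst q(2)] by (simp add: z_def)
  have z\<omega>: "z \<omega> = \<one>" using d q by (simp add: z_def cst_mult)
  have dc: "d \<otimes> c \<in> carrier K" "d \<otimes> c \<noteq> \<zero>" using d c A.integral by auto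
  have cdc: "cst (d \<otimes> c) \<noteq> \<zero>\<^bsub>FA\<^esub>" using dc by (metis cst_inject cst_zero)
  have b': "b' \<in> C" using dc b by (simp add: b'_def)
  have b'0: "b' \<noteq> \<zero>\<^bsub>FA\<^esub>" "deg b' = deg b"
    unfolding b'_def using FA_integral[of "cst (d \<otimes> c)" b] cdc cl b dc by (simp_all add: deg_cst)
  have "top b' = top (cst (d \<otimes> c)) \<otimes>\<^bsub>FA\<^esub> top b"
    unfolding b'_def using cdc cl b dc by (intro top_mult) auto
  also have "top (cst (d \<otimes> c)) = cst d \<otimes>\<^bsub>FA\<^esub> cst c"
    using d c by (simp add: deg_cst component_hom homog_cst cst_cst_mult)
  also have "(cst d \<otimes>\<^bsub>FA\<^esub> cst c) \<otimes>\<^bsub>FA\<^esub> top b = z \<otimes>\<^bsub>FA\<^esub> top a"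
    using d c cl q by (simp add: R.m_assoc z_def)
  finally have tb: "top b' = z \<otimes>\<^bsub>FA\<^esub> top a" .
  \<comment> \<open>Both \<open>top a\<close> and \<open>top b' = z top a\<close> commute with
    \<open>top p\<close>; cancelling \<open>top a\<close> leaves the same for
    \<open>z\<close>.\<close>
  have "z \<otimes>\<^bsub>FA\<^esub> top p = top p \<otimes>\<^bsub>FA\<^esub> z"
  proof (rule FA_r_cancel)
    have ca: "top a \<otimes>\<^bsub>FA\<^esub> top p = top p \<otimes>\<^bsub>FA\<^esub> top a" using top_C[OF a(1,2)] by (simp add: centralizer_def)
    have cb: "top b' \<otimes>\<^bsub>FA\<^esub> top p = top p \<otimes>\<^bsub>FA\<^esub> top b'" using top_C[OF b' b'0(1)] by (simp add: centralizer_def)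
    have "(z \<otimes>\<^bsub>FA\<^esub> top p) \<otimes>\<^bsub>FA\<^esub> top a = (z \<otimes>\<^bsub>FA\<^esub> top a) \<otimes>\<^bsub>FA\<^esub> top p"
      using z cl top_p ca by (simp add: R.m_assoc)
    also have "\<dots> = (top p \<otimes>\<^bsub>FA\<^esub> z) \<otimes>\<^bsub>FA\<^esub> top a"
      using cb z cl top_p unfolding tb by (simp add: R.m_assoc)
    finally show "(z \<otimes>\<^bsub>FA\<^esub> top p) \<otimes>\<^bsub>FA\<^esub> top a = (top p \<otimes>\<^bsub>FA\<^esub> z) \<otimes>\<^bsub>FA\<^esub> top a" .
  qed (use z cl nz top_p in auto)
  then have zc: "z \<in> centralizer FA (top p)" using z by (simp add: centralizer_def)
  have db: "deg b' = deg a + g" using b'0 b(3) by simp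
  have "\<forall>f\<in>C. f \<noteq> \<zero>\<^bsub>FA\<^esub> \<longrightarrow> g dvd deg f" using g(2) by blast
  then show ?thesis using g(1) a(1,2,3) b' b'0(1) db zc hz z\<omega> tb by blast
qed

end

subsection \<open>Leading forms\<close>

locale free_alg_root = free_alg_centralizer K S p
  for K :: "('k, 'm) ring_scheme" (structure) and S :: "'x set" and p +
  fixes g :: nat and a b z :: "'x list \<Rightarrow> 'k" and \<omega> :: "'x list"
  assumes g_pos: "0 < g" and g_dvd: "\<And>f. f \<in> C \<Longrightarrow> f \<noteq> \<zero>\<^bsub>FA\<^esub> \<Longrightarrow> g dvd deg f"
    and a_C [simp]: "a \<in> C" and b_C [simp]: "b \<in> C" and a_nonzero: "a \<noteq> \<zero>\<^bsub>FA\<^esub>" and b_nonzero: "b \<noteq> \<zero>\<^bsub>FA\<^esub>"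
    and deg_a: "0 < deg a" and deg_b: "deg b = deg a + g"
    and z_centralizer: "z \<in> centralizer FA (top p)" and homog_z: "homog z g" and z_\<omega>: "z \<omega> = \<one>"
    and top_b: "top b = z \<otimes>\<^bsub>FA\<^esub> top a"
begin

lemma z_closed [simp, intro]: "z \<in> carrier FA"
  using z_centralizer by (simp add: centralizer_def)

lemma length_\<omega>: "length \<omega> = g"
  using homog_z z_\<omega> by (simp add: homog_def)

lemma z_nonzero: "z \<noteq> \<zero>\<^bsub>FA\<^esub>"
  using z_\<omega> by (auto simp: FA_zero)

text \<open>The power \<open>\<omega>^k\<close>, a word at which \<open>z^k\<close> has coefficient
  1. Leading coefficients of elements of \<open>C\<close> are read off there.\<close>

definition om :: "nat \<Rightarrow> 'x list" where
  "om k = concat (replicate k \<omega>)"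

lemma length_om: "length (om k) = k * g"
  by (simp add: om_def length_concat sum_list_replicate length_\<omega>)

lemma om_add: "om (j + k) = om j @ om k"
  by (simp add: om_def replicate_add)

lemma om_0 [simp]: "om 0 = []" and om_1: "om (Suc 0) = \<omega>"
  by (simp_all add: om_def)

lemma om_mult:
  assumes "f \<in> carrier FA" "h \<in> carrier FA" "dle f (j * g)" "dle h (k * g)"
  shows "(f \<otimes>\<^bsub>FA\<^esub> h) (om (j + k)) = f (om j) \<otimes> h (om k)"
  unfolding om_add using assms by (intro mult_top) (auto simp: length_om)

lemma z_pow_om: "(z [^]\<^bsub>FA\<^esub> k) (om k) = \<one>"
proof (induction k)
  case 0
  then show ?case by (simp add: FA_one)
next
  case (Suc k)
  have "dle z (1 * g)" using homog_dle[OF homog_z] by simp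
  then have "(z [^]\<^bsub>FA\<^esub> k \<otimes>\<^bsub>FA\<^esub> z) (om (k + 1)) = (z [^]\<^bsub>FA\<^esub> k) (om k) \<otimes> z (om 1)"
    using homog_dle[OF homog_pow[OF z_closed homog_z]] by (intro om_mult) auto
  then show ?case using Suc z_\<omega> by (simp add: om_1)
qed

text \<open>In degree \<open>k g\<close> every leading form is a multiple of \<open>z^k\<close>; the
  factor is the coefficient at \<open>om k\<close>, as that of \<open>z^k\<close> is 1.\<close>

lemma top_C_om:
  assumes f: "f \<in> C" "f \<noteq> \<zero>\<^bsub>FA\<^esub>" "deg f = k * g"
  shows "top f = cst (f (om k)) \<otimes>\<^bsub>FA\<^esub> z [^]\<^bsub>FA\<^esub> k" "f (om k) \<noteq> \<zero>"
proof -
  have fF: "f \<in> carrier FA" using f by auto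
  have "z [^]\<^bsub>FA\<^esub> k \<in> centralizer FA (top p)"
    by (rule R.centralizer_pow[OF top_p(1) z_centralizer])
  moreover have "z [^]\<^bsub>FA\<^esub> k \<noteq> \<zero>\<^bsub>FA\<^esub>" by (rule pow_nonzero[OF z_closed z_nonzero])
  moreover have "homog (z [^]\<^bsub>FA\<^esub> k) (deg f)" using homog_pow[OF z_closed homog_z] f(3) by simp
  ultimately obtain c where c: "c \<in> carrier K" "top f = cst c \<otimes>\<^bsub>FA\<^esub> z [^]\<^bsub>FA\<^esub> k"
    using proportional[OF _ top_C[OF f(1,2)]] homog_comp by blast
  have "f (om k) = top f (om k)" using f(3) by (simp add: component_def length_om)
  also have "\<dots> = c" unfolding c(2) using c(1) by (simp add: cst_mult z_pow_om)
  finally have fc: "f (om k) = c" .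
  then show "top f = cst (f (om k)) \<otimes>\<^bsub>FA\<^esub> z [^]\<^bsub>FA\<^esub> k" using c by simp
  show "f (om k) \<noteq> \<zero>"
    using top_nonzero[OF fF f(2)] c fc by (auto simp: cst_zero)
qed

text \<open>The grading of \<open>C\<close> is that of \<open>K[z]\<close>, so the leading form of \<open>d\<close>, with the degree in \<open>C\<close>
  added to the length of the words, is determined by its coefficients in \<open>K\<close>.\<close>

definition wle :: "('x list \<Rightarrow> 'x list \<Rightarrow> 'k) \<Rightarrow> nat \<Rightarrow> bool" where
  "wle d t \<longleftrightarrow> (\<forall>v w. d v w \<noteq> \<zero> \<longrightarrow> length v + length w \<le> t)"

definition bar :: "nat \<Rightarrow> ('x list \<Rightarrow> 'x list \<Rightarrow> 'k) \<Rightarrow> 'x list \<Rightarrow> 'k" where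
  "bar t d v = (if length v \<le> t \<and> g dvd t - length v then d v (om ((t - length v) div g)) else \<zero>)"

lemma bar_closed [simp, intro]:
  assumes "d \<in> carrier B.FA"
  shows "bar t d \<in> carrier FA"
proof -
  have nz: "d v \<noteq> \<zero>\<^bsub>FA\<^esub>" if "bar t d v \<noteq> \<zero>" for v
    using that by (auto simp: bar_def FA_zero split: if_splits)
  then have "{v. bar t d v \<noteq> \<zero>} \<subseteq> {v. d v \<noteq> \<zero>\<^bsub>Cr\<^esub>}" by auto
  moreover have "finite {v. d v \<noteq> \<zero>\<^bsub>Cr\<^esub>}" using assms unfolding B.carrier_FA by blast
  ultimately have "finite {v. bar t d v \<noteq> \<zero>}" by (rule finite_subset)
  moreover have "v \<in> lists S" if "bar t d v \<noteq> \<zero>" for v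
    using nz[OF that] B.FA_supp[OF assms] by simp
  moreover have "bar t d v \<in> carrier K" for v using assms by (simp add: bar_def)
  ultimately show ?thesis unfolding carrier_FA by blast
qed

lemma wle_dle: 
  assumes "wle d t" "d v \<noteq> \<zero>\<^bsub>FA\<^esub>"
  shows "length v \<le> t" "dle (d v) (t - length v)"
proof -
  obtain w where "d v w \<noteq> \<zero>" using assms(2) by (auto simp: FA_zero)
  then show "length v \<le> t" using assms(1) by (force simp: wle_def)
  show "dle (d v) (t - length v)" using assms(1) by (force simp: wle_def dle_def)
qed

lemma wle_mult:
  assumes "h \<in> carrier B.FA" "d \<in> carrier B.FA" "wle h s" "wle d t"
  shows "wle (h \<otimes>\<^bsub>B.FA\<^esub> d) (s + t)"
  unfolding wle_def
proof (intro allI impI)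
  fix v w assume nz: "(h \<otimes>\<^bsub>B.FA\<^esub> d) v w \<noteq> \<zero>"
  have "\<exists>i. (h (take i v) \<otimes>\<^bsub>FA\<^esub> d (drop i v)) w \<noteq> \<zero> \<and> i \<le> length v"
  proof (rule ccontr)
    assume "\<not> ?thesis"
    then have "(h \<otimes>\<^bsub>B.FA\<^esub> d) v w = \<zero>"
      unfolding B_mult_coeff[OF assms(1,2)] by (intro A.finsum_all_zero) auto
    with nz show False by simp
  qed
  then obtain i where i: "(h (take i v) \<otimes>\<^bsub>FA\<^esub> d (drop i v)) w \<noteq> \<zero>" "i \<le> length v" by blast
  then obtain x y where xy: "w = x @ y" "h (take i v) x \<noteq> \<zero>" "d (drop i v) y \<noteq> \<zero>"
    using FA_mult_nonzero[OF _ _ i(1)] assms by auto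
  then have "length (take i v) + length x \<le> s" "length (drop i v) + length y \<le> t"
    using assms(3,4) unfolding wle_def by blast+
  then show "length v + length w \<le> s + t" using xy(1) i(2) by simp
qed

text \<open>Leading coefficients of elements of \<open>C\<close> multiply, as
  \<open>om (j + k)\<close> is the concatenation of \<open>om j\<close> and \<open>om k\<close>. If
  \<open>s - length u\<close> is not a multiple of \<open>g\<close>, then \<open>h u\<close> has no
  term of that length, its degree being a multiple of \<open>g\<close>, and the product has no term
  in the top degree either.\<close>

lemma bar_mult_coeff:
  assumes h: "h \<in> carrier B.FA" "wle h s" and d: "d \<in> carrier B.FA" "wle d t"
  shows "bar s h u \<otimes> bar t d v = (if length u + length v \<le> s + t \<and> g dvd s + t - (length u + length v)
     then (h u \<otimes>\<^bsub>FA\<^esub> d v) (om ((s + t - (length u + length v)) div g)) else \<zero>)"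
proof (cases "h u = \<zero>\<^bsub>FA\<^esub> \<or> d v = \<zero>\<^bsub>FA\<^esub>")
  case True
  then have "bar s h u = \<zero> \<or> bar t d v = \<zero>" by (auto simp: bar_def FA_zero)
  then have 1: "bar s h u \<otimes> bar t d v = \<zero>" using h d by auto
  have "h u \<otimes>\<^bsub>FA\<^esub> d v = \<zero>\<^bsub>FA\<^esub>" using True h d by auto
  then show ?thesis using 1 by (simp add: FA_zero)
next
  case False
  then have u: "length u \<le> s" "dle (h u) (s - length u)" and v: "length v \<le> t" "dle (d v) (t - length v)"
    using wle_dle h d by auto
  have hd: "h u \<in> C" "d v \<in> C" "h u \<in> carrier FA" "d v \<in> carrier FA" using h d by auto
  have sum: "s + t - (length u + length v) = (s - length u) + (t - length v)" using u v by simp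
  show ?thesis
  proof (cases "g dvd s - length u")
    case True
    then obtain j where j: "s - length u = j * g" by (metis dvdE mult.commute)
    show ?thesis
    proof (cases "g dvd t - length v")
      case 2: True
      then obtain k where k: "t - length v = k * g" by (metis dvdE mult.commute)
      have "(h u \<otimes>\<^bsub>FA\<^esub> d v) (om (j + k)) = h u (om j) \<otimes> d v (om k)"
        using hd u v j k by (intro om_mult) auto
      moreover have "(j * g + k * g) div g = j + k" using g_pos by (simp flip: add_mult_distrib)
      ultimately show ?thesis
        unfolding sum j k bar_def using u v g_pos by (simp add: j k)
    next
      case 2: False
      then have "\<not> g dvd (s - length u) + (t - length v)" using True dvd_add_right_iff by blast
      then show ?thesis unfolding sum using 2 h d by (simp add: bar_def)
    qed
  next
    case nd: False
    have "(h u \<otimes>\<^bsub>FA\<^esub> d v) (om k) = \<zero>" if k: "(s - length u) + (t - length v) = k * g" for k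
    proof (rule ccontr)
      assume "(h u \<otimes>\<^bsub>FA\<^esub> d v) (om k) \<noteq> \<zero>"
      then obtain x y where xy: "om k = x @ y" "h u x \<noteq> \<zero>" "d v y \<noteq> \<zero>"
        using FA_mult_nonzero[OF hd(3,4)] by blast
      then have "length x \<le> s - length u" "length y \<le> t - length v" using u v by (auto simp: dle_def)
      moreover have "length x + length y = k * g" using xy(1) length_om[of k] by simp
      ultimately have "length x = s - length u" using k by simp
      then have "deg (h u) = s - length u" using deg_eqI[OF hd(3) u(2) xy(2)] by simp
      moreover have "g dvd deg (h u)" using g_dvd hd False by blast
      ultimately show False using nd by simp
    qed
    moreover have "((s - length u) + (t - length v)) = ((s - length u) + (t - length v)) div g * g" 
      if "g dvd (s - length u) + (t - length v)" using that by simp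
    ultimately have "(h u \<otimes>\<^bsub>FA\<^esub> d v) (om (((s - length u) + (t - length v)) div g)) = \<zero>" 
      if "g dvd (s - length u) + (t - length v)" using that by blast
    then show ?thesis unfolding sum using nd d by (simp add: bar_def)
  qed
qed

lemma bar_mult:
  assumes h: "h \<in> carrier B.FA" "wle h s" and d: "d \<in> carrier B.FA" "wle d t"
  shows "bar (s + t) (h \<otimes>\<^bsub>B.FA\<^esub> d) = bar s h \<otimes>\<^bsub>FA\<^esub> bar t d"
proof
  fix w :: "'x list"
  have len: "length (take i w) + length (drop i w) = length w" if "i \<le> length w" for i
    using that by simp
  show "bar (s + t) (h \<otimes>\<^bsub>B.FA\<^esub> d) w = (bar s h \<otimes>\<^bsub>FA\<^esub> bar t d) w"
  proof (cases "length w \<le> s + t \<and> g dvd s + t - length w")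
    case True
    have "bar (s + t) (h \<otimes>\<^bsub>B.FA\<^esub> d) w = 
      (\<Oplus>i\<in>{..length w}. (h (take i w) \<otimes>\<^bsub>FA\<^esub> d (drop i w)) (om ((s + t - length w) div g)))"
      using True h d by (simp add: bar_def B_mult_coeff)
    also have "\<dots> = (\<Oplus>i\<in>{..length w}. bar s h (take i w) \<otimes> bar t d (drop i w))"
    proof (rule A.finsum_cong')
      fix i assume "i \<in> {..length w}"
      then show "(h (take i w) \<otimes>\<^bsub>FA\<^esub> d (drop i w)) (om ((s + t - length w) div g)) = bar s h (take i w) \<otimes> bar t d (drop i w)"
        using bar_mult_coeff[OF h d, of "take i w" "drop i w"] True len[of i] by simp
    qed (use h d in auto)
    finally show ?thesis by (simp add: FA_mult)
  next
    case False
    have "bar s h (take i w) \<otimes> bar t d (drop i w) = \<zero>" if "i \<in> {..length w}" for i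
      using bar_mult_coeff[OF h d, of "take i w" "drop i w"] False len[of i] that by auto
    then have "(bar s h \<otimes>\<^bsub>FA\<^esub> bar t d) w = \<zero>"
      unfolding FA_mult by (intro A.finsum_all_zero)
    then show ?thesis using False by (auto simp: bar_def)
  qed
qed

text \<open>The weight is the maximum of \<open>length v + deg (x v)\<close>. A coefficient
  attaining it has its leading coefficient recorded by \<open>bar\<close>, which is therefore
  nonzero.\<close>

lemma weight_exists:
  assumes x: "x \<in> carrier B.FA" "x \<noteq> \<zero>\<^bsub>B.FA\<^esub>"
  shows "\<exists>t. wle x t \<and> bar t x \<noteq> \<zero>\<^bsub>FA\<^esub>"
proof -
  define W where "W = (\<lambda>v. length v + deg (x v)) ` {v. x v \<noteq> \<zero>\<^bsub>FA\<^esub>}"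
  have "finite {v. x v \<noteq> \<zero>\<^bsub>Cr\<^esub>}" using x unfolding B.carrier_FA by blast
  then have fin: "finite W" by (simp add: W_def)
  have ne: "W \<noteq> {}" using x(2) by (auto simp: W_def B.FA_zero)
  define t where "t = Max W"
  have "wle x t"
    unfolding wle_def
  proof (intro allI impI)
    fix v w assume w: "x v w \<noteq> \<zero>"
    then have "x v \<noteq> \<zero>\<^bsub>FA\<^esub>" by (auto simp: FA_zero)
    then have "length v + deg (x v) \<le> t" unfolding t_def using fin by (intro Max_ge) (auto simp: W_def)
    moreover have "length w \<le> deg (x v)" using dle_deg[of "x v"] w x by (auto simp: dle_def)
    ultimately show "length v + length w \<le> t" by simp
  qed
  moreover obtain v where v: "x v \<noteq> \<zero>\<^bsub>FA\<^esub>" "t = length v + deg (x v)"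
    using Max_in[OF fin ne] by (auto simp: W_def t_def)
  have xv: "x v \<in> C" using x by simp
  obtain k where k: "deg (x v) = k * g" using g_dvd[OF xv v(1)] by (metis dvdE mult.commute)
  then have "bar t x v = x v (om k)" using v(2) g_pos by (simp add: bar_def)
  then have "bar t x v \<noteq> \<zero>" using top_C_om(2)[OF xv v(1) k] by simp
  then have "bar t x \<noteq> \<zero>\<^bsub>FA\<^esub>" by (auto simp: FA_zero)
  ultimately show ?thesis by blast
qed

text \<open>If \<open>bar s x\<close> is nonzero, some pair of words of total length
  \<open>s\<close> occurs in \<open>x\<close>, so no bound on the weight lies below
  \<open>s\<close>.\<close>

lemma weight_unique:
  assumes "wle x s" "wle x t" "bar s x \<noteq> \<zero>\<^bsub>FA\<^esub>" "bar t x \<noteq> \<zero>\<^bsub>FA\<^esub>"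
  shows "s = t"
proof -
  have le: "s \<le> t" if "wle x t" "bar s x \<noteq> \<zero>\<^bsub>FA\<^esub>" for s t
  proof -
    obtain v where v: "bar s x v \<noteq> \<zero>" using \<open>bar s x \<noteq> \<zero>\<^bsub>FA\<^esub>\<close> by (auto simp: FA_zero)
    then have "length v \<le> s" "g dvd s - length v" "x v (om ((s - length v) div g)) \<noteq> \<zero>"
      by (auto simp: bar_def split: if_splits)
    then show ?thesis using \<open>wle x t\<close> by (force simp: wle_def length_om)
  qed
  show ?thesis using le[OF assms(2,3)] le[OF assms(1,4)] by simp
qed

lemma bar_cst:
  assumes "f \<in> C" "f \<noteq> \<zero>\<^bsub>FA\<^esub>" 
  shows "wle (B.cst f) (deg f)" "\<exists>c\<in>carrier K. c \<noteq> \<zero> \<and> bar (deg f) (B.cst f) = cst c"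
proof -
  show "wle (B.cst f) (deg f)"
    using dle_deg[of f] assms by (auto simp: wle_def B.cst_def FA_zero dle_def split: if_splits)
  obtain k where k: "deg f = k * g" using g_dvd[OF assms] by (metis dvdE mult.commute)
  have "bar (deg f) (B.cst f) = cst (f (om k))"
    using k g_pos by (auto simp: bar_def B.cst_def cst_def FA_zero)
  moreover have "f (om k) \<in> carrier K" using assms by auto
  ultimately show "\<exists>c\<in>carrier K. c \<noteq> \<zero> \<and> bar (deg f) (B.cst f) = cst c"
    using top_C_om(2)[OF assms k] by blast
qed

text \<open>In weight \<open>deg c\<close> the first copy contributes its leading form, in words.
  The second contributes at the empty word, where only its leading coefficient is recorded.\<close>

lemma bar_dif:
  assumes c: "c \<in> C" "c \<noteq> \<zero>\<^bsub>FA\<^esub>" "deg c = k * g" "0 < deg c"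
  shows "wle (dif c) (deg c)" "bar (deg c) (dif c) = top c \<ominus>\<^bsub>FA\<^esub> cst (c (om k))"
    "bar (deg c) (dif c) \<noteq> \<zero>\<^bsub>FA\<^esub>"
proof -
  have cF: "c \<in> carrier FA" using c by auto
  show "wle (dif c) (deg c)"
    unfolding wle_def
  proof (intro allI impI)
    fix v w assume nz: "dif c v w \<noteq> \<zero>"
    show "length v + length w \<le> deg c"
    proof (cases "v = []")
      case True
      then have "dif c v = cst (c []) \<ominus>\<^bsub>FA\<^esub> c" using dif_coeff[OF c(1)] by simp
      moreover have "dle (cst (c []) \<ominus>\<^bsub>FA\<^esub> c) (deg c)"
        using cF by (intro dle_minus dle_deg dle_mono[OF dle_cst]) auto
      ultimately show ?thesis using nz True by (auto simp: dle_def)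
    next
      case False
      then have "cst (c v) w \<noteq> \<zero>" using nz dif_coeff[OF c(1)] by simp
      then have "w = []" "c v \<noteq> \<zero>" by (auto simp: cst_def split: if_splits)
      then show ?thesis using dle_deg[OF cF] by (auto simp: dle_def)
    qed
  qed
  have k: "0 < k" using c(3,4) by (simp add: zero_less_mult_iff)
  have om: "om j = [] \<longleftrightarrow> j = 0" for j
    using length_om[of j] g_pos by (metis length_0_conv mult_is_0 neq0_conv)
  show eq: "bar (deg c) (dif c) = top c \<ominus>\<^bsub>FA\<^esub> cst (c (om k))"
  proof
    fix v
    have R: "(top c \<ominus>\<^bsub>FA\<^esub> cst (c (om k))) v = top c v \<ominus> cst (c (om k)) v"
      using cF by (simp add: FA_minus)
    show "bar (deg c) (dif c) v = (top c \<ominus>\<^bsub>FA\<^esub> cst (c (om k))) v"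
    proof (cases "v = []")
      case True
      have "bar (deg c) (dif c) v = (cst (c []) \<ominus>\<^bsub>FA\<^esub> c) (om k)"
        using True c g_pos by (simp add: bar_def dif_coeff)
      also have "\<dots> = \<zero> \<ominus> c (om k)" using cF k om by (simp add: FA_minus cst_def)
      finally show ?thesis unfolding R using True c(4) by (simp add: component_def cst_def)
    next
      case False
      have "bar (deg c) (dif c) v = top c v"
      proof (cases "length v = deg c")
        case True
        then show ?thesis using False c by (simp add: bar_def dif_coeff component_def cst_def)
      next
        case len: False
        have "cst (c v) (om ((deg c - length v) div g)) = \<zero>" if "length v \<le> deg c" "g dvd deg c - length v"
        proof -
          have "0 < (deg c - length v) div g" using that len g_pos by (simp add: div_greater_zero_iff dvd_imp_le)
          then show ?thesis using om by (simp add: cst_def)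
        qed
        then show ?thesis using False c len by (simp add: bar_def dif_coeff component_def)
      qed
      then show ?thesis unfolding R using False cF by (simp add: cst_def A.minus_eq)
    qed
  qed
  obtain w where w: "length w = deg c" "c w \<noteq> \<zero>" using deg_witness[OF cF c(2)] by blast
  then have "bar (deg c) (dif c) w = c w"
    unfolding eq using cF c(4) by (auto simp: FA_minus component_def cst_def A.minus_eq)
  then show "bar (deg c) (dif c) \<noteq> \<zero>\<^bsub>FA\<^esub>" using w by (auto simp: FA_zero)
qed

lemma ev_cst: "c \<in> C \<Longrightarrow> ev (B.cst c) w = c w"
proof -
  assume c: "c \<in> C"
  have cF: "c \<in> carrier FA" using c by auto
  have "ev (B.cst c) w = B.cst c (take 0 w) (drop 0 w)"
    unfolding ev_def 
  proof (rule A.finsum_single)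
    fix j assume "j \<in> {..length w}" "j \<noteq> 0"
    then have "take j w \<noteq> []" by auto
    then show "B.cst c (take j w) (drop j w) = \<zero>" by (simp add: B.cst_def FA_zero)
  qed (use B.cst_closed[of c] c in auto)
  then show ?thesis by (simp add: B.cst_def)
qed

lemma dif_nonzero:
  assumes "c \<in> C" "c \<noteq> \<zero>\<^bsub>FA\<^esub>" "0 < deg c" 
  shows "dif c \<noteq> \<zero>\<^bsub>B.FA\<^esub>" "B.deg (dif c) = deg c" 
    "\<And>v. length v = deg c \<Longrightarrow> dif c v = cst (c v)"
proof -
  have cF: "c \<in> carrier FA" using assms by auto
  show *: "dif c v = cst (c v)" if "length v = deg c" for v 
    using that assms by (auto simp: dif_coeff)
  obtain w where w: "length w = deg c" "c w \<noteq> \<zero>" using deg_witness[OF cF assms(2)] by blast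
  then have nz: "dif c w \<noteq> \<zero>\<^bsub>FA\<^esub>" using * by (metis cst_inject cst_zero)
  then show "dif c \<noteq> \<zero>\<^bsub>B.FA\<^esub>" by (auto simp: B.FA_zero)
  have "B.dle (dif c) (deg c)"
  proof (rule B.dleI)
    fix v :: "'x list" assume v: "deg c < length v"
    then have "c v = \<zero>" using dle_zero[OF dle_deg[OF cF]] by simp
    moreover have "v \<noteq> []" using v by auto
    ultimately show "dif c v = \<zero>\<^bsub>Cr\<^esub>" using assms by (simp add: dif_coeff cst_zero)
  qed
  then show "B.deg (dif c) = deg c" using nz w assms by (intro B.deg_eqI[of _ _ w]) auto
qed

text \<open>\<open>d\<close> is a right gcd of the two elements \<open>dif a\<close> and \<open>dif b\<close>. Its leading form divides \<open>z - 1\<close>,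
  which forces the degrees of its coefficients.\<close>

lemma gcd_shape:
  "\<exists>d\<in>carrier B.FA. \<exists>h\<in>carrier B.FA. \<exists>f\<in>C. \<exists>\<alpha> \<beta>. \<exists>c\<in>carrier K.
    (\<forall>w. ev d w = \<zero>) \<and> B.dle d g \<and> f \<noteq> \<zero>\<^bsub>FA\<^esub> \<and> B.cst f \<otimes>\<^bsub>B.FA\<^esub> dif a = h \<otimes>\<^bsub>B.FA\<^esub> d \<and>
    length \<beta> = g \<and> d \<beta> \<noteq> \<zero>\<^bsub>FA\<^esub> \<and> h \<alpha> \<noteq> \<zero>\<^bsub>FA\<^esub> \<and> c \<noteq> \<zero> \<and> h \<alpha> \<otimes>\<^bsub>FA\<^esub> d \<beta> = cst c \<otimes>\<^bsub>FA\<^esub> f \<and>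
    (\<forall>v. v \<noteq> [] \<longrightarrow> d v \<noteq> \<zero>\<^bsub>FA\<^esub> \<longrightarrow> deg (d v) \<le> deg (d \<beta>))"
proof -
  have aF: "a \<in> carrier FA" "b \<in> carrier FA" by (auto intro: C_carrier)
  have deg_b': "0 < deg b" using deg_a deg_b by simp
  note difa = dif_nonzero[OF a_C a_nonzero deg_a] and difb = dif_nonzero[OF b_C b_nonzero deg_b']
  have U: "dif a \<in> carrier B.FA" "dif b \<in> carrier B.FA" by auto
  \<comment> \<open>The common left multiple is \<open>dif b dif a = dif a dif b\<close>.\<close>
  obtain d \<alpha>0 \<beta>0 f h f' h' where d: "d \<in> carrier B.FA" "d \<noteq> \<zero>\<^bsub>B.FA\<^esub>"
    and ab: "\<alpha>0 \<in> carrier B.FA" "\<beta>0 \<in> carrier B.FA" "d = \<alpha>0 \<otimes>\<^bsub>B.FA\<^esub> dif a \<oplus>\<^bsub>B.FA\<^esub> \<beta>0 \<otimes>\<^bsub>B.FA\<^esub> dif b"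
    and f: "f \<in> carrier Cr" "f \<noteq> \<zero>\<^bsub>Cr\<^esub>" "h \<in> carrier B.FA" "B.cst f \<otimes>\<^bsub>B.FA\<^esub> dif a = h \<otimes>\<^bsub>B.FA\<^esub> d"
    and f': "f' \<in> carrier Cr" "f' \<noteq> \<zero>\<^bsub>Cr\<^esub>" "h' \<in> carrier B.FA" "B.cst f' \<otimes>\<^bsub>B.FA\<^esub> dif b = h' \<otimes>\<^bsub>B.FA\<^esub> d"
    using B.euclid[OF U difa(1) difb(1) U(2,1) difb(1) dif_commute[OF b_C a_C]] by blast
  note f12 = f(1,2)[unfolded Cr_simps] and f12' = f'(1,2)[unfolded Cr_simps]
  have ev0: "ev d w = \<zero>" for w
    unfolding ab(3) using ab U by (simp add: ev_add ev_mult_dif)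
  obtain t where t: "wle d t" "bar t d \<noteq> \<zero>\<^bsub>FA\<^esub>" using weight_exists d by blast
  define D where "D = bar t d"
  have D: "D \<in> carrier FA" "D \<noteq> \<zero>\<^bsub>FA\<^esub>" using d t by (auto simp: D_def)
  \<comment> \<open>In \<open>f dif e = h d\<close> the constant \<open>f\<close> contributes only a
    nonzero scalar to the leading forms, so \<open>D\<close> is a right divisor of the leading form
    of \<open>dif e\<close>. The equation between weights serves the count of degrees below.\<close>
  have divides: "\<exists>q\<in>carrier FA. bar (deg e) (dif e) = q \<otimes>\<^bsub>FA\<^esub> D \<and> (\<exists>s. wle h s \<and> deg f + deg e = s + t)"
    if e: "e \<in> C" "e \<noteq> \<zero>\<^bsub>FA\<^esub>" "0 < deg e" and f: "f \<in> C" "f \<noteq> \<zero>\<^bsub>FA\<^esub>" and h: "h \<in> carrier B.FA"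
      and eq: "B.cst f \<otimes>\<^bsub>B.FA\<^esub> dif e = h \<otimes>\<^bsub>B.FA\<^esub> d" for e f h
  proof -
    obtain k where k: "deg e = k * g" using g_dvd[OF e(1,2)] by (metis dvdE mult.commute)
    note be = bar_dif[OF e(1,2) k e(3)]
    obtain c where c: "c \<in> carrier K" "c \<noteq> \<zero>" "bar (deg f) (B.cst f) = cst c" using bar_cst[OF f] by blast
    have fB: "B.cst f \<in> carrier B.FA" using f by auto
    have eB: "dif e \<in> carrier B.FA" using e by auto
    have "B.cst f \<noteq> \<zero>\<^bsub>B.FA\<^esub>" using f(2) by (metis B.cst_inject B.cst_zero Cr_simps(2))
    then have "h \<otimes>\<^bsub>B.FA\<^esub> d \<noteq> \<zero>\<^bsub>B.FA\<^esub>"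
      using B.FA_integral(1)[OF fB eB _ dif_nonzero(1)[OF e]] eq by simp
    then have "h \<noteq> \<zero>\<^bsub>B.FA\<^esub>" using d by auto
    then obtain s where s: "wle h s" "bar s h \<noteq> \<zero>\<^bsub>FA\<^esub>" using weight_exists h by blast
    have ebar: "bar (deg e) (dif e) \<in> carrier FA" using eB by auto
    have b1: "bar (deg f + deg e) (h \<otimes>\<^bsub>B.FA\<^esub> d) = cst c \<otimes>\<^bsub>FA\<^esub> bar (deg e) (dif e)"
      using bar_mult[OF fB bar_cst(1)[OF f] eB be(1)] c(3) eq by simp
    have b2: "bar (s + t) (h \<otimes>\<^bsub>B.FA\<^esub> d) = bar s h \<otimes>\<^bsub>FA\<^esub> D"
      using bar_mult[OF h s(1) d(1) t(1)] by (simp add: D_def)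
    have "cst c \<noteq> \<zero>\<^bsub>FA\<^esub>" using c(2) by (metis cst_inject cst_zero)
    then have n1: "bar (deg f + deg e) (h \<otimes>\<^bsub>B.FA\<^esub> d) \<noteq> \<zero>\<^bsub>FA\<^esub>"
      unfolding b1 using c ebar be(3) by (intro FA_integral) auto
    have n2: "bar (s + t) (h \<otimes>\<^bsub>B.FA\<^esub> d) \<noteq> \<zero>\<^bsub>FA\<^esub>"
      unfolding b2 using D s h by (intro FA_integral) auto
    have w1: "wle (h \<otimes>\<^bsub>B.FA\<^esub> d) (deg f + deg e)"
      using wle_mult[OF fB eB bar_cst(1)[OF f] be(1)] eq by simp
    have w2: "wle (h \<otimes>\<^bsub>B.FA\<^esub> d) (s + t)" by (rule wle_mult[OF h d(1) s(1) t(1)])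
    have st: "deg f + deg e = s + t" by (rule weight_unique[OF w1 w2 n1 n2])
    obtain c' where c': "c' \<in> carrier K" "c' \<otimes> c = \<one>" using K_inverse c by blast
    have "bar (deg e) (dif e) = (cst c' \<otimes>\<^bsub>FA\<^esub> cst c) \<otimes>\<^bsub>FA\<^esub> bar (deg e) (dif e)"
      using c c' ebar by (simp add: cst_cst_mult FA_one_cst[symmetric])
    also have "\<dots> = cst c' \<otimes>\<^bsub>FA\<^esub> (bar s h \<otimes>\<^bsub>FA\<^esub> D)"
      using c c' ebar b1 b2 st by (simp add: R.m_assoc)
    also have "\<dots> = (cst c' \<otimes>\<^bsub>FA\<^esub> bar s h) \<otimes>\<^bsub>FA\<^esub> D" using c' h D by (simp add: R.m_assoc)
    finally show ?thesis using s(1) st c' h by (intro bexI[of _ "cst c' \<otimes>\<^bsub>FA\<^esub> bar s h"]) auto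
  qed
  obtain q1 s where q1: "q1 \<in> carrier FA" "bar (deg a) (dif a) = q1 \<otimes>\<^bsub>FA\<^esub> D"
    and s: "wle h s" "deg f + deg a = s + t"
    using divides[OF a_C a_nonzero deg_a f12 f(3,4)] by blast
  obtain q2 where q2: "q2 \<in> carrier FA" "bar (deg b) (dif b) = q2 \<otimes>\<^bsub>FA\<^esub> D"
    using divides[OF b_C b_nonzero deg_b' f12' f'(3,4)] by blast
  obtain k where k: "deg a = k * g" using g_dvd[OF a_C a_nonzero] by (metis dvdE mult.commute)
  have k': "deg b = (1 + k) * g" using k deg_b by simp
  define c where "c = a (om k)"
  have c: "c \<in> carrier K" "c \<noteq> \<zero>" using top_C_om(2)[OF a_C a_nonzero k] aF by (auto simp: c_def)
  have "b (om (1 + k)) = top b (om (1 + k))" using k' by (simp add: component_def length_om)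
  also have "\<dots> = z (om 1) \<otimes> top a (om k)"
    unfolding top_b using aF k homog_dle[OF homog_z] by (intro om_mult) (auto intro: homog_dle)
  also have "\<dots> = c" using k c by (simp add: om_1 z_\<omega> component_def length_om c_def)
  finally have bc: "b (om (1 + k)) = c" .
  \<comment> \<open>This is \<open>(z^(k+1) - 1) - z (z^k - 1) = z - 1\<close>, multiplied by the
    common leading coefficient \<open>c\<close>; here the choice of \<open>a\<close> and
    \<open>b\<close> with degrees differing by \<open>g\<close> is used.\<close>
  have "bar (deg b) (dif b) \<ominus>\<^bsub>FA\<^esub> z \<otimes>\<^bsub>FA\<^esub> bar (deg a) (dif a) =
     (z \<otimes>\<^bsub>FA\<^esub> top a \<ominus>\<^bsub>FA\<^esub> cst c) \<ominus>\<^bsub>FA\<^esub> z \<otimes>\<^bsub>FA\<^esub> (top a \<ominus>\<^bsub>FA\<^esub> cst c)"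
    using bar_dif(2)[OF a_C a_nonzero k deg_a] bar_dif(2)[OF b_C b_nonzero k' deg_b'] bc top_b by (simp add: c_def)
  also have "\<dots> = z \<otimes>\<^bsub>FA\<^esub> cst c \<ominus>\<^bsub>FA\<^esub> cst c"
    using component_closed[OF aF(1), of "deg a"] cst_closed[OF c(1)] z_closed by algebra
  also have "\<dots> = cst c \<otimes>\<^bsub>FA\<^esub> (z \<ominus>\<^bsub>FA\<^esub> \<one>\<^bsub>FA\<^esub>)"
    unfolding cst_commute[OF c(1) z_closed, symmetric]
    using cst_closed[OF c(1)] z_closed by (simp add: R.minus_eq R.r_distr R.r_minus)
  finally have zc: "cst c \<otimes>\<^bsub>FA\<^esub> (z \<ominus>\<^bsub>FA\<^esub> \<one>\<^bsub>FA\<^esub>) = (q2 \<ominus>\<^bsub>FA\<^esub> z \<otimes>\<^bsub>FA\<^esub> q1) \<otimes>\<^bsub>FA\<^esub> D"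
    unfolding q1(2) q2(2) using q1(1) q2(1) D(1) z_closed 
    by algebra
  define q where "q = q2 \<ominus>\<^bsub>FA\<^esub> z \<otimes>\<^bsub>FA\<^esub> q1"
  have q: "q \<in> carrier FA" using q1 q2 by (simp add: q_def)
  have val: "(cst c \<otimes>\<^bsub>FA\<^esub> (z \<ominus>\<^bsub>FA\<^esub> \<one>\<^bsub>FA\<^esub>)) v = c \<otimes> (z v \<ominus> \<one>\<^bsub>FA\<^esub> v)" for v
    using c by (simp add: cst_mult FA_minus)
  have z0: "z [] = \<zero>" using homog_zero[OF homog_z, of "[]"] g_pos by simp
  \<comment> \<open>The constant term of \<open>z - 1\<close> is nonzero, hence so is that of its
    right divisor \<open>D\<close>. By the definition of \<open>bar\<close> this forces
    \<open>g\<close> to divide the weight \<open>t\<close>.\<close>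
  have "q [] \<otimes> D [] = (q \<otimes>\<^bsub>FA\<^esub> D) []" using q D by (simp add: FA_mult Pi_iff)
  also have "\<dots> = c \<otimes> (\<zero> \<ominus> \<one>)" using val[of "[]"] zc z0 by (simp add: q_def FA_one)
  also have "\<dots> = \<ominus> c" using c by (simp add: A.minus_eq A.r_minus)
  finally have "q [] \<otimes> D [] \<noteq> \<zero>" using c A.add.inv_eq_1_iff by simp
  then have D0: "D [] \<noteq> \<zero>" using q by auto
  then have gt: "g dvd t" by (simp add: D_def bar_def split: if_splits)
  have degD: "deg D \<le> g"
  proof -
    have "q \<noteq> \<zero>\<^bsub>FA\<^esub>" using \<open>q [] \<otimes> D [] \<noteq> \<zero>\<close> D by (auto simp: FA_zero)
    then have "deg (q \<otimes>\<^bsub>FA\<^esub> D) = deg q + deg D" using q D by (intro FA_integral(2))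
    moreover have "dle (q \<otimes>\<^bsub>FA\<^esub> D) g"
      unfolding q_def zc[symmetric]
    proof (rule dleI)
      fix w :: "'x list" assume "g < length w"
      then have "z w = \<zero>" "w \<noteq> []" using homog_zero[OF homog_z, of w] by auto
      then show "(cst c \<otimes>\<^bsub>FA\<^esub> (z \<ominus>\<^bsub>FA\<^esub> \<one>\<^bsub>FA\<^esub>)) w = \<zero>" unfolding val using c by (simp add: FA_one A.minus_eq)
    qed
    ultimately show ?thesis using deg_le by fastforce
  qed
  \<comment> \<open>As \<open>g\<close> divides \<open>t\<close>, it divides the length of each word
    of \<open>D\<close>, and these lengths are at most \<open>g\<close> because \<open>D\<close>
    divides \<open>z - 1\<close>.\<close>
  have lenD: "length v = 0 \<or> length v = g" if "D v \<noteq> \<zero>" for v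
  proof -
    have "length v \<le> t" "g dvd t - length v" using that by (auto simp: D_def bar_def split: if_splits)
    then have "g dvd length v" using gt by (metis dvd_diffD1)
    moreover have "length v \<le> g" using that dle_deg[OF D(1)] degD by (force simp: dle_def)
    ultimately show ?thesis by (metis dvd_imp_le le_antisym neq0_conv)
  qed
  define m where "m = B.deg d"
  define m' where "m' = B.deg h"
  \<comment> \<open>A word of maximal length in \<open>a\<close>, to be cut at the word degree
    \<open>m'\<close> of \<open>h\<close>. At it, the two sides of \<open>f dif a = h d\<close> have
    the coefficients \<open>a \<gamma> f\<close> and \<open>h \<alpha> d \<beta>\<close>.\<close>
  obtain \<gamma> where \<gamma>: "length \<gamma> = deg a" "a \<gamma> \<noteq> \<zero>" using deg_witness[OF aF(1) a_nonzero] by blast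
  define \<alpha> \<beta> where "\<alpha> = take m' \<gamma>" and "\<beta> = drop m' \<gamma>"
  have fB: "B.cst f \<in> carrier B.FA" "B.cst f \<noteq> \<zero>\<^bsub>B.FA\<^esub>" 
    using f by (auto, metis B.cst_inject B.cst_zero)
  have hd_nz: "h \<otimes>\<^bsub>B.FA\<^esub> d \<noteq> \<zero>\<^bsub>B.FA\<^esub>"
    using B.FA_integral(1)[OF fB(1) U(1) fB(2) difa(1)] f(4) by simp
  then have h0: "h \<noteq> \<zero>\<^bsub>B.FA\<^esub>" using d by auto
  have dm: "m' + m = deg a"
    using B.FA_integral(2)[OF fB(1) U(1) fB(2) difa(1)] B.FA_integral(2)[OF f(3) d(1) h0 d(2)]
      f(4) difa(2) B.deg_cst by (simp add: m_def m'_def)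
  have \<alpha>\<beta>: "\<gamma> = \<alpha> @ \<beta>" "length \<alpha> = m'" "length \<beta> = m" using \<gamma>(1) dm by (auto simp: \<alpha>_def \<beta>_def)
  have prod: "h \<alpha> \<otimes>\<^bsub>FA\<^esub> d \<beta> = cst (a \<gamma>) \<otimes>\<^bsub>FA\<^esub> f"
  proof -
    have "h \<alpha> \<otimes>\<^bsub>Cr\<^esub> d \<beta> = (h \<otimes>\<^bsub>B.FA\<^esub> d) (\<alpha> @ \<beta>)"
      using B.mult_top[OF f(3) d(1) B.dle_deg[OF f(3)] B.dle_deg[OF d(1)], of \<alpha> \<beta>] \<alpha>\<beta>
      by (simp add: m_def m'_def)
    also have "\<dots> = f \<otimes>\<^bsub>Cr\<^esub> dif a \<gamma>" using B.cst_mult[OF f(1) U(1)] f(4) \<alpha>\<beta>(1) by metis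
    also have "\<dots> = cst (a \<gamma>) \<otimes>\<^bsub>FA\<^esub> f" 
      using difa(3)[OF \<gamma>(1)] f12 aF cst_commute[of "a \<gamma>" f] by (simp add: C_carrier)
    finally show ?thesis by simp
  qed
  have hdF: "h \<alpha> \<in> carrier FA" "d \<beta> \<in> carrier FA" using f d by auto
  have fF: "f \<in> carrier FA" using f12 by auto
  have a\<gamma>: "cst (a \<gamma>) \<noteq> \<zero>\<^bsub>FA\<^esub>" using \<gamma>(2) by (metis cst_inject cst_zero)
  have nz: "h \<alpha> \<otimes>\<^bsub>FA\<^esub> d \<beta> \<noteq> \<zero>\<^bsub>FA\<^esub>" 
    unfolding prod using a\<gamma> fF f12 aF by (intro FA_integral) auto
  then have nz': "h \<alpha> \<noteq> \<zero>\<^bsub>FA\<^esub>" "d \<beta> \<noteq> \<zero>\<^bsub>FA\<^esub>" using hdF by auto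
  have "deg (h \<alpha>) + deg (d \<beta>) = deg f"
    using FA_integral(2)[OF hdF nz'] FA_integral(2)[OF _ fF a\<gamma> f12(2)] aF prod by (simp add: deg_cst)
  moreover have "m' + deg (h \<alpha>) \<le> s"
    using wle_dle[OF s(1) nz'(1)] deg_le[of "h \<alpha>" "s - m'"] \<alpha>\<beta> by auto
  moreover have mt: "m + deg (d \<beta>) \<le> t"
    using wle_dle[OF t(1) nz'(2)] deg_le[of "d \<beta>" "t - m"] \<alpha>\<beta> by auto
  \<comment> \<open>The two bounds add up to \<open>deg f + deg a \<le> s + t\<close>, which is an
    equality, so each is attained: \<open>d \<beta>\<close> reaches the weight \<open>t\<close> and
    shows in \<open>D\<close>.\<close>
  ultimately have md: "m + deg (d \<beta>) = t" using s(2) dm by simp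
  have "d \<beta> \<in> C" using d by simp
  then obtain j where j: "deg (d \<beta>) = j * g" using g_dvd nz'(2) by (metis dvdE mult.commute)
  have "D \<beta> = d \<beta> (om j)" using md j \<alpha>\<beta>(3) g_pos by (simp add: D_def bar_def flip: md)
  then have "D \<beta> \<noteq> \<zero>" using top_C_om(2)[OF \<open>d \<beta> \<in> C\<close> nz'(2) j] by simp
  then have "m = 0 \<or> m = g" using lenD \<alpha>\<beta>(3) by blast
  \<comment> \<open>A constant \<open>d\<close> would be sent by \<open>ev\<close> to its own value
    \<open>d []\<close>, which would then be zero. Here the identification of the two copies is
    used.\<close>
  moreover have "m \<noteq> 0"
  proof
    assume "m = 0"
    then have "d = B.cst (d [])" using B.deg_0_cst[OF d(1)] B.dle_deg[OF d(1)] by (simp add: m_def)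
    then have "d [] w = \<zero>" for w using ev_cst[of "d []" w] ev0[of w] d by simp
    then have "d [] = \<zero>\<^bsub>FA\<^esub>" by (auto simp: FA_zero)
    then show False using \<open>d = B.cst (d [])\<close> d(2) B.cst_zero by simp
  qed
  ultimately have mg: "m = g" by simp
  \<comment> \<open>The weight is \<open>g + j g\<close> and \<open>v\<close> takes up at least one
    letter, so the degree is less than \<open>(j+1) g\<close>; being a multiple of \<open>g\<close>,
    it is at most \<open>j g\<close>.\<close>
  have "deg (d v) \<le> deg (d \<beta>)" if v: "v \<noteq> []" "d v \<noteq> \<zero>\<^bsub>FA\<^esub>" for v
  proof -
    have "length v + deg (d v) \<le> t" using wle_dle[OF t(1) v(2)] deg_le[of "d v" "t - length v"] by auto
    moreover have "0 < length v" using v by simp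
    moreover have "g + j * g = t" using md mg j by simp
    ultimately have lt: "deg (d v) < g + j * g" by linarith
    obtain i where i: "deg (d v) = i * g" using g_dvd[of "d v"] v d by (metis B_coeff_C dvdE mult.commute)
    have "i * g < Suc j * g" using lt i by simp
    then have "i < Suc j" by (rule mult_less_cancel2[THEN iffD1, THEN conjunct2])
    then show ?thesis using i j by simp
  qed
  moreover have "a \<gamma> \<in> carrier K" using aF by simp
  moreover have "B.dle d g" using B.dle_deg[OF d(1)] mg by (simp add: m_def)
  ultimately show ?thesis
    using d(1) f(3,4) f12 ev0 \<alpha>\<beta>(3) mg nz' \<gamma>(2) prod by blast
qed

end

subsection \<open>Contents\<close>

context cring
begin

section \<open>Inclusions between sums, products and powers of ideals\<close>

lemma ideal_prod_mono: "I \<subseteq> I' \<Longrightarrow> J \<subseteq> J' \<Longrightarrow> I \<cdot> J \<subseteq> I' \<cdot> J'"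
proof
  fix x assume "I \<subseteq> I'" "J \<subseteq> J'" "x \<in> I \<cdot> J"
  then show "x \<in> I' \<cdot> J'"
    by (induction rule: ideal_prod.induct[OF \<open>x \<in> I \<cdot> J\<close>]) (auto intro: ideal_prod.intros)
qed

lemma ideal_prod_least:
  assumes "ideal Z R" "\<And>i j. i \<in> I \<Longrightarrow> j \<in> J \<Longrightarrow> i \<otimes> j \<in> Z"
  shows "I \<cdot> J \<subseteq> Z"
proof
  fix x assume "x \<in> I \<cdot> J"
  then show "x \<in> Z"
    by (induction rule: ideal_prod.induct)
      (use assms additive_subgroup.a_closed[OF ideal.axioms(1)[OF assms(1)]] in auto)
qed

lemma ideal_sum_least: "ideal Z R \<Longrightarrow> I \<subseteq> Z \<Longrightarrow> J \<subseteq> Z \<Longrightarrow> I <+>\<^bsub>R\<^esub> J \<subseteq> Z"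
  using additive_subgroup.a_closed[OF ideal.axioms(1)] by (fastforce simp: set_add_def')

lemma ideal_prod_sum_least:
  assumes "ideal I R" "ideal J R" "ideal L R" "ideal Z R" "I \<cdot> J \<subseteq> Z" "I \<cdot> L \<subseteq> Z" "H \<subseteq> J <+>\<^bsub>R\<^esub> L"
  shows "I \<cdot> H \<subseteq> Z"
proof -
  have "I \<cdot> H \<subseteq> I \<cdot> (J <+>\<^bsub>R\<^esub> L)" using assms(7) by (intro ideal_prod_mono) auto
  also have "\<dots> \<subseteq> Z" unfolding ideal_prod_distr(1)[OF assms(1-3)] by (rule ideal_sum_least) fact+
  finally show ?thesis .
qed

lemma ideal_sum_upper:
  assumes "ideal I R" "ideal J R"
  shows "I \<subseteq> I <+>\<^bsub>R\<^esub> J" "J \<subseteq> I <+>\<^bsub>R\<^esub> J"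
proof -
  have z: "\<zero> \<in> I" "\<zero> \<in> J"
    using assms[THEN ideal.axioms(1), THEN additive_subgroup.zero_closed] by auto
  show "I \<subseteq> I <+>\<^bsub>R\<^esub> J"
  proof
    fix x assume x: "x \<in> I"
    then have "x = x \<oplus> \<zero>" using ideal.Icarr[OF assms(1)] by simp
    then show "x \<in> I <+>\<^bsub>R\<^esub> J" unfolding set_add_def' using x z by blast
  qed
  show "J \<subseteq> I <+>\<^bsub>R\<^esub> J"
  proof
    fix x assume x: "x \<in> J"
    then have "x = \<zero> \<oplus> x" using ideal.Icarr[OF assms(2)] by simp
    then show "x \<in> I <+>\<^bsub>R\<^esub> J" unfolding set_add_def' using x z by blast
  qed
qed

lemma ideal_prod_lcomm:
  assumes "ideal I R" "ideal J R" "ideal L R"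
  shows "I \<cdot> (J \<cdot> L) = J \<cdot> (I \<cdot> L)"
  by (metis assms ideal_prod_assoc ideal_prod_commute)

primrec ideal_pow :: "'a set \<Rightarrow> nat \<Rightarrow> 'a set" where
  "ideal_pow I 0 = carrier R"
| "ideal_pow I (Suc n) = I \<cdot> ideal_pow I n"

lemma ideal_pow_ideal [simp]: "ideal I R \<Longrightarrow> ideal (ideal_pow I n) R"
  by (induction n) (auto simp: oneideal ideal_prod_is_ideal)

lemma ideal_prod_ideal [simp]: "ideal I R \<Longrightarrow> ideal J R \<Longrightarrow> ideal (I \<cdot> J) R"
  by (rule ideal_prod_is_ideal)

lemma ideal_pow_mono: "I \<subseteq> J \<Longrightarrow> ideal_pow I n \<subseteq> ideal_pow J n"
  by (induction n) (auto intro: ideal_prod_mono[THEN subsetD])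

lemma pow_in_ideal_pow: "ideal I R \<Longrightarrow> y \<in> I \<Longrightarrow> y [^] n \<in> ideal_pow I n"
proof (induction n)
  case (Suc n)
  then have "y \<otimes> y [^] n \<in> ideal_pow I (Suc n)" by (auto intro: ideal_prod.prod)
  moreover have "y \<in> carrier R" using Suc ideal.Icarr by metis
  ultimately show ?case by (simp add: m_comm)
qed (simp add: ideal.Icarr)

text \<open>On expanding the power of \<open>T + J\<close>, each product with a factor from
  \<open>T\<close> falls into \<open>T I^n\<close>, and only the pure power of \<open>J\<close>
  remains.\<close>

lemma ideal_sum_pow:
  assumes "ideal I R" "ideal J R" "ideal T R" "T \<subseteq> I" "J \<subseteq> I" "I \<subseteq> T <+>\<^bsub>R\<^esub> J"
  shows "ideal_pow I (Suc n) \<subseteq> T \<cdot> ideal_pow I n <+>\<^bsub>R\<^esub> ideal_pow J (Suc n)"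
proof (induction n)
  case 0
  then show ?case using assms by (simp add: ideal_prod_one)
next
  case (Suc n)
  let ?Z = "T \<cdot> ideal_pow I (Suc n) <+>\<^bsub>R\<^esub> ideal_pow J (Suc (Suc n))"
  note id = assms(1-3)
  have idZ: "ideal ?Z R" using id by (intro add_ideals) (auto simp: ideal_prod_is_ideal simp del: ideal_pow.simps)
  have Z: "T \<cdot> ideal_pow I (Suc n) \<subseteq> ?Z" "ideal_pow J (Suc (Suc n)) \<subseteq> ?Z"
    using ideal_sum_upper[of "T \<cdot> ideal_pow I (Suc n)" "ideal_pow J (Suc (Suc n))"] id
    by (simp_all del: ideal_pow.simps)
  have "J \<cdot> ideal_pow I (Suc n) \<subseteq> ?Z"
  proof (rule ideal_prod_sum_least[OF id(2) _ _ idZ _ _ Suc])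
    have "J \<cdot> (T \<cdot> ideal_pow I n) = T \<cdot> (J \<cdot> ideal_pow I n)" using id by (simp add: ideal_prod_lcomm)
    also have "\<dots> \<subseteq> T \<cdot> ideal_pow I (Suc n)" unfolding ideal_pow.simps(2) by (intro ideal_prod_mono order_refl assms(5))
    finally show "J \<cdot> (T \<cdot> ideal_pow I n) \<subseteq> ?Z" using Z(1) by blast
    show "J \<cdot> ideal_pow J (Suc n) \<subseteq> ?Z" using Z(2) by simp
  qed (use id in \<open>auto simp del: ideal_pow.simps\<close>)
  then have "ideal_pow I (Suc n) \<cdot> J \<subseteq> ?Z" using id by (simp add: ideal_prod_commute del: ideal_pow.simps(2))
  moreover have "ideal_pow I (Suc n) \<cdot> T \<subseteq> ?Z"
    using Z(1) id by (simp add: ideal_prod_commute[of _ T] del: ideal_pow.simps(2))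
  ultimately have "ideal_pow I (Suc n) \<cdot> I \<subseteq> ?Z"
    using id by (intro ideal_prod_sum_least[OF _ id(3,2) idZ _ _ assms(6)]) (auto simp del: ideal_pow.simps)
  then show ?case using id by (simp add: ideal_prod_commute[of _ I])
qed

end

context free_alg
begin

section \<open>Ideals generated by coefficients\<close>

definition content :: "('x list \<Rightarrow> 'a) \<Rightarrow> 'a set" where
  "content f = genideal A (range f)"

lemma content_ideal [simp]: "f \<in> carrier FA \<Longrightarrow> ideal (content f) A"
  unfolding content_def by (intro A.genideal_ideal) auto

lemma content_coeff: "f \<in> carrier FA \<Longrightarrow> f w \<in> content f"
  unfolding content_def using A.genideal_self[of "range f"] by auto

lemma content_least: "ideal I A \<Longrightarrow> (\<And>w. f w \<in> I) \<Longrightarrow> content f \<subseteq> I"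
  unfolding content_def by (intro A.genideal_minimal) auto

text \<open>Generators are replaced by whole ideals one factor at a time: the elements that multiply
  a given set into \<open>Z\<close> form an ideal.\<close>

lemma content_prod_least:
  assumes "f \<in> carrier FA" "h \<in> carrier FA" "ideal Z A" "\<And>u v. f u \<otimes> h v \<in> Z"
  shows "content f \<cdot>\<^bsub>A\<^esub> content h \<subseteq> Z"
proof (rule A.ideal_prod_least[OF assms(3)])
  have colon: "ideal {x \<in> carrier A. \<forall>y\<in>Y. x \<otimes> y \<in> Z} A" if Y: "Y \<subseteq> carrier A" for Y
  proof (rule idealI)
    have Z: "additive_subgroup Z A" using assms(3) by (rule ideal.axioms(1))
    show "subgroup {x \<in> carrier A. \<forall>y\<in>Y. x \<otimes> y \<in> Z} (add_monoid A)"
    proof (rule A.add.subgroupI)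
      show "{x \<in> carrier A. \<forall>y\<in>Y. x \<otimes> y \<in> Z} \<noteq> {}"
        using Y additive_subgroup.zero_closed[OF Z] by (auto intro!: exI[of _ \<zero>])
      show "\<ominus> x \<in> {x \<in> carrier A. \<forall>y\<in>Y. x \<otimes> y \<in> Z}" if "x \<in> {x \<in> carrier A. \<forall>y\<in>Y. x \<otimes> y \<in> Z}" for x
        using that Y additive_subgroup.a_inv_closed[OF Z] by (auto simp: a_inv_def[symmetric] A.l_minus subset_iff)
      show "x \<oplus> y \<in> {x \<in> carrier A. \<forall>y\<in>Y. x \<otimes> y \<in> Z}" 
        if "x \<in> {x \<in> carrier A. \<forall>y\<in>Y. x \<otimes> y \<in> Z}" "y \<in> {x \<in> carrier A. \<forall>y\<in>Y. x \<otimes> y \<in> Z}" for x y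
        using that Y additive_subgroup.a_closed[OF Z] by (auto simp: A.l_distr subset_iff)
    qed auto
    fix a x assume a: "a \<in> {x \<in> carrier A. \<forall>y\<in>Y. x \<otimes> y \<in> Z}" and x: "x \<in> carrier A"
    show "x \<otimes> a \<in> {x \<in> carrier A. \<forall>y\<in>Y. x \<otimes> y \<in> Z}"
      using a x Y ideal.I_l_closed[OF assms(3)] by (auto simp: A.m_assoc subset_iff)
    then show "a \<otimes> x \<in> {x \<in> carrier A. \<forall>y\<in>Y. x \<otimes> y \<in> Z}"
      using a x by (simp add: A.m_comm)
  qed (rule A.ring_axioms)
  fix i j assume i: "i \<in> content f" and j: "j \<in> content h"
  have f: "range f \<subseteq> carrier A" using assms by auto
  have "content f \<subseteq> {x \<in> carrier A. \<forall>y\<in>range h. x \<otimes> y \<in> Z}"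
    using assms by (intro content_least colon) auto
  then have "content h \<subseteq> {y \<in> carrier A. \<forall>x\<in>{i}. y \<otimes> x \<in> Z}"
    using assms i by (intro content_least colon) (auto simp: A.m_comm)
  then have "j \<otimes> i \<in> Z" using j by auto
  moreover have "i \<in> carrier A" "j \<in> carrier A" using i j assms ideal.Icarr content_ideal by metis+
  ultimately show "i \<otimes> j \<in> Z" by (simp add: A.m_comm)
qed

lemma content_add:
  assumes "f \<in> carrier FA" "h \<in> carrier FA"
  shows "content (f \<oplus>\<^bsub>FA\<^esub> h) \<subseteq> content f <+>\<^bsub>A\<^esub> content h"
proof (rule content_least)
  show "ideal (content f <+>\<^bsub>A\<^esub> content h) A" using assms by (intro A.add_ideals) auto
  show "(f \<oplus>\<^bsub>FA\<^esub> h) w \<in> content f <+>\<^bsub>A\<^esub> content h" for w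
    unfolding FA_add set_add_def' using content_coeff assms by blast
qed

lemma content_uminus: 
  assumes "f \<in> carrier FA"
  shows "content (\<ominus>\<^bsub>FA\<^esub> f) \<subseteq> content f"
  using assms additive_subgroup.a_inv_closed[OF ideal.axioms(1)[OF content_ideal[OF assms]] content_coeff[OF assms]]
  by (intro content_least) (auto simp: FA_uminus)

lemma content_minus:
  assumes "f \<in> carrier FA" "h \<in> carrier FA"
  shows "content (f \<ominus>\<^bsub>FA\<^esub> h) \<subseteq> content f <+>\<^bsub>A\<^esub> content h"
proof -
  have "content (f \<ominus>\<^bsub>FA\<^esub> h) \<subseteq> content f <+>\<^bsub>A\<^esub> content (\<ominus>\<^bsub>FA\<^esub> h)"
    unfolding a_minus_def using assms by (intro content_add) auto
  also have "\<dots> \<subseteq> content f <+>\<^bsub>A\<^esub> content h"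
    using content_uminus[OF assms(2)] by (auto simp: set_add_def')
  finally show ?thesis .
qed

lemma content_mult:
  assumes "f \<in> carrier FA" "h \<in> carrier FA"
  shows "content (f \<otimes>\<^bsub>FA\<^esub> h) \<subseteq> content f \<cdot>\<^bsub>A\<^esub> content h"
proof (rule content_least)
  show id: "ideal (content f \<cdot>\<^bsub>A\<^esub> content h) A" using assms by simp
  fix w
  have *: "(\<Oplus>i\<in>I. f (take i w) \<otimes> h (drop i w)) \<in> content f \<cdot>\<^bsub>A\<^esub> content h" if "finite I" for I
    using that
  proof (induction I rule: finite_induct)
    case empty
    then show ?case using additive_subgroup.zero_closed[OF ideal.axioms(1)[OF id]] by simp
  next
    case (insert i I)
    have "f (take i w) \<otimes> h (drop i w) \<oplus> (\<Oplus>i\<in>I. f (take i w) \<otimes> h (drop i w)) \<in> content f \<cdot>\<^bsub>A\<^esub> content h"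
      using assms insert.IH by (intro ideal_prod.sum ideal_prod.prod content_coeff)
    then show ?case
      using assms insert.hyps by (subst A.finsum_insert) auto
  qed
  show "(f \<otimes>\<^bsub>FA\<^esub> h) w \<in> content f \<cdot>\<^bsub>A\<^esub> content h"
    unfolding FA_mult by (rule *) simp
qed

lemma component_coeff_content:
  assumes "f \<in> carrier FA"
  shows "content (component n f) \<subseteq> content f" "content (f \<ominus>\<^bsub>FA\<^esub> component n f) \<subseteq> content f"
proof -
  note id = additive_subgroup.zero_closed[OF ideal.axioms(1)[OF content_ideal[OF assms]]]
  show "content (component n f) \<subseteq> content f"
    using assms id content_coeff by (intro content_least) (auto simp: component_def)
  show "content (f \<ominus>\<^bsub>FA\<^esub> component n f) \<subseteq> content f"
    using assms id content_coeff[OF assms]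
    by (intro content_least) (auto simp: component_def FA_minus A.minus_eq A.r_neg)
qed

text \<open>The Dedekind--Mertens lemma: homogeneous components multiply like the coefficients of
  polynomials in one variable, since all products of coefficients occur in their product.\<close>

lemma dedekind_mertens:
  assumes "h \<in> carrier FA" "d \<in> carrier FA" "dle h k"
  shows "A.ideal_pow (content d) (Suc k) \<cdot>\<^bsub>A\<^esub> content h
    \<subseteq> A.ideal_pow (content d) k \<cdot>\<^bsub>A\<^esub> content (h \<otimes>\<^bsub>FA\<^esub> d)"
  using assms
proof (induction k arbitrary: h d rule: less_induct)
  case (less k)
  \<comment> \<open>The outer induction is on the bound \<open>k\<close> for the degree of
    \<open>h\<close>; for \<open>d\<close> there is an inner induction on the strict bound
    \<open>m\<close> for the length of its words, with \<open>d = 0\<close> at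
    \<open>m = 0\<close>.\<close>
  have main: "A.ideal_pow (content d) (Suc k) \<cdot>\<^bsub>A\<^esub> content h
    \<subseteq> A.ideal_pow (content d) k \<cdot>\<^bsub>A\<^esub> content (h \<otimes>\<^bsub>FA\<^esub> d)"
    if h: "h \<in> carrier FA" "dle h k" and d: "d \<in> carrier FA" "\<And>w. m \<le> length w \<Longrightarrow> d w = \<zero>" for h d m
    using d
  proof (induction m arbitrary: d)
    case 0
    then have "content d \<subseteq> {\<zero>}" by (intro content_least A.zeroideal) auto
    then have "A.ideal_pow (content d) (Suc k) \<cdot>\<^bsub>A\<^esub> content h \<subseteq> {\<zero>}"
    proof (intro A.ideal_prod_least A.zeroideal)
      fix i j assume i: "i \<in> A.ideal_pow (content d) (Suc k)" and j: "j \<in> content h"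
      have "A.ideal_pow (content d) (Suc k) \<subseteq> content d"
        using A.ideal_prod_inter[of "content d" "A.ideal_pow (content d) k"] 0 by auto
      then have "i = \<zero>" using i \<open>content d \<subseteq> {\<zero>}\<close> by blast
      moreover have "j \<in> carrier A" using j h ideal.Icarr content_ideal by metis
      ultimately show "i \<otimes> j \<in> {\<zero>}" by simp
    qed
    moreover have "\<zero> \<in> A.ideal_pow (content d) k \<cdot>\<^bsub>A\<^esub> content (h \<otimes>\<^bsub>FA\<^esub> d)"
      using 0(1) h(1)
      by (intro additive_subgroup.zero_closed ideal.axioms(1) A.ideal_prod_ideal A.ideal_pow_ideal content_ideal) simp_all
    ultimately show ?case by blast
  next
    case (Suc m)
    note d = Suc.prems(1)
    define I where "I = content d"
    define J where "J = content h"
    define Q where "Q = content (h \<otimes>\<^bsub>FA\<^esub> d)"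
    \<comment> \<open>Each factor is split into its component of maximal length and the rest, to
      which an induction hypothesis applies.\<close>
    define dt d' where "dt = component m d" and "d' = d \<ominus>\<^bsub>FA\<^esub> dt"
    define ht h' where "ht = component k h" and "h' = h \<ominus>\<^bsub>FA\<^esub> ht"
    have cl: "dt \<in> carrier FA" "d' \<in> carrier FA" "ht \<in> carrier FA" "h' \<in> carrier FA" "h \<otimes>\<^bsub>FA\<^esub> d \<in> carrier FA"
      using d h by (auto simp: dt_def d'_def ht_def h'_def)
    define T where "T = content dt"
    define I' where "I' = content d'"
    define U where "U = content ht"
    define Z where "Z = A.ideal_pow I k \<cdot>\<^bsub>A\<^esub> Q"
    have id: "ideal I A" "ideal J A" "ideal Q A" "ideal T A" "ideal I' A" "ideal U A" "ideal (content h') A"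
      using cl d h by (auto simp: I_def J_def Q_def T_def I'_def U_def)
    then have idZ: "ideal Z A" by (simp add: Z_def)
    have TI: "T \<subseteq> I" "I' \<subseteq> I" unfolding T_def I'_def I_def dt_def d'_def by (rule component_coeff_content[OF d])+
    have UJ: "U \<subseteq> J" unfolding U_def J_def ht_def by (rule component_coeff_content[OF h(1)])
    have dd: "d = dt \<oplus>\<^bsub>FA\<^esub> d'" "h = ht \<oplus>\<^bsub>FA\<^esub> h'"
      unfolding d'_def h'_def using d h cl(1,3) by algebra+
    have ITI: "I \<subseteq> T <+>\<^bsub>A\<^esub> I'" unfolding I_def T_def I'_def using content_add[OF cl(1,2)] dd by simp
    have JUJ: "J \<subseteq> U <+>\<^bsub>A\<^esub> content h'" unfolding J_def U_def using content_add[OF cl(3,4)] dd by simp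
    have dm: "dle d m" using Suc.prems(2) by (intro dleI) auto
    \<comment> \<open>A coefficient of \<open>dt\<close> times one of \<open>ht\<close> is the
      coefficient of \<open>h d\<close> at the concatenated word. For polynomials in one variable
      there is just one such product.\<close>
    have TU: "T \<cdot>\<^bsub>A\<^esub> U \<subseteq> Q"
      unfolding T_def U_def
    proof (rule content_prod_least[OF cl(1,3) id(3)])
      fix u v
      show "dt u \<otimes> ht v \<in> Q"
      proof (cases "length u = m \<and> length v = k")
        case True
        then have "dt u \<otimes> ht v = (h \<otimes>\<^bsub>FA\<^esub> d) (v @ u)"
          using mult_top[OF h(1) d h(2) dm, of v u] d h by (simp add: dt_def ht_def component_def A.m_comm)
        then show ?thesis unfolding Q_def using content_coeff[OF cl(5)] by simp
      next
        case False
        then have "dt u \<otimes> ht v = \<zero>" using d h by (auto simp: dt_def ht_def component_def)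
        then show ?thesis using additive_subgroup.zero_closed[OF ideal.axioms(1)[OF id(3)]] by simp
      qed
    qed
    let ?P = "A.ideal_pow I"
    have idP: "ideal (?P n) A" for n using id by simp
    have TPU: "(T \<cdot>\<^bsub>A\<^esub> ?P n) \<cdot>\<^bsub>A\<^esub> U \<subseteq> ?P n \<cdot>\<^bsub>A\<^esub> Q" for n
    proof -
      have "(T \<cdot>\<^bsub>A\<^esub> ?P n) \<cdot>\<^bsub>A\<^esub> U = ?P n \<cdot>\<^bsub>A\<^esub> (T \<cdot>\<^bsub>A\<^esub> U)"
        using id idP by (simp add: A.ideal_prod_assoc A.ideal_prod_commute A.ideal_prod_lcomm)
      also have "\<dots> \<subseteq> ?P n \<cdot>\<^bsub>A\<^esub> Q" using TU by (intro A.ideal_prod_mono) auto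
      finally show ?thesis .
    qed
    \<comment> \<open>The outer hypothesis for \<open>h'\<close> leads to the content of
      \<open>h' d = h d - ht d\<close>, which lies in \<open>Q + U I\<close>. The factor
      \<open>T\<close> turns the part with \<open>Q\<close> into \<open>I^k Q\<close>, and the part
      with \<open>U\<close> into a multiple of \<open>T U\<close>, already known to lie in
      \<open>Q\<close>.\<close>
    have TPh': "(T \<cdot>\<^bsub>A\<^esub> ?P k) \<cdot>\<^bsub>A\<^esub> content h' \<subseteq> Z"
    proof (cases k)
      case 0
      have "h' w = \<zero>" for w
        using h dle_zero[OF h(2), of w] 0 by (auto simp: h'_def ht_def component_def FA_minus A.minus_eq A.r_neg)
      then have "content h' \<subseteq> {\<zero>}" by (intro content_least A.zeroideal) auto
      then have "(T \<cdot>\<^bsub>A\<^esub> ?P k) \<cdot>\<^bsub>A\<^esub> content h' \<subseteq> (T \<cdot>\<^bsub>A\<^esub> ?P k) \<cdot>\<^bsub>A\<^esub> {\<zero>}" by (intro A.ideal_prod_mono) auto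
      also have "\<dots> = {\<zero>}" using id idP by (intro A.ideal_prod_zero) auto
      finally show ?thesis using additive_subgroup.zero_closed[OF ideal.axioms(1)[OF idZ]] by blast
    next
      case (Suc l)
      have "dle h' l"
      proof (rule dleI)
        fix w :: "'x list" assume "l < length w"
        then show "h' w = \<zero>"
          using h dle_zero[OF h(2), of w] Suc by (cases "length w = k") (auto simp: h'_def ht_def component_def FA_minus A.minus_eq A.r_neg)
      qed
      then have IH: "?P k \<cdot>\<^bsub>A\<^esub> content h' \<subseteq> ?P l \<cdot>\<^bsub>A\<^esub> content (h' \<otimes>\<^bsub>FA\<^esub> d)"
        unfolding Suc I_def using less.IH[of l h' d] cl d Suc by simp
      have "h' \<otimes>\<^bsub>FA\<^esub> d = (h \<otimes>\<^bsub>FA\<^esub> d) \<ominus>\<^bsub>FA\<^esub> (ht \<otimes>\<^bsub>FA\<^esub> d)"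
        unfolding h'_def using h d cl(3) by algebra
      then have "content (h' \<otimes>\<^bsub>FA\<^esub> d) \<subseteq> Q <+>\<^bsub>A\<^esub> content (ht \<otimes>\<^bsub>FA\<^esub> d)"
        unfolding Q_def using content_minus[OF cl(5), of "ht \<otimes>\<^bsub>FA\<^esub> d"] cl d by simp
      also have "\<dots> \<subseteq> Q <+>\<^bsub>A\<^esub> U \<cdot>\<^bsub>A\<^esub> I"
        using content_mult[OF cl(3) d] by (auto simp: set_add_def' U_def I_def)
      finally have sub: "content (h' \<otimes>\<^bsub>FA\<^esub> d) \<subseteq> Q <+>\<^bsub>A\<^esub> U \<cdot>\<^bsub>A\<^esub> I" .
      have k: "?P k = I \<cdot>\<^bsub>A\<^esub> ?P l" by (simp add: Suc)
      have "(T \<cdot>\<^bsub>A\<^esub> ?P l) \<cdot>\<^bsub>A\<^esub> content (h' \<otimes>\<^bsub>FA\<^esub> d) \<subseteq> Z"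
      proof (rule A.ideal_prod_sum_least[OF _ id(3) _ idZ _ _ sub])
        have "T \<cdot>\<^bsub>A\<^esub> ?P l \<subseteq> ?P k" unfolding k using TI by (intro A.ideal_prod_mono) auto
        then show "(T \<cdot>\<^bsub>A\<^esub> ?P l) \<cdot>\<^bsub>A\<^esub> Q \<subseteq> Z" unfolding Z_def by (intro A.ideal_prod_mono) auto
        have "(T \<cdot>\<^bsub>A\<^esub> ?P l) \<cdot>\<^bsub>A\<^esub> (U \<cdot>\<^bsub>A\<^esub> I) = (T \<cdot>\<^bsub>A\<^esub> ?P k) \<cdot>\<^bsub>A\<^esub> U"
          unfolding k using id idP by (simp add: A.ideal_prod_assoc A.ideal_prod_commute A.ideal_prod_lcomm)
        also have "\<dots> \<subseteq> Z" unfolding Z_def by (rule TPU)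
        finally show "(T \<cdot>\<^bsub>A\<^esub> ?P l) \<cdot>\<^bsub>A\<^esub> (U \<cdot>\<^bsub>A\<^esub> I) \<subseteq> Z" .
      qed (use id idP in auto)
      moreover have "(T \<cdot>\<^bsub>A\<^esub> ?P k) \<cdot>\<^bsub>A\<^esub> content h' \<subseteq> (T \<cdot>\<^bsub>A\<^esub> ?P l) \<cdot>\<^bsub>A\<^esub> content (h' \<otimes>\<^bsub>FA\<^esub> d)"
      proof -
        have "(T \<cdot>\<^bsub>A\<^esub> ?P k) \<cdot>\<^bsub>A\<^esub> content h' = T \<cdot>\<^bsub>A\<^esub> (?P k \<cdot>\<^bsub>A\<^esub> content h')" using id idP by (simp add: A.ideal_prod_assoc)
        also have "\<dots> \<subseteq> T \<cdot>\<^bsub>A\<^esub> (?P l \<cdot>\<^bsub>A\<^esub> content (h' \<otimes>\<^bsub>FA\<^esub> d))" by (rule A.ideal_prod_mono[OF order_refl IH])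
        also have "\<dots> = (T \<cdot>\<^bsub>A\<^esub> ?P l) \<cdot>\<^bsub>A\<^esub> content (h' \<otimes>\<^bsub>FA\<^esub> d)" using id idP cl d by (simp add: A.ideal_prod_assoc)
        finally show ?thesis .
      qed
      ultimately show ?thesis by blast
    qed
    have TPJ: "(T \<cdot>\<^bsub>A\<^esub> ?P k) \<cdot>\<^bsub>A\<^esub> J \<subseteq> Z"
      by (rule A.ideal_prod_sum_least[OF _ id(6,7) idZ TPU[of k, folded Z_def] TPh' JUJ]) (use id idP in simp)
    \<comment> \<open>The inner hypothesis for \<open>d'\<close> leads to the content of
      \<open>h d' = h d - h dt\<close>, contained in \<open>Q + J T\<close>, and
      \<open>T I^k J\<close> has just been treated.\<close>
    have I'J: "A.ideal_pow I' (Suc k) \<cdot>\<^bsub>A\<^esub> J \<subseteq> Z"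
    proof -
      have "d' w = \<zero>" if "m \<le> length w" for w
        using that Suc.prems d by (cases "length w = m") (auto simp: d'_def dt_def component_def FA_minus A.minus_eq A.r_neg)
      then have "A.ideal_pow I' (Suc k) \<cdot>\<^bsub>A\<^esub> J \<subseteq> A.ideal_pow I' k \<cdot>\<^bsub>A\<^esub> content (h \<otimes>\<^bsub>FA\<^esub> d')"
        unfolding I'_def J_def using Suc.IH[OF cl(2)] by simp
      also have "\<dots> \<subseteq> ?P k \<cdot>\<^bsub>A\<^esub> content (h \<otimes>\<^bsub>FA\<^esub> d')"
        using TI(2) by (intro A.ideal_prod_mono A.ideal_pow_mono) auto
      also have "\<dots> \<subseteq> Z"
      proof (rule A.ideal_prod_sum_least[OF idP id(3) _ idZ])
        show "?P k \<cdot>\<^bsub>A\<^esub> Q \<subseteq> Z" by (simp add: Z_def)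
        show "ideal (J \<cdot>\<^bsub>A\<^esub> T) A" using id by simp
        have "?P k \<cdot>\<^bsub>A\<^esub> (J \<cdot>\<^bsub>A\<^esub> T) = (T \<cdot>\<^bsub>A\<^esub> ?P k) \<cdot>\<^bsub>A\<^esub> J"
          using id idP by (simp add: A.ideal_prod_assoc A.ideal_prod_commute A.ideal_prod_lcomm)
        then show "?P k \<cdot>\<^bsub>A\<^esub> (J \<cdot>\<^bsub>A\<^esub> T) \<subseteq> Z" using TPJ by simp
        have "h \<otimes>\<^bsub>FA\<^esub> d' = (h \<otimes>\<^bsub>FA\<^esub> d) \<ominus>\<^bsub>FA\<^esub> (h \<otimes>\<^bsub>FA\<^esub> dt)"
          unfolding d'_def using h d cl(1) by algebra
        then have "content (h \<otimes>\<^bsub>FA\<^esub> d') \<subseteq> Q <+>\<^bsub>A\<^esub> content (h \<otimes>\<^bsub>FA\<^esub> dt)"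
          unfolding Q_def using content_minus[OF cl(5), of "h \<otimes>\<^bsub>FA\<^esub> dt"] cl h by simp
        also have "\<dots> \<subseteq> Q <+>\<^bsub>A\<^esub> J \<cdot>\<^bsub>A\<^esub> T"
          using content_mult[OF h(1) cl(1)] by (auto simp: set_add_def' J_def T_def)
        finally show "content (h \<otimes>\<^bsub>FA\<^esub> d') \<subseteq> Q <+>\<^bsub>A\<^esub> J \<cdot>\<^bsub>A\<^esub> T" .
      qed
      finally show ?thesis .
    qed
    have "J \<cdot>\<^bsub>A\<^esub> ?P (Suc k) \<subseteq> Z"
    proof (rule A.ideal_prod_sum_least[OF id(2) _ _ idZ])
      show "ideal (T \<cdot>\<^bsub>A\<^esub> ?P k) A" "ideal (A.ideal_pow I' (Suc k)) A" using id idP by (simp_all del: A.ideal_pow.simps)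
      show "J \<cdot>\<^bsub>A\<^esub> (T \<cdot>\<^bsub>A\<^esub> ?P k) \<subseteq> Z" using TPJ id idP by (simp add: A.ideal_prod_commute[of J])
      show "J \<cdot>\<^bsub>A\<^esub> A.ideal_pow I' (Suc k) \<subseteq> Z" using I'J id by (simp add: A.ideal_prod_commute[of J] del: A.ideal_pow.simps)
      show "?P (Suc k) \<subseteq> T \<cdot>\<^bsub>A\<^esub> ?P k <+>\<^bsub>A\<^esub> A.ideal_pow I' (Suc k)"
        using A.ideal_sum_pow[OF id(1,5,4) TI ITI] .
    qed
    then have "?P (Suc k) \<cdot>\<^bsub>A\<^esub> J \<subseteq> Z" using id idP by (simp add: A.ideal_prod_commute[of J] del: A.ideal_pow.simps)
    then show ?case unfolding Z_def I_def J_def Q_def .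
  qed
  have "d w = \<zero>" if "Suc (deg d) \<le> length w" for w
    using dle_zero[OF dle_deg[OF less.prems(2)]] that by simp
  then show ?case using main[OF less.prems(1,3,2)] by blast
qed

end

subsection \<open>Bergman's centralizer theorem\<close>

lemma (in cring) ideal_prod_cgenideal:
  assumes "ideal N R" "f \<in> carrier R" "x \<in> N \<cdot> (PIdl f)"
  shows "\<exists>y\<in>N. x = y \<otimes> f"
  using assms(3)
proof (induction rule: ideal_prod.induct)
  case (prod i j)
  then obtain r where r: "r \<in> carrier R" "j = r \<otimes> f" by (auto simp: cgenideal_def)
  have i: "i \<in> carrier R" using prod assms(1) ideal.Icarr by metis
  have "i \<otimes> j = (i \<otimes> r) \<otimes> f" using i r assms by (simp add: m_assoc)
  moreover have "i \<otimes> r \<in> N" using prod(1) r(1) ideal.I_r_closed[OF assms(1)] by blast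
  ultimately show ?case by blast
next
  case (sum s1 s2)
  then obtain y1 y2 where y: "y1 \<in> N" "y2 \<in> N" "s1 = y1 \<otimes> f" "s2 = y2 \<otimes> f" by blast
  then have "s1 \<oplus> s2 = (y1 \<oplus> y2) \<otimes> f"
    using assms ideal.Icarr[OF assms(1)] by (simp add: l_distr)
  moreover have "y1 \<oplus> y2 \<in> N" using y additive_subgroup.a_closed[OF ideal.axioms(1)[OF assms(1)]] by blast
  ultimately show ?case by blast
qed

text \<open>The conclusion says that \<open>y / v\<close> is almost integral.\<close>

lemma (in domain) almost_integral:
  assumes I: "ideal I R" and J: "ideal J R" and Q: "ideal Q R"
    and dm: "ideal_pow I (Suc k) \<cdot> J \<subseteq> ideal_pow I k \<cdot> Q" and Qf: "Q \<subseteq> PIdl f"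
    and f: "f \<in> carrier R" and u: "u \<in> J" "u \<noteq> \<zero>" and v: "v \<in> carrier R"
    and c: "c \<in> carrier R" "c' \<in> carrier R" "c' \<otimes> c = \<one>" and uv: "u \<otimes> v = c \<otimes> f"
    and y: "y \<in> I"
  shows "\<exists>r\<in>carrier R. y [^] (k + j) = r \<otimes> v [^] j"
proof -
  let ?P = "ideal_pow I"
  have id: "ideal (?P n) R" for n using I by simp
  have uc: "u \<in> carrier R" using u J ideal.Icarr by metis
  \<comment> \<open>Multiplied by \<open>u\<close>, an element of \<open>I^(k+1)\<close> lies in
    \<open>I^k f\<close>. As \<open>f\<close> is \<open>u v\<close> up to a unit, \<open>u\<close>
    cancels and the element lies in \<open>I^k v\<close>.\<close>
  have step: "\<exists>y\<in>?P k. x = y \<otimes> v" if x: "x \<in> ?P (Suc k)" for x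
  proof -
    have "x \<otimes> u \<in> ?P (Suc k) \<cdot> J" using x u by (intro ideal_prod.prod)
    then have "x \<otimes> u \<in> ?P k \<cdot> (PIdl f)" using dm ideal_prod_mono[OF order_refl Qf] by blast
    then obtain y where y: "y \<in> ?P k" "x \<otimes> u = y \<otimes> f" using ideal_prod_cgenideal[OF id f] by blast
    have yc: "y \<in> carrier R" using y id ideal.Icarr by metis
    have xc: "x \<in> carrier R" using x id ideal.Icarr by metis
    have "u \<otimes> (c \<otimes> x) = c \<otimes> (x \<otimes> u)" using uc c xc by (simp add: m_ac)
    also have "\<dots> = y \<otimes> (c \<otimes> f)" unfolding y(2) using yc c f by (simp add: m_ac)
    also have "\<dots> = u \<otimes> (y \<otimes> v)" unfolding uv[symmetric] using yc uc v by (simp add: m_ac)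
    finally have cx: "c \<otimes> x = y \<otimes> v" using m_lcancel[OF u(2) uc] c xc yc v by simp
    have "x = c' \<otimes> (c \<otimes> x)" using c xc by (simp add: m_assoc[symmetric])
    also have "\<dots> = (c' \<otimes> y) \<otimes> v" unfolding cx using c yc v by (simp add: m_assoc)
    finally show ?thesis using ideal.I_l_closed[OF id y(1) c(2)] by blast
  qed
  have iter: "\<exists>y\<in>?P k. x = y \<otimes> v [^] j" if "x \<in> ?P (k + j)" for x j
    using that
  proof (induction j arbitrary: x)
    case 0
    then show ?case using ideal.Icarr[OF id] by (intro bexI[of _ x]) auto
  next
    case (Suc j)
    have "x \<in> I \<cdot> ?P (k + j)" using Suc.prems by simp
    then show ?case
    proof (induction rule: ideal_prod.induct)
      case (prod i s)
      obtain y where y: "y \<in> ?P k" "s = y \<otimes> v [^] j" using Suc.IH[OF prod(2)] by blast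
      have "i \<otimes> y \<in> ?P (Suc k)" using prod(1) y(1) by (simp add: ideal_prod.prod)
      then obtain y' where y': "y' \<in> ?P k" "i \<otimes> y = y' \<otimes> v" using step by blast
      have cl: "i \<in> carrier R" "y \<in> carrier R" "y' \<in> carrier R" 
        using prod(1) y(1) y'(1) ideal.Icarr[OF I] ideal.Icarr[OF id] by auto
      have "i \<otimes> s = (i \<otimes> y) \<otimes> v [^] j" unfolding y(2) using cl v by (simp add: m_assoc)
      also have "\<dots> = y' \<otimes> v [^] Suc j" unfolding y'(2) using cl v by (simp add: m_ac)
      finally show ?case using y'(1) by blast
    next
      case (sum s1 s2)
      then obtain y1 y2 where y: "y1 \<in> ?P k" "y2 \<in> ?P k" "s1 = y1 \<otimes> v [^] Suc j" "s2 = y2 \<otimes> v [^] Suc j" by blast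
      then have "s1 \<oplus> s2 = (y1 \<oplus> y2) \<otimes> v [^] Suc j"
        using v ideal.Icarr[OF id] by (simp add: l_distr)
      then show ?case using y additive_subgroup.a_closed[OF ideal.axioms(1)[OF id]] by blast
    qed
  qed
  show ?thesis using iter[OF pow_in_ideal_pow[OF I y]] ideal.Icarr[OF id] by blast
qed

context free_alg
begin

text \<open>The algebra generated by \<open>t\<close> over the coefficients, given by closure
  instead of coefficient lists: properties of its elements are later proved by induction on sums and
  products.\<close>

inductive_set polys :: "('x list \<Rightarrow> 'a) \<Rightarrow> ('x list \<Rightarrow> 'a) set" for t where
  polys_cst: "c \<in> carrier A \<Longrightarrow> cst c \<in> polys t"
| polys_gen: "t \<in> polys t"
| polys_add: "f \<in> polys t \<Longrightarrow> h \<in> polys t \<Longrightarrow> f \<oplus>\<^bsub>FA\<^esub> h \<in> polys t"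
| polys_mult: "f \<in> polys t \<Longrightarrow> h \<in> polys t \<Longrightarrow> f \<otimes>\<^bsub>FA\<^esub> h \<in> polys t"

lemma polys_pow: "t [^]\<^bsub>FA\<^esub> (k::nat) \<in> polys t"
  by (induction k) (auto simp: FA_one_cst intro: polys.intros)

end

context free_alg_root
begin

lemma Cr_pow: "y [^]\<^bsub>Cr\<^esub> (n::nat) = y [^]\<^bsub>FA\<^esub> n"
  by (induction n) auto

text \<open>Once the coefficients of \<open>d\<close> at the nonempty words are known to be scalar
  multiples of \<open>d \<beta>\<close>, the equation \<open>ev d = 0\<close> reads
  \<open>d [] + t d \<beta> = 0\<close> for an element \<open>t\<close> of the free algebra. This
  puts \<open>t d \<beta>\<close> into \<open>C\<close>, and cancelling \<open>d \<beta>\<close>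
  puts \<open>t\<close> there too.\<close>

lemma generator_exists: "\<exists>t\<in>C. t \<noteq> \<zero>\<^bsub>FA\<^esub> \<and> deg t = g"
proof -
  obtain d h f \<alpha> \<beta> c where d: "d \<in> carrier B.FA" "B.dle d g" "\<And>w. ev d w = \<zero>" and h: "h \<in> carrier B.FA"
    and f: "f \<in> C" "f \<noteq> \<zero>\<^bsub>FA\<^esub>" and c: "c \<in> carrier K" "c \<noteq> \<zero>"
    and eq: "B.cst f \<otimes>\<^bsub>B.FA\<^esub> dif a = h \<otimes>\<^bsub>B.FA\<^esub> d"
    and \<alpha>\<beta>: "length \<beta> = g" "d \<beta> \<noteq> \<zero>\<^bsub>FA\<^esub>" "h \<alpha> \<noteq> \<zero>\<^bsub>FA\<^esub>" "h \<alpha> \<otimes>\<^bsub>FA\<^esub> d \<beta> = cst c \<otimes>\<^bsub>FA\<^esub> f"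
    and degs: "\<And>v. v \<noteq> [] \<Longrightarrow> d v \<noteq> \<zero>\<^bsub>FA\<^esub> \<Longrightarrow> deg (d v) \<le> deg (d \<beta>)"
    using gcd_shape by blast
  obtain c' where c': "c' \<in> carrier K" "c' \<otimes> c = \<one>" using K_inverse c by blast
  have cc: "cst c \<in> C" "cst c' \<in> C" "cst c' \<otimes>\<^bsub>FA\<^esub> cst c = \<one>\<^bsub>FA\<^esub>"
    using c c' by (auto simp: cst_cst_mult FA_one_cst)
  have dC: "d v \<in> C" "d v \<in> carrier FA" for v using d(1) by auto
  have fF: "f \<in> carrier FA" using f by auto
  define I where "I = B.content d"
  have I: "ideal I Cr" using d by (simp add: I_def)
  have dI: "d v \<in> I" for v unfolding I_def by (rule B.content_coeff[OF d(1)])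
  have IC: "y \<in> C" if "y \<in> I" for y using ideal.Icarr[OF I that] by simp
  have Q: "B.content (h \<otimes>\<^bsub>B.FA\<^esub> d) \<subseteq> PIdl\<^bsub>Cr\<^esub> f"
  proof (rule B.content_least)
    show "ideal (PIdl\<^bsub>Cr\<^esub> f) Cr" using B.A.cgenideal_ideal[of f] f by simp
    show "(h \<otimes>\<^bsub>B.FA\<^esub> d) w \<in> PIdl\<^bsub>Cr\<^esub> f" for w
      using B.cst_mult[of f "dif a" w] f B_coeff_C[OF dif_closed[OF a_C], of w]
        C_commute[of f "dif a w"]
      unfolding eq[symmetric] by (auto simp: cgenideal_def)
  qed
  have almost: "\<exists>r\<in>C. y [^]\<^bsub>FA\<^esub> (B.deg h + j) = r \<otimes>\<^bsub>FA\<^esub> d \<beta> [^]\<^bsub>FA\<^esub> j" if y: "y \<in> I" for y and j :: nat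
    using B.A.almost_integral[OF I B.content_ideal[OF h] B.content_ideal[OF B.R.m_closed[OF h d(1)]]
        B.dedekind_mertens[OF h d(1) B.dle_deg[OF h], folded I_def] Q, of "h \<alpha>" "d \<beta>" "cst c" "cst c'" y j]
      f cc \<alpha>\<beta> dC y B.content_coeff[OF h, of \<alpha>] by (simp add: Cr_pow)
  \<comment> \<open>No nonzero element of the content ideal has smaller degree than
    \<open>d \<beta>\<close>: by almost integrality
    \<open>j deg (d \<beta>) \<le> (k + j) deg y\<close> for every \<open>j\<close>.\<close>
  have lower: "deg (d \<beta>) \<le> deg y" if y: "y \<in> I" "y \<noteq> \<zero>\<^bsub>FA\<^esub>" for y
  proof (rule ccontr)
    assume "\<not> deg (d \<beta>) \<le> deg y"
    then have lt: "Suc (deg y) \<le> deg (d \<beta>)" by simp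
    define k where "k = B.deg h"
    \<comment> \<open>With \<open>deg y + 1 \<le> deg (d \<beta>)\<close> the inequality gives
      \<open>j \<le> k deg y\<close>, which this \<open>j\<close> exceeds by one.\<close>
    define j where "j = Suc (k * deg y)"
    have yF: "y \<in> carrier FA" using IC y by auto
    obtain r where r: "r \<in> C" "y [^]\<^bsub>FA\<^esub> (k + j) = r \<otimes>\<^bsub>FA\<^esub> d \<beta> [^]\<^bsub>FA\<^esub> j" 
      using almost[OF y(1)] unfolding k_def by blast
    have nz: "y [^]\<^bsub>FA\<^esub> (k + j) \<noteq> \<zero>\<^bsub>FA\<^esub>" by (rule pow_nonzero[OF yF y(2)])
    have dj: "d \<beta> [^]\<^bsub>FA\<^esub> j \<noteq> \<zero>\<^bsub>FA\<^esub>" "d \<beta> [^]\<^bsub>FA\<^esub> j \<in> carrier FA"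
      using pow_nonzero[OF dC(2) \<alpha>\<beta>(2)] dC(2) by auto
    have "r \<noteq> \<zero>\<^bsub>FA\<^esub>" using nz r dj by auto
    then have "deg (y [^]\<^bsub>FA\<^esub> (k + j)) = deg r + j * deg (d \<beta>)"
      unfolding r(2) using FA_integral(2)[OF C_carrier[OF r(1)] dj(2) _ dj(1)] deg_pow[OF dC(2) \<alpha>\<beta>(2)] by simp
    then have "j * deg (d \<beta>) \<le> (k + j) * deg y" using deg_pow[OF yF y(2), of "k + j"] by simp
    moreover have "j * Suc (deg y) \<le> j * deg (d \<beta>)" using lt by (rule mult_le_mono2)
    ultimately show False by (simp add: j_def algebra_simps)
  qed
  have "\<exists>k\<in>carrier K. d v = cst k \<otimes>\<^bsub>FA\<^esub> d \<beta>" if v: "v \<noteq> []" for v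
  proof (cases "d v = \<zero>\<^bsub>FA\<^esub>")
    case True
    then show ?thesis using dC by (intro bexI[of _ \<zero>]) (simp_all add: cst_zero)
  next
    case False
    have dg: "deg (d v) = deg (d \<beta>)" using degs[OF v False] lower[OF dI False] by simp
    have nz: "top (d \<beta>) \<noteq> \<zero>\<^bsub>FA\<^esub>" by (rule top_nonzero[OF dC(2) \<alpha>\<beta>(2)])
    obtain k where k: "k \<in> carrier K" "top (d v) = cst k \<otimes>\<^bsub>FA\<^esub> top (d \<beta>)"
      using proportional[OF top_C[OF dC(1) \<alpha>\<beta>(2)] top_C[OF dC(1) False] homog_comp _ nz] dg homog_comp by metis
    define m where "m = cst (\<ominus> k)"
    have m: "m \<in> C" "m \<in> carrier FA" using k by (auto simp: m_def)
    \<comment> \<open>The combination that cancels the leading forms. It stays in the content ideal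
      and has degree below that of \<open>d \<beta>\<close> unless it is zero, so it is
      zero.\<close>
    define e where "e = d v \<oplus>\<^bsub>FA\<^esub> m \<otimes>\<^bsub>FA\<^esub> d \<beta>"
    have eI: "e \<in> I"
      using additive_subgroup.a_closed[OF ideal.axioms(1)[OF I] dI ideal.I_l_closed[OF I dI, of m]] m by (simp add: e_def)
    have eF: "e \<in> carrier FA" using IC[OF eI] by auto
    have km: "cst k \<oplus>\<^bsub>FA\<^esub> m = \<zero>\<^bsub>FA\<^esub>" using k by (simp add: m_def cst_add A.r_neg cst_zero)
    have "component (deg (d \<beta>)) (m \<otimes>\<^bsub>FA\<^esub> d \<beta>) = m \<otimes>\<^bsub>FA\<^esub> top (d \<beta>)"
      using component_mult[OF m(2) dC(2) dle_cst[of "\<ominus> k", folded m_def] dle_deg[OF dC(2)]]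
      by (simp add: m_def component_hom homog_cst)
    then have "component (deg (d \<beta>)) e = (cst k \<oplus>\<^bsub>FA\<^esub> m) \<otimes>\<^bsub>FA\<^esub> top (d \<beta>)"
      unfolding e_def component_add using k dg dC m by (simp add: R.l_distr)
    then have ce: "component (deg (d \<beta>)) e = \<zero>\<^bsub>FA\<^esub>" using km dC by simp
    have "dle e (deg (d \<beta>))"
      unfolding e_def
    proof (rule dle_add)
      show "dle (d v) (deg (d \<beta>))" using dle_deg[OF dC(2), of v] dg by simp
      show "dle (m \<otimes>\<^bsub>FA\<^esub> d \<beta>) (deg (d \<beta>))" 
        using dle_mult[OF m(2) dC(2) dle_cst[of "\<ominus> k", folded m_def] dle_deg[OF dC(2)]] by simp
    qed
    then have "e = \<zero>\<^bsub>FA\<^esub>" using deg_less[OF eF _ _ ce] lower[OF eI] by force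
    moreover have "d v = e \<oplus>\<^bsub>FA\<^esub> cst k \<otimes>\<^bsub>FA\<^esub> d \<beta>"
    proof -
      have "e \<oplus>\<^bsub>FA\<^esub> cst k \<otimes>\<^bsub>FA\<^esub> d \<beta> = d v \<oplus>\<^bsub>FA\<^esub> (cst k \<oplus>\<^bsub>FA\<^esub> m) \<otimes>\<^bsub>FA\<^esub> d \<beta>"
        unfolding e_def using dC(2) m cst_closed[OF k(1)] by algebra
      then show ?thesis using km dC by simp
    qed
    ultimately show ?thesis using k dC by auto
  qed
  then obtain \<kappa> where \<kappa>: "\<And>v. v \<noteq> [] \<Longrightarrow> \<kappa> v \<in> carrier K \<and> d v = cst (\<kappa> v) \<otimes>\<^bsub>FA\<^esub> d \<beta>" by metis
  \<comment> \<open>The coefficients of \<open>d\<close> at nonempty words are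
    \<open>\<kappa> v\<close> times \<open>d \<beta>\<close>. The empty word gets coefficient 0
    since \<open>d []\<close> is treated apart.\<close>
  define t where "t v = (if v = [] then \<zero> else \<kappa> v)" for v
  have t_nz: "d v \<noteq> \<zero>\<^bsub>FA\<^esub>" "v \<noteq> []" if "t v \<noteq> \<zero>" for v
  proof -
    show v: "v \<noteq> []" using that by (auto simp: t_def)
    have "\<kappa> v \<in> carrier K" "\<kappa> v \<noteq> \<zero>" using that v \<kappa> by (auto simp: t_def)
    moreover have "cst (\<kappa> v) \<noteq> \<zero>\<^bsub>FA\<^esub>" using \<open>\<kappa> v \<noteq> \<zero>\<close> by (metis cst_inject cst_zero)
    ultimately show "d v \<noteq> \<zero>\<^bsub>FA\<^esub>" using \<kappa>[OF v] FA_integral(1)[OF _ dC(2) _ \<alpha>\<beta>(2)] by (metis cst_closed)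
  qed
  have "finite {v. d v \<noteq> \<zero>\<^bsub>Cr\<^esub>}" using d(1) unfolding B.carrier_FA by blast
  then have "finite {v. t v \<noteq> \<zero>}" by (rule rev_finite_subset) (use t_nz in auto)
  moreover have "v \<in> lists S" if "t v \<noteq> \<zero>" for v using B.FA_supp[OF d(1)] t_nz[OF that] by simp
  moreover have "t v \<in> carrier K" for v using \<kappa> by (simp add: t_def)
  ultimately have t: "t \<in> carrier FA" unfolding carrier_FA by blast
  have "(d [] \<oplus>\<^bsub>FA\<^esub> t \<otimes>\<^bsub>FA\<^esub> d \<beta>) w = \<zero>" for w
  proof -
    define H where "H i = (if i = 0 then d [] w else \<zero>)" for i :: nat
    have "ev d w = (\<Oplus>i\<in>{..length w}. H i \<oplus> t (take i w) \<otimes> d \<beta> (drop i w))"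
      unfolding ev_def
    proof (rule A.finsum_cong')
      fix i assume i: "i \<in> {..length w}"
      show "d (take i w) (drop i w) = H i \<oplus> t (take i w) \<otimes> d \<beta> (drop i w)"
      proof (cases "i = 0")
        case True
        then show ?thesis using dC by (simp add: H_def t_def)
      next
        case False
        then have ne: "take i w \<noteq> []" using i by auto
        have "d (take i w) (drop i w) = (cst (\<kappa> (take i w)) \<otimes>\<^bsub>FA\<^esub> d \<beta>) (drop i w)" using \<kappa>[OF ne] by simp
        also have "\<dots> = \<kappa> (take i w) \<otimes> d \<beta> (drop i w)" using \<kappa>[OF ne] dC by (intro cst_mult) auto
        finally show ?thesis using False ne dC \<kappa>[OF ne] by (simp add: H_def t_def)
      qed
    qed (use dC t in \<open>auto simp: H_def\<close>)
    also have "\<dots> = (\<Oplus>i\<in>{..length w}. H i) \<oplus> (t \<otimes>\<^bsub>FA\<^esub> d \<beta>) w"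
      unfolding FA_mult using dC t by (intro A.finsum_addf) (auto simp: H_def)
    also have "(\<Oplus>i\<in>{..length w}. H i) = H 0"
      using dC by (intro A.finsum_single) (auto simp: H_def)
    finally show ?thesis using d(3) by (simp add: H_def FA_add)
  qed
  then have td: "d [] \<oplus>\<^bsub>FA\<^esub> t \<otimes>\<^bsub>FA\<^esub> d \<beta> = \<zero>\<^bsub>FA\<^esub>" by (auto simp: FA_zero)
  have "t \<otimes>\<^bsub>FA\<^esub> d \<beta> = \<ominus>\<^bsub>FA\<^esub> d []"
    using R.minus_equality[of "t \<otimes>\<^bsub>FA\<^esub> d \<beta>" "d []"] td t dC by (simp add: R.a_comm)
  then have tdC: "t \<otimes>\<^bsub>FA\<^esub> d \<beta> \<in> C" using dC by simp
  have "t \<otimes>\<^bsub>FA\<^esub> p = p \<otimes>\<^bsub>FA\<^esub> t"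
  proof (rule FA_r_cancel[OF dC(2) _ _ \<alpha>\<beta>(2)])
    have "(t \<otimes>\<^bsub>FA\<^esub> p) \<otimes>\<^bsub>FA\<^esub> d \<beta> = t \<otimes>\<^bsub>FA\<^esub> (d \<beta> \<otimes>\<^bsub>FA\<^esub> p)"
      using C_commute[OF C_p dC(1), of \<beta>] t dC by (simp add: R.m_assoc)
    also have "\<dots> = p \<otimes>\<^bsub>FA\<^esub> (t \<otimes>\<^bsub>FA\<^esub> d \<beta>)"
      using C_commute[OF C_p tdC] t dC by (simp add: R.m_assoc)
    finally show "(t \<otimes>\<^bsub>FA\<^esub> p) \<otimes>\<^bsub>FA\<^esub> d \<beta> = (p \<otimes>\<^bsub>FA\<^esub> t) \<otimes>\<^bsub>FA\<^esub> d \<beta>"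
      using t dC by (simp add: R.m_assoc)
  qed (use t in auto)
  then have tC: "t \<in> C" using t by (simp add: centralizer_def)
  have \<beta>: "\<beta> \<noteq> []" using \<alpha>\<beta>(1) g_pos by auto
  have "cst (\<kappa> \<beta>) \<noteq> \<zero>\<^bsub>FA\<^esub>" using \<kappa>[OF \<beta>] \<alpha>\<beta>(2) dC by auto
  then have t\<beta>: "t \<beta> \<noteq> \<zero>" using \<beta> by (metis cst_zero t_def)
  have "dle t g" using d(2) t_nz by (auto simp: dle_def B.dle_def)
  then have "deg t = g" using deg_eqI[OF t _ t\<beta> \<alpha>\<beta>(1)] by simp
  moreover have "t \<noteq> \<zero>\<^bsub>FA\<^esub>" using t\<beta> by (auto simp: FA_zero)
  ultimately show ?thesis using tC by blast
qed

end

context free_alg_centralizer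
begin

text \<open>Every degree in \<open>C\<close> is a multiple of \<open>deg t = g\<close>, and leading
  forms of equal degree are proportional; subtracting a scalar multiple of a power of
  \<open>t\<close> thus lowers the degree of any nonscalar element, or makes it zero.\<close>

theorem bergman_centralizer: "\<exists>t\<in>C. 0 < deg t \<and> C \<subseteq> polys t"
proof -
  obtain g a b z \<omega> where *: "0 < g" "\<And>f. f \<in> C \<Longrightarrow> f \<noteq> \<zero>\<^bsub>FA\<^esub> \<Longrightarrow> g dvd deg f"
    "a \<in> C" "b \<in> C" "z \<in> centralizer FA (top p)" "a \<noteq> \<zero>\<^bsub>FA\<^esub>" "b \<noteq> \<zero>\<^bsub>FA\<^esub>" "0 < deg a" 
    "deg b = deg a + g" "homog z g" "z \<omega> = \<one>" "top b = z \<otimes>\<^bsub>FA\<^esub> top a"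
    using leading_root by blast
  interpret free_alg_root K S p g a b z \<omega>
    by unfold_locales (use * in auto)
  obtain t where t: "t \<in> C" "t \<noteq> \<zero>\<^bsub>FA\<^esub>" "deg t = g" using generator_exists by blast
  have tF: "t \<in> carrier FA" using t by auto
  have "f \<in> polys t" if "f \<in> C" for f
    using that
  proof (induction "deg f" arbitrary: f rule: less_induct)
    case less
    note f = less.prems
    have fF: "f \<in> carrier FA" using f by auto
    consider "f = \<zero>\<^bsub>FA\<^esub>" | "deg f = 0" | "f \<noteq> \<zero>\<^bsub>FA\<^esub>" "0 < deg f" by blast
    then show ?case
    proof cases
      case 1
      then show ?thesis using polys_cst[of \<zero> t] by (simp add: cst_zero)
    next
      case 2
      then have "f = cst (f [])" using deg_0_cst[OF fF] dle_deg[OF fF] by simp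
      then show ?thesis using polys_cst[of "f []" t] fF by simp
    next
      case 3
      obtain k where k: "deg f = k * g" using g_dvd[OF f 3(1)] by (metis dvdE mult.commute)
      define T where "T = t [^]\<^bsub>FA\<^esub> k"
      have T: "T \<in> C" "T \<in> carrier FA" "T \<noteq> \<zero>\<^bsub>FA\<^esub>" "deg T = deg f" "T \<in> polys t"
        unfolding T_def using t tF pow_nonzero[OF tF t(2)] deg_pow[OF tF t(2)] k by (auto simp: polys_pow)
      obtain c where c: "c \<in> carrier K" "top f = cst c \<otimes>\<^bsub>FA\<^esub> top T"
        using proportional[OF top_C[OF T(1,3)] top_C[OF f 3(1)] homog_comp _ top_nonzero[OF T(2,3)]] T(4) homog_comp by metis
      have cT: "cst c \<otimes>\<^bsub>FA\<^esub> T \<in> C" "cst c \<otimes>\<^bsub>FA\<^esub> T \<in> carrier FA" using c T by auto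
      define f' where "f' = f \<ominus>\<^bsub>FA\<^esub> cst c \<otimes>\<^bsub>FA\<^esub> T"
      have f': "f' \<in> C" "f' \<in> carrier FA" unfolding f'_def using f fF cT by auto
      have dcT: "dle (cst c \<otimes>\<^bsub>FA\<^esub> T) (deg f)"
        using dle_mult[OF cst_closed[OF c(1)] T(2) dle_cst dle_deg[OF T(2)]] T(4) by simp
      have "component (deg f) (cst c \<otimes>\<^bsub>FA\<^esub> T) = cst c \<otimes>\<^bsub>FA\<^esub> top T"
        using component_mult[OF cst_closed[OF c(1)] T(2) dle_cst dle_deg[OF T(2)]] T(4) by (simp add: component_hom homog_cst)
      then have "component (deg f) f' = \<zero>\<^bsub>FA\<^esub>"
        unfolding f'_def component_minus[OF fF cT(2)] using c T by simp
      then have "f' = \<zero>\<^bsub>FA\<^esub> \<or> deg f' < deg f"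
        using deg_less[OF f'(2)] dle_minus[OF fF cT(2) dle_deg[OF fF] dcT] by (auto simp: f'_def)
      then have f'p: "f' \<in> polys t"
        using less.hyps[OF _ f'(1)] polys_cst[of \<zero> t] by (auto simp: cst_zero)
      have "f = f' \<oplus>\<^bsub>FA\<^esub> cst c \<otimes>\<^bsub>FA\<^esub> T"
        unfolding f'_def using fF cT(2) by algebra
      then show ?thesis using polys_add[OF f'p polys_mult[OF polys_cst[OF c(1)] T(5)]] by simp
    qed
  qed
  then show ?thesis using t g_pos by blast
qed

end

subsection \<open>The sentence\<close>

definition central :: "('a, 'm) ring_scheme \<Rightarrow> 'a \<Rightarrow> bool" where
  "central A x \<longleftrightarrow> (\<forall>y\<in>carrier A. x \<otimes>\<^bsub>A\<^esub> y = y \<otimes>\<^bsub>A\<^esub> x)"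

definition has_value :: "('a, 'm) ring_scheme \<Rightarrow> 'a \<Rightarrow> 'a \<Rightarrow> 'a \<Rightarrow> 'a \<Rightarrow> 'a \<Rightarrow> bool" where
  "has_value A p t f a b \<longleftrightarrow>
    (\<exists>h\<in>carrier A. h \<otimes>\<^bsub>A\<^esub> p = p \<otimes>\<^bsub>A\<^esub> h \<and> f \<oplus>\<^bsub>A\<^esub> a \<otimes>\<^bsub>A\<^esub> h = b \<oplus>\<^bsub>A\<^esub> t \<otimes>\<^bsub>A\<^esub> h)"

definition same_values :: "('a, 'm) ring_scheme \<Rightarrow> 'a \<Rightarrow> 'a \<Rightarrow> 'a \<Rightarrow> 'a \<Rightarrow> 'a \<Rightarrow> 'a \<Rightarrow> bool" where
  "same_values A p q t s f g \<longleftrightarrow> (\<forall>a\<in>carrier A. \<forall>b\<in>carrier A. central A a \<and> central A b \<longrightarrow>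
    (has_value A p t f a b \<longleftrightarrow> has_value A q s g a b))"

definition values_iso :: "('a, 'm) ring_scheme \<Rightarrow> 'a \<Rightarrow> 'a \<Rightarrow> 'a \<Rightarrow> 'a \<Rightarrow> bool" where
  "values_iso A p q t s \<longleftrightarrow>
    (\<forall>f\<in>centralizer A p. \<exists>g\<in>centralizer A q. same_values A p q t s f g) \<and>
    (\<forall>g\<in>centralizer A q. \<exists>f\<in>centralizer A p. same_values A p q t s f g) \<and>
    (\<forall>f\<in>centralizer A p. \<forall>g\<in>centralizer A q. \<forall>g'\<in>centralizer A q.
      same_values A p q t s f g \<and> same_values A p q t s f g' \<longrightarrow> g = g') \<and>
    (\<forall>f\<in>centralizer A p. \<forall>f'\<in>centralizer A p. \<forall>g\<in>centralizer A q.
      same_values A p q t s f g \<and> same_values A p q t s f' g \<longrightarrow> f = f') \<and>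
    same_values A p q t s \<one>\<^bsub>A\<^esub> \<one>\<^bsub>A\<^esub> \<and>
    (\<forall>f\<in>centralizer A p. \<forall>f'\<in>centralizer A p. \<forall>g\<in>centralizer A q. \<forall>g'\<in>centralizer A q.
      same_values A p q t s f g \<and> same_values A p q t s f' g' \<longrightarrow>
      same_values A p q t s (f \<oplus>\<^bsub>A\<^esub> f') (g \<oplus>\<^bsub>A\<^esub> g') \<and>
      same_values A p q t s (f \<otimes>\<^bsub>A\<^esub> f') (g \<otimes>\<^bsub>A\<^esub> g'))"

lemma teval_update: "n \<notin> tvars u \<Longrightarrow> teval A (e(n := a)) u = teval A e u"
  by (induction u) auto

lemma sat_central: "n \<noteq> 11 \<Longrightarrow> sat A e (central_fm (Var n)) \<longleftrightarrow> central A (e n)"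
  by (simp add: central_fm_def commute_fm_def central_def)

lemma sat_same_values:
  assumes "tvars u \<inter> {8, 9, 10} = {}" "tvars v \<inter> {8, 9, 10} = {}"
  shows "sat A e (same_values_fm u v) \<longleftrightarrow>
    same_values A (e 0) (e 1) (e 2) (e 3) (teval A e u) (teval A e v)"
  using assms
  by (simp add: same_values_fm_def value_fm_def commute_fm_def sat_central same_values_def
      has_value_def teval_update) blast

lemma sat_all_in_centralizer:
  "n \<noteq> m \<Longrightarrow> sat A e (all_in_centralizer n m \<phi>) \<longleftrightarrow> (\<forall>a\<in>centralizer A (e m). sat A (e(n := a)) \<phi>)"
  by (auto simp: all_in_centralizer_def commute_fm_def centralizer_def)

lemma sat_ex_in_centralizer:
  "n \<noteq> m \<Longrightarrow> sat A e (ex_in_centralizer n m \<phi>) \<longleftrightarrow> (\<exists>a\<in>centralizer A (e m). sat A (e(n := a)) \<phi>)"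
  by (auto simp: ex_in_centralizer_def commute_fm_def centralizer_def)

lemma sat_Isom:
  "sat A e Isom \<longleftrightarrow> (\<forall>p\<in>carrier A. \<forall>q\<in>carrier A. \<not> central A p \<and> \<not> central A q \<longrightarrow>
    (\<exists>t\<in>carrier A. \<exists>s\<in>carrier A. values_iso A p q t s))"
  by (simp add: Isom_def bijective_fm_def homomorphic_fm_def sat_central sat_same_values
      sat_all_in_centralizer sat_ex_in_centralizer values_iso_def)

lemma fvars_same_values: "fvars (same_values_fm u v) = {0, 1, 2, 3} \<union> (tvars u - {8, 9, 10}) \<union> (tvars v - {8, 9, 10})"
  by (auto simp: same_values_fm_def value_fm_def central_fm_def commute_fm_def)

lemma fvars_in_centralizer:
  "fvars (all_in_centralizer n m \<phi>) = insert m (fvars \<phi>) - {n}"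
  "fvars (ex_in_centralizer n m \<phi>) = insert m (fvars \<phi>) - {n}"
  by (auto simp: all_in_centralizer_def ex_in_centralizer_def commute_fm_def)

lemma sentence_Isom: "sentence Isom"
  unfolding sentence_def Isom_def bijective_fm_def homomorphic_fm_def
  by (simp add: fvars_same_values fvars_in_centralizer central_fm_def commute_fm_def Un_Diff insert_Diff_if)

text \<open>In an arbitrary ring \<open>same_values\<close> need not come from evaluating
  polynomials. The sentence itself asserts that it is the graph of a bijection between the
  centralizers, compatible with one, sums and products.\<close>

lemma values_iso_imp_ring_iso:
  assumes "ring A" "p \<in> carrier A" "q \<in> carrier A" "values_iso A p q t s"
  shows "centralizer_ring A p \<simeq> centralizer_ring A q"
proof -
  interpret ring A by fact
  define sv where "sv = same_values A p q t s"
  let ?P = "centralizer A p" and ?Q = "centralizer A q"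
  have ex: "\<exists>g\<in>?Q. sv f g" if "f \<in> ?P" for f
    using assms(4) that unfolding values_iso_def sv_def by blast
  have sur: "\<exists>f\<in>?P. sv f g" if "g \<in> ?Q" for g
    using assms(4) that unfolding values_iso_def sv_def by blast
  have un: "g = g'" if "f \<in> ?P" "g \<in> ?Q" "g' \<in> ?Q" "sv f g" "sv f g'" for f g g'
    using assms(4) that unfolding values_iso_def sv_def by blast
  have inj: "f = f'" if "f \<in> ?P" "f' \<in> ?P" "g \<in> ?Q" "sv f g" "sv f' g" for f f' g
    using assms(4) that unfolding values_iso_def sv_def by blast
  have one: "sv \<one>\<^bsub>A\<^esub> \<one>\<^bsub>A\<^esub>" using assms(4) unfolding values_iso_def sv_def by blast
  have compat: "sv (f \<oplus>\<^bsub>A\<^esub> f') (g \<oplus>\<^bsub>A\<^esub> g') \<and> sv (f \<otimes>\<^bsub>A\<^esub> f') (g \<otimes>\<^bsub>A\<^esub> g')"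
    if "f \<in> ?P" "f' \<in> ?P" "g \<in> ?Q" "g' \<in> ?Q" "sv f g" "sv f' g'" for f f' g g'
    using assms(4) that unfolding values_iso_def sv_def by blast
  obtain \<phi> where \<phi>: "\<And>f. f \<in> ?P \<Longrightarrow> \<phi> f \<in> ?Q \<and> sv f (\<phi> f)" using ex by metis
  note subP = subringE[OF centralizer_subring[OF assms(2)]]
  note subQ = subringE[OF centralizer_subring[OF assms(3)]]
  have "\<phi> \<in> ring_iso (centralizer_ring A p) (centralizer_ring A q)"
  proof (rule ring_iso_memI)
    fix f f' assume "f \<in> carrier (centralizer_ring A p)" "f' \<in> carrier (centralizer_ring A p)"
    then have f: "f \<in> ?P" "f' \<in> ?P" by (simp_all add: centralizer_ring_def)
    show "\<phi> f \<in> carrier (centralizer_ring A q)" using \<phi> f by (simp add: centralizer_ring_def)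
    have *: "sv (f \<oplus>\<^bsub>A\<^esub> f') (\<phi> f \<oplus>\<^bsub>A\<^esub> \<phi> f')" "sv (f \<otimes>\<^bsub>A\<^esub> f') (\<phi> f \<otimes>\<^bsub>A\<^esub> \<phi> f')"
      using compat \<phi> f by blast+
    have "\<phi> (f \<otimes>\<^bsub>A\<^esub> f') = \<phi> f \<otimes>\<^bsub>A\<^esub> \<phi> f'"
      using un[OF subP(6)[OF f] _ subQ(6) _ *(2)] \<phi> f subP(6)[OF f] by blast
    then show "\<phi> (f \<otimes>\<^bsub>centralizer_ring A p\<^esub> f') = \<phi> f \<otimes>\<^bsub>centralizer_ring A q\<^esub> \<phi> f'"
      by (simp add: centralizer_ring_def)
    have "\<phi> (f \<oplus>\<^bsub>A\<^esub> f') = \<phi> f \<oplus>\<^bsub>A\<^esub> \<phi> f'"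
      using un[OF subP(7)[OF f] _ subQ(7) _ *(1)] \<phi> f subP(7)[OF f] by blast
    then show "\<phi> (f \<oplus>\<^bsub>centralizer_ring A p\<^esub> f') = \<phi> f \<oplus>\<^bsub>centralizer_ring A q\<^esub> \<phi> f'"
      by (simp add: centralizer_ring_def)
  next
    have "\<phi> \<one>\<^bsub>A\<^esub> = \<one>\<^bsub>A\<^esub>" using un[OF subP(3) _ subQ(3) _ one] \<phi>[OF subP(3)] by blast
    then show "\<phi> \<one>\<^bsub>centralizer_ring A p\<^esub> = \<one>\<^bsub>centralizer_ring A q\<^esub>" by (simp add: centralizer_ring_def)
  next
    have "inj_on \<phi> ?P" using inj \<phi> by (metis inj_onI)
    moreover have "\<phi> ` ?P = ?Q"
    proof
      show "\<phi> ` ?P \<subseteq> ?Q" using \<phi> by blast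
      show "?Q \<subseteq> \<phi> ` ?P"
      proof
        fix g assume g: "g \<in> ?Q"
        then obtain f where "f \<in> ?P" "sv f g" using sur by blast
        then have "\<phi> f = g" using un[of f "\<phi> f" g] \<phi> g by blast
        then show "g \<in> \<phi> ` ?P" using \<open>f \<in> ?P\<close> by blast
      qed
    qed
    ultimately show "bij_betw \<phi> (carrier (centralizer_ring A p)) (carrier (centralizer_ring A q))"
      by (simp add: bij_betw_def centralizer_ring_def)
  qed
  then show ?thesis unfolding is_ring_iso_def by blast
qed

text \<open>A central element of positive degree commutes with every generator \<open>u\<close>, so
  its leading form is proportional to a power of \<open>u\<close> and its words of maximal length
  use only the letter \<open>u\<close>. Two different generators leave only the empty word.\<close>

lemma (in free_alg_field) central_iff_cst:
  assumes xy: "x \<in> S" "y \<in> S" "x \<noteq> y" and a: "a \<in> carrier FA"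
  shows "central FA a \<longleftrightarrow> (\<exists>c\<in>carrier K. a = cst c)"
proof
  assume "\<exists>c\<in>carrier K. a = cst c"
  then show "central FA a" using cst_commute by (auto simp: central_def)
next
  assume cen: "central FA a"
  define v where "v u w = (if w = [u] then \<one> else \<zero>)" for u :: 'x and w
  have v: "v u \<in> carrier FA" "homog (v u) 1" "v u \<noteq> \<zero>\<^bsub>FA\<^esub>" "deg (v u) = 1" if "u \<in> S" for u
  proof -
    have "{w. v u w \<noteq> \<zero>} \<subseteq> {[u]}" by (auto simp: v_def)
    then have "finite {w. v u w \<noteq> \<zero>}" by (rule finite_subset) simp
    then show cl: "v u \<in> carrier FA" using that by (auto simp: carrier_FA v_def)
    show h: "homog (v u) 1" by (auto simp: homog_def v_def)
    have "v u [u] \<noteq> \<zero>" by (simp add: v_def)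
    then show "v u \<noteq> \<zero>\<^bsub>FA\<^esub>" by (metis FA_zero)
    show "deg (v u) = 1" using deg_eqI[OF cl homog_dle[OF h] \<open>v u [u] \<noteq> \<zero>\<close>] by simp
  qed
  have "deg a = 0"
  proof (rule ccontr)
    assume d: "deg a \<noteq> 0"
    then have a0: "a \<noteq> \<zero>\<^bsub>FA\<^esub>" using deg_cst[of \<zero>] by (auto simp: cst_zero)
    obtain w where w: "length w = deg a" "a w \<noteq> \<zero>" using deg_witness[OF a a0] by blast
    have only: "set w \<subseteq> {u}" if u: "u \<in> S" for u
    proof -
      interpret U: free_alg_centralizer K S "v u"
        by unfold_locales (use v[OF u] in auto)
      have vv: "v u \<in> centralizer FA (v u)" by (rule R.centralizer_self[OF v(1)[OF u]])
      have "a \<in> centralizer FA (v u)" using cen a v(1)[OF u] by (simp add: central_def centralizer_def)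
      then have ta: "top a \<in> centralizer FA (top (v u))" by (rule U.top_C[OF _ a0])
      have tv: "top (v u) = v u" using component_hom[OF v(2)[OF u]] v(4)[OF u] by simp
      define V where "V = v u [^]\<^bsub>FA\<^esub> deg a"
      have V: "V \<in> centralizer FA (top (v u))" unfolding V_def tv by (rule R.centralizer_pow[OF v(1)[OF u] vv])
      have "homog V (deg a)" using homog_pow[OF v(1,2)[OF u], of "deg a"] by (simp add: V_def)
      moreover have "V \<noteq> \<zero>\<^bsub>FA\<^esub>" unfolding V_def by (rule pow_nonzero[OF v(1,3)[OF u]])
      ultimately obtain c where c: "c \<in> carrier K" "top a = cst c \<otimes>\<^bsub>FA\<^esub> V"
        using U.proportional[OF V ta _ homog_comp] by blast
      have VF: "V \<in> carrier FA" using V by (simp add: centralizer_def)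
      have supp: "set w \<subseteq> {u}" if "(v u [^]\<^bsub>FA\<^esub> (n::nat)) w \<noteq> \<zero>" for n w
        using that
      proof (induction n arbitrary: w)
        case 0
        then show ?case by (simp add: FA_one split: if_splits)
      next
        case (Suc n)
        then obtain w1 w2 where "w = w1 @ w2" "(v u [^]\<^bsub>FA\<^esub> n) w1 \<noteq> \<zero>" "v u w2 \<noteq> \<zero>"
          using FA_mult_nonzero[of "v u [^]\<^bsub>FA\<^esub> n" "v u" w] v(1)[OF u] by auto
        moreover from this have "w2 = [u]" by (simp add: v_def split: if_splits)
        ultimately show ?case using Suc.IH[of w1] by auto
      qed
      have "top a w \<noteq> \<zero>" using w by (simp add: component_def)
      then have "V w \<noteq> \<zero>" unfolding c(2) using c(1) VF by (auto simp: cst_mult)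
      then show ?thesis using supp unfolding V_def by blast
    qed
    have "set w \<subseteq> {x} \<inter> {y}" using only xy by blast
    then have "w = []" using xy(3) by auto
    then show False using w d by simp
  qed
  then have "a = cst (a [])" using deg_0_cst[OF a] dle_deg[OF a] by simp
  then show "\<exists>c\<in>carrier K. a = cst c" using FA_coeff[OF a] by blast
qed

section \<open>Evaluation of elements of a centralizer at scalars\<close>

locale free_alg_generator = free_alg_centralizer K S p
  for K :: "('k, 'm) ring_scheme" (structure) and S :: "'x set" and p +
  fixes t
  assumes t_C: "t \<in> C" and deg_t: "0 < deg t" and C_polys: "C \<subseteq> polys t" 
    and infinite_K: "infinite (carrier K)"
begin

lemma t_closed [simp]: "t \<in> carrier FA"
  using t_C by auto

definition lin :: "'k \<Rightarrow> 'x list \<Rightarrow> 'k" where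
  "lin c = t \<ominus>\<^bsub>FA\<^esub> cst c"

lemma lin_C: "c \<in> carrier K \<Longrightarrow> lin c \<in> C"
  unfolding lin_def using t_C by auto

lemma lin_closed [simp]: "c \<in> carrier K \<Longrightarrow> lin c \<in> carrier FA"
  using lin_C by auto

lemma deg_lin:
  assumes "c \<in> carrier K"
  shows "lin c \<noteq> \<zero>\<^bsub>FA\<^esub>" "0 < deg (lin c)"
proof -
  have "t \<noteq> \<zero>\<^bsub>FA\<^esub>" using deg_t deg_cst[of \<zero>] by (auto simp: cst_zero)
  then obtain w where w: "length w = deg t" "t w \<noteq> \<zero>" using deg_witness t_closed by blast
  then have "lin c w = t w" using assms deg_t by (auto simp: lin_def FA_minus cst_def A.minus_eq)
  then show "lin c \<noteq> \<zero>\<^bsub>FA\<^esub>" using w by (auto simp: FA_zero)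
  have "\<not> dle (lin c) 0"
    using dle_zero[of "lin c" 0 w] \<open>lin c w = t w\<close> w deg_t by auto
  then show "0 < deg (lin c)" using dle_deg[of "lin c"] assms by (cases "deg (lin c)") auto
qed

text \<open>Congruence of \<open>f\<close> and \<open>v\<close> modulo the ideal of \<open>C\<close>
  generated by \<open>t - c\<close>, that is, evaluation of a polynomial in \<open>t\<close> at
  \<open>c\<close>.\<close>

definition is_val :: "('x list \<Rightarrow> 'k) \<Rightarrow> 'k \<Rightarrow> 'k \<Rightarrow> bool" where
  "is_val f c v \<longleftrightarrow> v \<in> carrier K \<and> (\<exists>h\<in>C. f = cst v \<oplus>\<^bsub>FA\<^esub> lin c \<otimes>\<^bsub>FA\<^esub> h)"

text \<open>The formula moves the terms of \<open>f = v + (t - c) h\<close> so that no subtraction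
  occurs, as the language has none.\<close>

lemma has_value_iff:
  assumes "f \<in> C" "c \<in> carrier K" "v \<in> carrier K"
  shows "has_value FA p t f (cst c) (cst v) \<longleftrightarrow> is_val f c v"
proof -
  have "f \<oplus>\<^bsub>FA\<^esub> cst c \<otimes>\<^bsub>FA\<^esub> h = cst v \<oplus>\<^bsub>FA\<^esub> t \<otimes>\<^bsub>FA\<^esub> h \<longleftrightarrow> f = cst v \<oplus>\<^bsub>FA\<^esub> lin c \<otimes>\<^bsub>FA\<^esub> h" 
    if h: "h \<in> carrier FA" for h
  proof
    note cl = C_carrier[OF assms(1)] cst_closed[OF assms(2)] cst_closed[OF assms(3)] t_closed h
    assume "f \<oplus>\<^bsub>FA\<^esub> cst c \<otimes>\<^bsub>FA\<^esub> h = cst v \<oplus>\<^bsub>FA\<^esub> t \<otimes>\<^bsub>FA\<^esub> h"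
    then have "(f \<oplus>\<^bsub>FA\<^esub> cst c \<otimes>\<^bsub>FA\<^esub> h) \<ominus>\<^bsub>FA\<^esub> cst c \<otimes>\<^bsub>FA\<^esub> h = (cst v \<oplus>\<^bsub>FA\<^esub> t \<otimes>\<^bsub>FA\<^esub> h) \<ominus>\<^bsub>FA\<^esub> cst c \<otimes>\<^bsub>FA\<^esub> h"
      by simp
    moreover have "(f \<oplus>\<^bsub>FA\<^esub> cst c \<otimes>\<^bsub>FA\<^esub> h) \<ominus>\<^bsub>FA\<^esub> cst c \<otimes>\<^bsub>FA\<^esub> h = f" using cl by algebra
    moreover have "(cst v \<oplus>\<^bsub>FA\<^esub> t \<otimes>\<^bsub>FA\<^esub> h) \<ominus>\<^bsub>FA\<^esub> cst c \<otimes>\<^bsub>FA\<^esub> h = cst v \<oplus>\<^bsub>FA\<^esub> lin c \<otimes>\<^bsub>FA\<^esub> h"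
      unfolding lin_def using cl by algebra
    ultimately show "f = cst v \<oplus>\<^bsub>FA\<^esub> lin c \<otimes>\<^bsub>FA\<^esub> h" by simp
  next
    note cl = cst_closed[OF assms(2)] cst_closed[OF assms(3)] t_closed h
    assume "f = cst v \<oplus>\<^bsub>FA\<^esub> lin c \<otimes>\<^bsub>FA\<^esub> h"
    then show "f \<oplus>\<^bsub>FA\<^esub> cst c \<otimes>\<^bsub>FA\<^esub> h = cst v \<oplus>\<^bsub>FA\<^esub> t \<otimes>\<^bsub>FA\<^esub> h"
      unfolding lin_def using cl by algebra
  qed
  then show ?thesis using assms(3) by (auto simp: has_value_def is_val_def centralizer_def)
qed

lemma is_val_cst: "d \<in> carrier K \<Longrightarrow> c \<in> carrier K \<Longrightarrow> is_val (cst d) c d"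
  unfolding is_val_def by (auto intro!: bexI[of _ "\<zero>\<^bsub>FA\<^esub>"])

lemma is_val_gen: 
  assumes "c \<in> carrier K" 
  shows "is_val t c c"
proof -
  have "t = cst c \<oplus>\<^bsub>FA\<^esub> lin c \<otimes>\<^bsub>FA\<^esub> \<one>\<^bsub>FA\<^esub>"
    unfolding lin_def using cst_closed[OF assms] t_closed by (simp add: R.minus_eq R.a_lcomm R.r_neg)
  then show ?thesis unfolding is_val_def using assms by blast
qed

lemma is_val_add:
  assumes "is_val f c v" "is_val f' c v'" "c \<in> carrier K"
  shows "is_val (f \<oplus>\<^bsub>FA\<^esub> f') c (v \<oplus> v')"
proof -
  obtain h h' where h: "h \<in> C" "f = cst v \<oplus>\<^bsub>FA\<^esub> lin c \<otimes>\<^bsub>FA\<^esub> h" "h' \<in> C" "f' = cst v' \<oplus>\<^bsub>FA\<^esub> lin c \<otimes>\<^bsub>FA\<^esub> h'"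
    and v: "v \<in> carrier K" "v' \<in> carrier K" using assms by (auto simp: is_val_def)
  have "f \<oplus>\<^bsub>FA\<^esub> f' = (cst v \<oplus>\<^bsub>FA\<^esub> cst v') \<oplus>\<^bsub>FA\<^esub> lin c \<otimes>\<^bsub>FA\<^esub> (h \<oplus>\<^bsub>FA\<^esub> h')"
    unfolding h(2,4) using h(1,3)[THEN C_carrier] v[THEN cst_closed] lin_closed[OF assms(3)] by algebra
  then show ?thesis unfolding is_val_def using h v by (auto simp: cst_add)
qed

lemma is_val_mult:
  assumes "is_val f c v" "is_val f' c v'" "c \<in> carrier K"
  shows "is_val (f \<otimes>\<^bsub>FA\<^esub> f') c (v \<otimes> v')"
proof -
  obtain h h' where h: "h \<in> C" "f = cst v \<oplus>\<^bsub>FA\<^esub> lin c \<otimes>\<^bsub>FA\<^esub> h" "h' \<in> C" "f' = cst v' \<oplus>\<^bsub>FA\<^esub> lin c \<otimes>\<^bsub>FA\<^esub> h'"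
    and v: "v \<in> carrier K" "v' \<in> carrier K" using assms by (auto simp: is_val_def)
  note cl = h(1,3)[THEN C_carrier] v[THEN cst_closed] lin_closed[OF assms(3)]
  have "f \<otimes>\<^bsub>FA\<^esub> f' = cst v \<otimes>\<^bsub>FA\<^esub> cst v' \<oplus>\<^bsub>FA\<^esub> ((cst v \<otimes>\<^bsub>FA\<^esub> lin c) \<otimes>\<^bsub>FA\<^esub> h' \<oplus>\<^bsub>FA\<^esub> lin c \<otimes>\<^bsub>FA\<^esub> (h \<otimes>\<^bsub>FA\<^esub> cst v' \<oplus>\<^bsub>FA\<^esub> h \<otimes>\<^bsub>FA\<^esub> (lin c \<otimes>\<^bsub>FA\<^esub> h')))"
    unfolding h(2,4) using cl by algebra
  also have "cst v \<otimes>\<^bsub>FA\<^esub> lin c = lin c \<otimes>\<^bsub>FA\<^esub> cst v" using v cl by (intro cst_commute) auto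
  also have "cst v \<otimes>\<^bsub>FA\<^esub> cst v' \<oplus>\<^bsub>FA\<^esub> ((lin c \<otimes>\<^bsub>FA\<^esub> cst v) \<otimes>\<^bsub>FA\<^esub> h' \<oplus>\<^bsub>FA\<^esub> lin c \<otimes>\<^bsub>FA\<^esub> (h \<otimes>\<^bsub>FA\<^esub> cst v' \<oplus>\<^bsub>FA\<^esub> h \<otimes>\<^bsub>FA\<^esub> (lin c \<otimes>\<^bsub>FA\<^esub> h')))
    = cst v \<otimes>\<^bsub>FA\<^esub> cst v' \<oplus>\<^bsub>FA\<^esub> lin c \<otimes>\<^bsub>FA\<^esub> (cst v \<otimes>\<^bsub>FA\<^esub> h' \<oplus>\<^bsub>FA\<^esub> (h \<otimes>\<^bsub>FA\<^esub> cst v' \<oplus>\<^bsub>FA\<^esub> h \<otimes>\<^bsub>FA\<^esub> (lin c \<otimes>\<^bsub>FA\<^esub> h')))"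
    using cl by algebra
  finally have "f \<otimes>\<^bsub>FA\<^esub> f' = cst (v \<otimes> v') \<oplus>\<^bsub>FA\<^esub> lin c \<otimes>\<^bsub>FA\<^esub> (cst v \<otimes>\<^bsub>FA\<^esub> h' \<oplus>\<^bsub>FA\<^esub> (h \<otimes>\<^bsub>FA\<^esub> cst v' \<oplus>\<^bsub>FA\<^esub> h \<otimes>\<^bsub>FA\<^esub> (lin c \<otimes>\<^bsub>FA\<^esub> h')))"
    using v by (simp add: cst_cst_mult)
  moreover have "cst v \<otimes>\<^bsub>FA\<^esub> h' \<oplus>\<^bsub>FA\<^esub> (h \<otimes>\<^bsub>FA\<^esub> cst v' \<oplus>\<^bsub>FA\<^esub> h \<otimes>\<^bsub>FA\<^esub> (lin c \<otimes>\<^bsub>FA\<^esub> h')) \<in> C"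
    using h v lin_C[OF assms(3)] by auto
  ultimately show ?thesis unfolding is_val_def using v by blast
qed

text \<open>Scalars and \<open>t\<close> have values, and values respect sums and products, so
  everything generated by them has one.\<close>

lemma is_val_exists: "f \<in> C \<Longrightarrow> c \<in> carrier K \<Longrightarrow> \<exists>v. is_val f c v"
proof -
  assume "f \<in> C" and c: "c \<in> carrier K"
  then have "f \<in> polys t" using C_polys by blast
  then show ?thesis
  proof (induction rule: polys.induct)
    case (polys_cst d)
    then show ?case using is_val_cst c by blast
  next
    case polys_gen
    then show ?case using is_val_gen c by blast
  next
    case (polys_add f h)
    then show ?case using is_val_add[OF _ _ c] by blast
  next
    case (polys_mult f h)
    then show ?case using is_val_mult[OF _ _ c] by blast
  qed
qed

text \<open>A nonzero multiple of \<open>t - c\<close> has positive degree and cannot equal the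
  scalar \<open>v - v'\<close>.\<close>

lemma is_val_unique:
  assumes "is_val f c v" "is_val f c v'" "c \<in> carrier K"
  shows "v = v'"
proof -
  obtain h h' where h: "h \<in> C" "f = cst v \<oplus>\<^bsub>FA\<^esub> lin c \<otimes>\<^bsub>FA\<^esub> h" "h' \<in> C" "f = cst v' \<oplus>\<^bsub>FA\<^esub> lin c \<otimes>\<^bsub>FA\<^esub> h'"
    and v: "v \<in> carrier K" "v' \<in> carrier K" using assms by (auto simp: is_val_def)
  note cl = h(1,3)[THEN C_carrier] v[THEN cst_closed] lin_closed[OF assms(3)]
  define k where "k = h' \<ominus>\<^bsub>FA\<^esub> h"
  have k: "k \<in> carrier FA" using cl by (simp add: k_def)
  have "lin c \<otimes>\<^bsub>FA\<^esub> k = (cst v' \<oplus>\<^bsub>FA\<^esub> lin c \<otimes>\<^bsub>FA\<^esub> h') \<ominus>\<^bsub>FA\<^esub> (cst v \<oplus>\<^bsub>FA\<^esub> lin c \<otimes>\<^bsub>FA\<^esub> h) \<oplus>\<^bsub>FA\<^esub> (cst v \<ominus>\<^bsub>FA\<^esub> cst v')"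
    unfolding k_def using cl by algebra
  also have "\<dots> = cst v \<ominus>\<^bsub>FA\<^esub> cst v'"
    unfolding h(2,4)[symmetric] using cl C_carrier[of f] h v by (simp add: R.minus_eq R.r_neg)
  finally have eq: "lin c \<otimes>\<^bsub>FA\<^esub> k = cst v \<ominus>\<^bsub>FA\<^esub> cst v'" .
  have "k = \<zero>\<^bsub>FA\<^esub>"
  proof (rule ccontr)
    assume "k \<noteq> \<zero>\<^bsub>FA\<^esub>"
    then have "0 < deg (lin c \<otimes>\<^bsub>FA\<^esub> k)" using FA_integral(2)[OF cl(5) k deg_lin(1)[OF assms(3)]] deg_lin(2)[OF assms(3)] by simp
    moreover have "dle (cst v \<ominus>\<^bsub>FA\<^esub> cst v') 0" using cl by (intro dle_minus dle_cst)
    ultimately show False unfolding eq using deg_le by fastforce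
  qed
  then have "cst v \<ominus>\<^bsub>FA\<^esub> cst v' = \<zero>\<^bsub>FA\<^esub>" using eq cl by simp
  then have "cst v = cst v'" using cl by simp
  then show ?thesis by simp
qed

text \<open>A zero \<open>c\<close> splits off the factor \<open>t - c\<close>, and the cofactor has
  smaller degree; any other zero of \<open>f\<close> is a zero of the cofactor.\<close>

lemma finite_zeros:
  assumes "f \<in> C" "f \<noteq> \<zero>\<^bsub>FA\<^esub>"
  shows "finite {c \<in> carrier K. is_val f c \<zero>}"
  using assms
proof (induction "deg f" arbitrary: f rule: less_induct)
  case less
  show ?case
  proof (cases "\<exists>c\<in>carrier K. is_val f c \<zero>")
    case False
    then have "{c \<in> carrier K. is_val f c \<zero>} = {}" by blast
    then show ?thesis by (metis finite.emptyI)
  next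
    case True
    then obtain c h where c: "c \<in> carrier K" and h: "h \<in> C" "f = cst \<zero> \<oplus>\<^bsub>FA\<^esub> lin c \<otimes>\<^bsub>FA\<^esub> h"
      by (auto simp: is_val_def)
    have f: "f = lin c \<otimes>\<^bsub>FA\<^esub> h" using h c by (simp add: cst_zero C_carrier)
    have h0: "h \<noteq> \<zero>\<^bsub>FA\<^esub>" using f less.prems c by auto
    have "deg h < deg f"
      unfolding f using FA_integral(2)[OF lin_closed[OF c] C_carrier[OF h(1)] deg_lin(1)[OF c] h0] deg_lin(2)[OF c] by simp
    then have fin: "finite {c \<in> carrier K. is_val h c \<zero>}" using less.hyps h(1) h0 by blast
    have "{c \<in> carrier K. is_val f c \<zero>} \<subseteq> insert c {c \<in> carrier K. is_val h c \<zero>}"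
    proof
      fix e assume "e \<in> {c \<in> carrier K. is_val f c \<zero>}"
      then have e: "e \<in> carrier K" "is_val f e \<zero>" by auto
      obtain v where v: "is_val h e v" using is_val_exists h e by blast
      \<comment> \<open>The linear factor takes the value \<open>e - c\<close> at \<open>e\<close>,
        so the value of \<open>f\<close> there is this times the value of \<open>h\<close>.\<close>
      have "is_val (t \<oplus>\<^bsub>FA\<^esub> cst (\<ominus> c)) e (e \<oplus> \<ominus> c)"
        using c e by (intro is_val_add is_val_gen is_val_cst) auto
      moreover have "t \<oplus>\<^bsub>FA\<^esub> cst (\<ominus> c) = lin c"
        using c by (auto simp: lin_def FA_add FA_minus cst_def fun_eq_iff A.minus_eq)
      ultimately have "is_val f e ((e \<oplus> \<ominus> c) \<otimes> v)" unfolding f using v e by (auto intro: is_val_mult)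
      then have "(e \<oplus> \<ominus> c) \<otimes> v = \<zero>" using is_val_unique e by blast
      moreover have "v \<in> carrier K" using v by (simp add: is_val_def)
      ultimately have "e \<oplus> \<ominus> c = \<zero> \<or> v = \<zero>" using A.integral c e by simp
      moreover have "e = c" if "e \<oplus> \<ominus> c = \<zero>" using that c e A.r_right_minus_eq[of e c] by (simp add: A.minus_eq)
      ultimately show "e \<in> insert c {c \<in> carrier K. is_val h c \<zero>}" using v e by blast
    qed
    then show ?thesis using fin finite_subset by blast
  qed
qed

text \<open>The difference has the value zero at all scalars, of which there are infinitely
  many.\<close>

lemma values_determine:
  assumes "f \<in> C" "f' \<in> C" "\<And>c. c \<in> carrier K \<Longrightarrow> \<exists>v. is_val f c v \<and> is_val f' c v"
  shows "f = f'"
proof (rule ccontr)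
  assume ne: "f \<noteq> f'"
  \<comment> \<open>The difference is written with sum and product only, so that the rules for
    values apply to it.\<close>
  define e where "e = f \<oplus>\<^bsub>FA\<^esub> cst (\<ominus> \<one>) \<otimes>\<^bsub>FA\<^esub> f'"
  have m: "cst (\<ominus> \<one>) \<in> C" "cst (\<ominus> \<one>) \<oplus>\<^bsub>FA\<^esub> \<one>\<^bsub>FA\<^esub> = \<zero>\<^bsub>FA\<^esub>"
    by (auto simp: FA_one_cst cst_add A.l_neg cst_zero)
  have e: "e \<in> C" using assms m by (simp add: e_def)
  have "e \<noteq> \<zero>\<^bsub>FA\<^esub>"
  proof
    assume "e = \<zero>\<^bsub>FA\<^esub>"
    moreover have "e \<oplus>\<^bsub>FA\<^esub> f' = f \<oplus>\<^bsub>FA\<^esub> (cst (\<ominus> \<one>) \<oplus>\<^bsub>FA\<^esub> \<one>\<^bsub>FA\<^esub>) \<otimes>\<^bsub>FA\<^esub> f'"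
      unfolding e_def using assms(1,2)[THEN C_carrier] m(1)[THEN C_carrier] by (simp add: R.l_distr R.a_assoc)
    ultimately show False using m assms ne by (simp add: C_carrier)
  qed
  then have "finite {c \<in> carrier K. is_val e c \<zero>}" by (rule finite_zeros[OF e])
  moreover have "{c \<in> carrier K. is_val e c \<zero>} = carrier K"
  proof -
    have "is_val e c \<zero>" if c: "c \<in> carrier K" for c
    proof -
      obtain v where v: "is_val f c v" "is_val f' c v" using assms(3) c by blast
      have "is_val e c (v \<oplus> \<ominus> \<one> \<otimes> v)"
        unfolding e_def using v c by (intro is_val_add is_val_mult is_val_cst) auto
      moreover have "v \<oplus> \<ominus> \<one> \<otimes> v = \<zero>" using v by (simp add: is_val_def A.l_minus A.r_neg)
      ultimately show ?thesis by simp
    qed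
    then show ?thesis by blast
  qed
  ultimately show False using infinite_K by simp
qed

end

text \<open>Equality of all values relates each scalar to itself and \<open>t\<close> to
  \<open>s\<close>, and it respects sums and products. By induction over the generated algebras
  every element has a partner on the other side; partners are unique because values determine
  elements. The two generators enter through the centre, which makes the central \<open>a\<close>
  and \<open>b\<close> of the formulas exactly the scalars.\<close>

lemma free_alg_values_iso:
  assumes "free_alg_generator K S p t" "free_alg_generator K S q s" and xy: "x \<in> S" "y \<in> S" "x \<noteq> y"
  shows "values_iso (free_algebra K S) p q t s"
proof -
  interpret P: free_alg_generator K S p t by fact
  interpret Q: free_alg_generator K S q s by fact
  let ?R = "free_algebra K S"
  define eqv where "eqv f g \<longleftrightarrow> (\<forall>c\<in>carrier K. \<exists>v. P.is_val f c v \<and> Q.is_val g c v)" for f g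
  have sv: "same_values ?R p q t s f g \<longleftrightarrow> eqv f g" if f: "f \<in> P.C" and g: "g \<in> Q.C" for f g
  proof
    assume sv: "same_values ?R p q t s f g"
    show "eqv f g"
      unfolding eqv_def
    proof
      fix c assume c: "c \<in> carrier K"
      then obtain v where v: "P.is_val f c v" using P.is_val_exists[OF f] by blast
      then have vK: "v \<in> carrier K" by (simp add: P.is_val_def)
      have "central ?R (P.cst c)" "central ?R (P.cst v)"
        using P.central_iff_cst[OF xy P.cst_closed[OF c], THEN iffD2]
          P.central_iff_cst[OF xy P.cst_closed[OF vK], THEN iffD2] c vK by auto
      then have "has_value ?R p t f (P.cst c) (P.cst v) \<longleftrightarrow> has_value ?R q s g (P.cst c) (P.cst v)"
        using sv P.cst_closed[OF c] P.cst_closed[OF vK] unfolding same_values_def by blast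
      then show "\<exists>v. P.is_val f c v \<and> Q.is_val g c v"
        using v P.has_value_iff[OF f c vK] Q.has_value_iff[OF g c vK] by blast
    qed
  next
    assume eqv: "eqv f g"
    show "same_values ?R p q t s f g"
      unfolding same_values_def
    proof (intro ballI impI)
      fix a b assume a: "a \<in> carrier ?R" and b: "b \<in> carrier ?R" and ab: "central ?R a \<and> central ?R b"
      obtain c where c1: "c \<in> carrier K" "a = P.cst c"
        using P.central_iff_cst[OF xy a, THEN iffD1, OF conjunct1[OF ab]] ..
      obtain v where v1: "v \<in> carrier K" "b = P.cst v"
        using P.central_iff_cst[OF xy b, THEN iffD1, OF conjunct2[OF ab]] ..
      note c = c1(1) v1(1) c1(2) v1(2)
      \<comment> \<open>A common value at \<open>c\<close> exists and values are unique, so either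
        side of the equivalence says that \<open>v\<close> is this value.\<close>
      obtain v' where v': "P.is_val f c v'" "Q.is_val g c v'" using eqv c(1) unfolding eqv_def by blast
      have "P.is_val f c v \<longleftrightarrow> v = v'" using v' P.is_val_unique[OF _ _ c(1)] by blast
      moreover have "Q.is_val g c v \<longleftrightarrow> v = v'" using v' Q.is_val_unique[OF _ _ c(1)] by blast
      ultimately show "has_value ?R p t f a b \<longleftrightarrow> has_value ?R q s g a b"
        unfolding c(3,4) using P.has_value_iff[OF f c(1,2)] Q.has_value_iff[OF g c(1,2)] by simp
    qed
  qed
  have eqv_cst: "eqv (P.cst d) (P.cst d)" if "d \<in> carrier K" for d
    unfolding eqv_def using P.is_val_cst[OF that] Q.is_val_cst[OF that] by blast
  have eqv_gen: "eqv t s"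
    unfolding eqv_def using P.is_val_gen Q.is_val_gen by blast
  have eqv_add: "eqv (f \<oplus>\<^bsub>?R\<^esub> f') (g \<oplus>\<^bsub>?R\<^esub> g')" and eqv_mult: "eqv (f \<otimes>\<^bsub>?R\<^esub> f') (g \<otimes>\<^bsub>?R\<^esub> g')"
    if e: "eqv f g" "eqv f' g'" for f f' g g'
  proof -
    have "(\<exists>v. P.is_val (f \<oplus>\<^bsub>?R\<^esub> f') c v \<and> Q.is_val (g \<oplus>\<^bsub>?R\<^esub> g') c v) \<and>
        (\<exists>v. P.is_val (f \<otimes>\<^bsub>?R\<^esub> f') c v \<and> Q.is_val (g \<otimes>\<^bsub>?R\<^esub> g') c v)" if c: "c \<in> carrier K" for c
    proof -
      obtain v where v: "P.is_val f c v" "Q.is_val g c v" using e(1) c unfolding eqv_def by blast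
      obtain v' where v': "P.is_val f' c v'" "Q.is_val g' c v'" using e(2) c unfolding eqv_def by blast
      show ?thesis
        using P.is_val_add[OF v(1) v'(1) c] Q.is_val_add[OF v(2) v'(2) c]
          P.is_val_mult[OF v(1) v'(1) c] Q.is_val_mult[OF v(2) v'(2) c] by blast
    qed
    then show "eqv (f \<oplus>\<^bsub>?R\<^esub> f') (g \<oplus>\<^bsub>?R\<^esub> g')" "eqv (f \<otimes>\<^bsub>?R\<^esub> f') (g \<otimes>\<^bsub>?R\<^esub> g')"
      unfolding eqv_def by blast+
  qed
  have "\<exists>g\<in>Q.C. eqv f g" if "f \<in> P.polys t" for f
    using that
  proof (induction rule: P.polys.induct)
    case (polys_cst d)
    then show ?case using eqv_cst Q.C_cst by blast
  next
    case polys_gen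
    then show ?case using eqv_gen Q.t_C by blast
  next
    case (polys_add f h)
    then show ?case using eqv_add Q.C_ops(5) by blast
  next
    case (polys_mult f h)
    then show ?case using eqv_mult Q.C_ops(4) by blast
  qed
  then have 1: "\<exists>g\<in>Q.C. eqv f g" if "f \<in> P.C" for f
    using that P.C_polys by blast
  have "\<exists>f\<in>P.C. eqv f g" if "g \<in> P.polys s" for g
    using that
  proof (induction rule: P.polys.induct)
    case (polys_cst d)
    then show ?case using eqv_cst P.C_cst by blast
  next
    case polys_gen
    then show ?case using eqv_gen P.t_C by blast
  next
    case (polys_add f h)
    then show ?case using eqv_add P.C_ops(5) by blast
  next
    case (polys_mult f h)
    then show ?case using eqv_mult P.C_ops(4) by blast
  qed
  then have 2: "\<exists>f\<in>P.C. eqv f g" if "g \<in> Q.C" for g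
    using that Q.C_polys by blast
  have 3: "g = g'" if "f \<in> P.C" "g \<in> Q.C" "g' \<in> Q.C" and e: "eqv f g" "eqv f g'" for f g g'
  proof (rule Q.values_determine[OF that(2,3)])
    fix c assume c: "c \<in> carrier K"
    obtain v v' where "P.is_val f c v" "Q.is_val g c v" "P.is_val f c v'" "Q.is_val g' c v'"
      using e c unfolding eqv_def by blast
    then show "\<exists>v. Q.is_val g c v \<and> Q.is_val g' c v" using P.is_val_unique[OF _ _ c] by blast
  qed
  have 4: "f = f'" if "f \<in> P.C" "f' \<in> P.C" "g \<in> Q.C" and e: "eqv f g" "eqv f' g" for f f' g
  proof (rule P.values_determine[OF that(1,2)])
    fix c assume c: "c \<in> carrier K"
    obtain v v' where "P.is_val f c v" "Q.is_val g c v" "P.is_val f' c v'" "Q.is_val g c v'"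
      using e c unfolding eqv_def by blast
    then show "\<exists>v. P.is_val f c v \<and> P.is_val f' c v" using Q.is_val_unique[OF _ _ c] by blast
  qed
  have 5: "eqv \<one>\<^bsub>?R\<^esub> \<one>\<^bsub>?R\<^esub>" unfolding P.FA_one_cst by (rule eqv_cst) simp
  show ?thesis
    unfolding values_iso_def
  proof (intro conjI ballI impI)
    show "\<exists>g\<in>Q.C. same_values ?R p q t s f g" if "f \<in> P.C" for f
      using 1[OF that] sv[OF that] by blast
    show "\<exists>f\<in>P.C. same_values ?R p q t s f g" if "g \<in> Q.C" for g
      using 2[OF that] sv[OF _ that] by blast
    show "g = g'" if "f \<in> P.C" "g \<in> Q.C" "g' \<in> Q.C"
      "same_values ?R p q t s f g \<and> same_values ?R p q t s f g'" for f g g'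
      using 3[OF that(1-3)] that(4) sv[OF that(1,2)] sv[OF that(1,3)] by blast
    show "f = f'" if "f \<in> P.C" "f' \<in> P.C" "g \<in> Q.C"
      "same_values ?R p q t s f g \<and> same_values ?R p q t s f' g" for f f' g
      using 4[OF that(1-3)] that(4) sv[OF that(1,3)] sv[OF that(2,3)] by blast
    show "same_values ?R p q t s \<one>\<^bsub>?R\<^esub> \<one>\<^bsub>?R\<^esub>"
      using 5 sv[OF P.C_ops(2) Q.C_ops(2)] by blast
    show "same_values ?R p q t s (f \<oplus>\<^bsub>?R\<^esub> f') (g \<oplus>\<^bsub>?R\<^esub> g')" "same_values ?R p q t s (f \<otimes>\<^bsub>?R\<^esub> f') (g \<otimes>\<^bsub>?R\<^esub> g')"
      if f: "f \<in> P.C" "f' \<in> P.C" and g: "g \<in> Q.C" "g' \<in> Q.C"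
        and e: "same_values ?R p q t s f g \<and> same_values ?R p q t s f' g'" for f f' g g'
    proof -
      have "eqv f g" "eqv f' g'" using e sv[OF f(1) g(1)] sv[OF f(2) g(2)] by blast+
      then show "same_values ?R p q t s (f \<oplus>\<^bsub>?R\<^esub> f') (g \<oplus>\<^bsub>?R\<^esub> g')" "same_values ?R p q t s (f \<otimes>\<^bsub>?R\<^esub> f') (g \<otimes>\<^bsub>?R\<^esub> g')"
        using eqv_add eqv_mult sv[OF P.C_ops(5)[OF f] Q.C_ops(5)[OF g]] sv[OF P.C_ops(4)[OF f] Q.C_ops(4)[OF g]] by blast+
    qed
  qed
qed

text \<open>Scalars are central, so a non-central element has positive degree and the centralizer
  theorem supplies a generator \<open>t\<close> of its centralizer.\<close>

lemma free_algebra_models_Isom: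
  assumes "field K" "infinite (carrier K)" and xy: "x \<in> S" "y \<in> S" "x \<noteq> y"
  shows "models (free_algebra K S) Isom"
proof -
  interpret field K by fact
  interpret free_alg_field K S by unfold_locales
  have gen: "\<exists>t. free_alg_generator K S p t" if p: "p \<in> carrier FA" "\<not> central FA p" for p
  proof -
    have "0 < deg p"
    proof (rule ccontr)
      assume "\<not> 0 < deg p"
      then have "p = cst (p [])" using deg_0_cst[OF p(1)] dle_deg[OF p(1)] by simp
      then show False using p central_iff_cst[OF xy p(1)] FA_coeff[OF p(1)] by blast
    qed
    then interpret free_alg_centralizer K S p by unfold_locales (use p in auto)
    obtain t where "t \<in> C" "0 < deg t" "C \<subseteq> polys t" using bergman_centralizer by blast
    then have "free_alg_generator K S p t" by unfold_locales (use assms in auto)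
    then show ?thesis by blast
  qed
  have "values_iso FA p q t s \<and> t \<in> carrier FA \<and> s \<in> carrier FA" 
    if "free_alg_generator K S p t" "free_alg_generator K S q s" for p q t s
    using free_alg_values_iso[OF that xy] free_alg_generator.t_closed[OF that(1)] free_alg_generator.t_closed[OF that(2)] by blast
  then show ?thesis unfolding models_def sat_Isom using gen by meson
qed

theorem theorem6p11:
  shows "sentence Isom \<and>
    (\<forall>(K :: ('k, 'm) ring_scheme) (S :: 'x set).
       field K \<and> infinite (carrier K) \<and> (\<exists>x\<in>S. \<exists>y\<in>S. x \<noteq> y)
         \<longrightarrow> models (free_algebra K S) Isom) \<and>
    (\<forall>A :: ('a, 'n) ring_scheme.
       ring A \<and> models A Isom
         \<longrightarrow> (\<forall>P\<in>carrier A. \<forall>Q\<in>carrier A.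
               centralizer A P \<noteq> carrier A \<and> centralizer A Q \<noteq> carrier A
                 \<longrightarrow> centralizer_ring A P \<simeq> centralizer_ring A Q))"
proof (intro conjI allI impI ballI)
  show "sentence Isom" by (rule sentence_Isom)
next
  fix K :: "('k, 'm) ring_scheme" and S :: "'x set"
  assume *: "field K \<and> infinite (carrier K) \<and> (\<exists>x\<in>S. \<exists>y\<in>S. x \<noteq> y)"
  then obtain x y where xy: "x \<in> S" "y \<in> S" "x \<noteq> y" by blast
  show "models (free_algebra K S) Isom"
    by (rule free_algebra_models_Isom[OF _ _ xy]) (use * in simp_all)
next
  fix A :: "('a, 'n) ring_scheme" and P Q
  assume A: "ring A \<and> models A Isom" and P: "P \<in> carrier A" and Q: "Q \<in> carrier A"
    and ne: "centralizer A P \<noteq> carrier A \<and> centralizer A Q \<noteq> carrier A"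
  have nc: "\<not> central A y" if "centralizer A y \<noteq> carrier A" for y
    using that by (auto simp: central_def centralizer_def)
  \<comment> \<open>An assignment into the carrier is required to use \<open>models\<close>; the
    constant one at \<open>P\<close> is at hand.\<close>
  have "sat A (\<lambda>_. P) Isom" using A P by (simp add: models_def)
  then have "\<exists>t\<in>carrier A. \<exists>s\<in>carrier A. values_iso A P Q t s"
    unfolding sat_Isom by (elim ballE[of _ _ P] ballE[of _ _ Q]) (use P Q ne nc in auto)
  then obtain t s where "values_iso A P Q t s" by blast
  then show "centralizer_ring A P \<simeq> centralizer_ring A Q"
    by (rule values_iso_imp_ring_iso[OF conjunct1[OF A] P Q])
qed

end
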